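(* Let $C_c^\infty(H_p^\circ\backslash G_p/G_p^\circ)$ be the space of compactly supported functions $f:G_p\to\mathbf{C}$ that are invariant under left translation by the diagonally embedded $H_p^\circ$ and under right translation by $G_p^\circ$. Regard it as a module over $\mathcal{H}^\circ_{G_p}\otimes\mathcal{H}^\circ_{H_p}$ via $$((\theta_1\otimes\theta_2)\cdot f)(x)=\int_{G_p}\int_{H_p}\theta_1(g)\theta_2(h)f(h^{-1}xg)\,dh\,dg .$$ Then this module is cyclic, generated by the characteristic function $\mathrm{ch}(G_p^\circ)$.
   Context: Let $p$ be a prime, $H_p=\mathrm{GL}_2(\mathbf{Q}_p)$, $H_p^\circ=\mathrm{GL}_2(\mathbf{Z}_p)$, $G_p=H_p\times H_p$, $G_p^\circ=H_p^\circ\times H_p^\circ$, with $H_p$ embedded in $G_p$ diagonally via $h\mapsto (h,h)$. Haar measures $dh$ on $H_p$ and $dg$ on $G_p$ are normalized to give $H_p^\circ$ and $G_p^\circ$ volume $1$. For $\Gamma\in\{H_p,G_p\}$ with maximal compact $\Gamma^\circ\in\{H_p^\circ,G_p^\circ\}$, $\mathcal{H}^\circ_{\Gamma}$ denotes the spherical Hecke algebra of compactly supported $\Gamma^\circ$-bi-invariant $\mathbf{C}$-valued functions on $\Gamma$ under convolution $(\theta_1\cdot\theta_2)(x)=\int_\Gamma\theta_1(\gamma)\theta_2(\gamma^{-1}x)\,d\gamma$. *)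

theory Defs
  imports
    "HOL-Analysis.Analysis"
    "HOL-Algebra.Module"
    "Berlekamp_Zassenhaus.Finite_Field"
begin

section \<open>The \<open>p\<close>-adic absolute value on the rationals\<close>

definition padic_abs :: "nat \<Rightarrow> rat \<Rightarrow> real" where
  "padic_abs p x = (if x = 0 then 0
     else (case quotient_of x of (a, b) \<Rightarrow>
       real p powi (int (multiplicity (int p) b) - int (multiplicity (int p) a))))"

context
  fixes p :: nat
  assumes p: "prime p"
begin

lemma padic_abs_frac:
  assumes "a \<noteq> 0" "b \<noteq> 0"
  shows "padic_abs p (of_int a / of_int b) =
    real p powi (int (multiplicity (int p) b) - int (multiplicity (int p) a))"
proof -
  obtain c d where cd: "quotient_of (of_int a / of_int b) = (c, d)" by force
  have d: "d > 0" using cd quotient_of_denom_pos by blast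
  have eq: "of_int a / of_int b = (of_int c / of_int d :: rat)" using cd quotient_of_div by blast
  have c: "c \<noteq> 0" using eq assms d by auto
  have "(of_int (a * d) :: rat) = of_int (c * b)"
    using eq assms d by (simp add: field_simps)
  then have "a * d = c * b" by (simp only: of_int_eq_iff)
  then have "multiplicity (int p) (a * d) = multiplicity (int p) (c * b)" by simp
  moreover have "prime_elem (int p)" using p by auto
  ultimately have "multiplicity (int p) a + multiplicity (int p) d
      = multiplicity (int p) c + multiplicity (int p) b"
    using assms c d by (simp add: prime_elem_multiplicity_mult_distrib)
  then have "int (multiplicity (int p) d) - int (multiplicity (int p) c)
      = int (multiplicity (int p) b) - int (multiplicity (int p) a)" by linarith
  then show ?thesis using assms by (simp add: padic_abs_def cd)
qed

lemma rat_fracE: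
  obtains a b :: int where "(x::rat) = of_int a / of_int b" "b \<noteq> 0"
  by (metis less_irrefl quotient_of_denom_pos quotient_of_div surj_pair)

lemma padic_abs_0 [simp]: "padic_abs p 0 = 0"
  by (simp add: padic_abs_def)

lemma padic_abs_1 [simp]: "padic_abs p 1 = 1"
  using padic_abs_frac[of 1 1] by simp

lemma padic_abs_pos: "x \<noteq> 0 \<Longrightarrow> padic_abs p x > 0"
  using p prime_gt_0_nat by (auto simp: padic_abs_def split: prod.splits)

lemma padic_abs_nonneg [simp]: "padic_abs p x \<ge> 0"
  using padic_abs_pos[of x] by (cases "x = 0") auto

lemma padic_abs_eq_0_iff [simp]: "padic_abs p x = 0 \<longleftrightarrow> x = 0"
  using padic_abs_pos[of x] by (cases "x = 0") auto

lemma padic_abs_mult: "padic_abs p (x * y) = padic_abs p x * padic_abs p y"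
proof (cases "x = 0 \<or> y = 0")
  case False
  obtain a b where ab: "x = of_int a / of_int b" "b \<noteq> 0" by (rule rat_fracE)
  obtain c d where cd: "y = of_int c / of_int d" "d \<noteq> 0" by (rule rat_fracE)
  have nz: "a \<noteq> 0" "c \<noteq> 0" using False ab cd by auto
  have xy: "x * y = of_int (a * c) / of_int (b * d)" using ab cd by simp
  have "prime_elem (int p)" using p by auto
  moreover have "real p \<noteq> 0" using p by auto
  ultimately show ?thesis
    unfolding xy using nz ab cd
    by (simp add: padic_abs_frac prime_elem_multiplicity_mult_distrib
        flip: power_int_add del: of_int_mult) (simp add: algebra_simps)
qed auto

lemma padic_abs_minus [simp]: "padic_abs p (- x) = padic_abs p x"
proof -
  have "padic_abs p (-1) = 1" using padic_abs_frac[of "-1" 1] by (simp add: multiplicity_unit_right)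
  then show ?thesis using padic_abs_mult[of "-1" x] by simp
qed

lemma padic_abs_minus_commute: "padic_abs p (x - y) = padic_abs p (y - x)"
  using padic_abs_minus[of "x - y"] by simp

lemma padic_abs_inverse: "padic_abs p (inverse x) = inverse (padic_abs p x)"
proof (cases "x = 0")
  case False
  then have "padic_abs p x * padic_abs p (inverse x) = 1"
    using padic_abs_mult[of x "inverse x"] by simp
  then show ?thesis by (metis inverse_unique)
qed auto

lemma padic_abs_ultrametric: "padic_abs p (x + y) \<le> max (padic_abs p x) (padic_abs p y)"
proof (cases "x = 0 \<or> y = 0 \<or> x + y = 0")
  case False
  obtain a b where ab: "x = of_int a / of_int b" "b \<noteq> 0" by (rule rat_fracE)
  obtain c d where cd: "y = of_int c / of_int d" "d \<noteq> 0" by (rule rat_fracE)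
  let ?v = "multiplicity (int p)"
  define m where "m = b * d"
  have x: "x = of_int (a * d) / of_int m" and y: "y = of_int (c * b) / of_int m"
    and s: "x + y = of_int (a * d + c * b) / of_int m"
    using ab cd by (simp_all add: m_def field_simps)
  have nz: "a * d \<noteq> 0" "c * b \<noteq> 0" "m \<noteq> 0" using False ab cd by (auto simp: m_def)
  have nzs: "a * d + c * b \<noteq> 0" using False s by (auto simp flip: of_int_add of_int_mult)
  have "\<not> is_unit (int p)" using p by auto
  then have "min (?v (a * d)) (?v (c * b)) \<le> ?v (a * d + c * b)"
    using nzs by (intro multiplicity_geI dvd_add) (auto intro!: multiplicity_dvd')
  moreover have "real p \<ge> 1" using p prime_ge_1_nat by auto
  ultimately have "real p powi (int (?v m) - int (?v (a * d + c * b)))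
      \<le> real p powi (int (?v m) - int (?v (a * d))) \<or>
    real p powi (int (?v m) - int (?v (a * d + c * b)))
      \<le> real p powi (int (?v m) - int (?v (c * b)))"
    by (auto simp: min_def split: if_splits intro!: power_int_increasing)
  then show ?thesis
    unfolding s using padic_abs_frac[OF nz(1,3)] padic_abs_frac[OF nz(2,3)]
      padic_abs_frac[OF nzs nz(3)] x y by auto
qed (auto simp: le_max_iff_disj)

lemma padic_abs_triangle: "padic_abs p (x + y) \<le> padic_abs p x + padic_abs p y"
  using padic_abs_ultrametric[of x y] padic_abs_nonneg[of x] padic_abs_nonneg[of y] by linarith

lemma padic_abs_diff_bound: "\<bar>padic_abs p x - padic_abs p y\<bar> \<le> padic_abs p (x - y)"
  using padic_abs_triangle[of "x - y" y] padic_abs_triangle[of "y - x" x]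
    padic_abs_minus_commute[of x y] by simp

end


section \<open>The field of \<open>p\<close>-adic numbers, as the completion of the rationals\<close>

definition padic_cauchy :: "nat \<Rightarrow> (nat \<Rightarrow> rat) \<Rightarrow> bool" where
  "padic_cauchy p X \<longleftrightarrow> (\<forall>e>0. \<exists>N. \<forall>m\<ge>N. \<forall>n\<ge>N. padic_abs p (X m - X n) < e)"

definition padic_null :: "nat \<Rightarrow> (nat \<Rightarrow> rat) \<Rightarrow> bool" where
  "padic_null p X \<longleftrightarrow> (\<lambda>n. padic_abs p (X n)) \<longlonglongrightarrow> 0"

definition padic_rel :: "nat \<Rightarrow> (nat \<Rightarrow> rat) \<Rightarrow> (nat \<Rightarrow> rat) \<Rightarrow> bool" where
  "padic_rel p X Y \<longleftrightarrow> padic_cauchy p X \<and> padic_cauchy p Y \<and> padic_null p (\<lambda>n. X n - Y n)"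

context
  fixes p :: nat
  assumes p: "prime p"
begin

lemma padic_cauchy_dominated:
  assumes "padic_cauchy p X" "padic_cauchy p Y" "C > 0"
    and "\<And>m n. m \<ge> M \<Longrightarrow> n \<ge> M \<Longrightarrow> padic_abs p (Z m - Z n)
      \<le> C * padic_abs p (X m - X n) + C * padic_abs p (Y m - Y n)"
  shows "padic_cauchy p Z"
  unfolding padic_cauchy_def
proof (intro allI impI)
  fix e :: real assume "e > 0"
  then have e: "e / (2 * C) > 0" using assms by simp
  obtain i where i: "\<And>m n. m \<ge> i \<Longrightarrow> n \<ge> i \<Longrightarrow> padic_abs p (X m - X n) < e / (2 * C)"
    using assms(1) e unfolding padic_cauchy_def by blast
  obtain j where j: "\<And>m n. m \<ge> j \<Longrightarrow> n \<ge> j \<Longrightarrow> padic_abs p (Y m - Y n) < e / (2 * C)"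
    using assms(2) e unfolding padic_cauchy_def by blast
  have "padic_abs p (Z m - Z n) < e" if "m \<ge> max M (max i j)" "n \<ge> max M (max i j)" for m n
  proof -
    have "C * padic_abs p (X m - X n) < C * (e / (2 * C))"
      and "C * padic_abs p (Y m - Y n) < C * (e / (2 * C))"
      using i[of m n] j[of m n] that assms(3) by (intro mult_strict_left_mono; simp)+
    moreover have "C * (e / (2 * C)) = e / 2" using assms(3) by simp
    ultimately show ?thesis using assms(4)[of m n] that by linarith
  qed
  then show "\<exists>N. \<forall>m\<ge>N. \<forall>n\<ge>N. padic_abs p (Z m - Z n) < e" by blast
qed

lemma padic_null_dominated:
  assumes "padic_null p X" "padic_null p Y"
    and "\<And>n. n \<ge> M \<Longrightarrow> padic_abs p (Z n) \<le> C * padic_abs p (X n) + C * padic_abs p (Y n)"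
  shows "padic_null p Z"
  unfolding padic_null_def
proof (rule tendsto_sandwich[where f = "\<lambda>_. 0"])
  show "(\<lambda>n. C * padic_abs p (X n) + C * padic_abs p (Y n)) \<longlonglongrightarrow> 0"
    using assms(1,2) unfolding padic_null_def by (auto intro!: tendsto_eq_intros)
  show "\<forall>\<^sub>F n in sequentially. padic_abs p (Z n) \<le> C * padic_abs p (X n) + C * padic_abs p (Y n)"
    using assms(3) eventually_at_top_linorder by blast
qed (auto simp: p)

lemma padic_cauchy_const [simp]: "padic_cauchy p (\<lambda>_. c)"
  by (simp add: padic_cauchy_def padic_abs_0[OF p])

lemma padic_cauchy_add:
  assumes "padic_cauchy p X" "padic_cauchy p Y"
  shows "padic_cauchy p (\<lambda>n. X n + Y n)"
  using padic_abs_triangle[OF p, of "X m - X n" "Y m - Y n" for m n]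
  by (intro padic_cauchy_dominated[OF assms zero_less_one, of 0]) (simp add: add_diff_add)

lemma padic_cauchy_minus:
  assumes "padic_cauchy p X"
  shows "padic_cauchy p (\<lambda>n. - X n)"
proof -
  have "padic_abs p (- X m - - X n) = padic_abs p (X m - X n)" for m n
    using padic_abs_minus_commute[OF p, of "X n" "X m"] by simp
  then show ?thesis using assms unfolding padic_cauchy_def by simp
qed

lemma padic_cauchy_convergent:
  assumes "padic_cauchy p X"
  shows "convergent (\<lambda>n. padic_abs p (X n))"
proof -
  have "Cauchy (\<lambda>n. padic_abs p (X n))"
    unfolding Cauchy_def dist_real_def
    using assms padic_abs_diff_bound[OF p] unfolding padic_cauchy_def by (meson order_le_less_trans)
  then show ?thesis by (simp add: Cauchy_convergent_iff)
qed

lemma padic_cauchy_bounded: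
  assumes "padic_cauchy p X"
  obtains B where "B > 0" "\<And>n. padic_abs p (X n) \<le> B"
proof -
  have "Bseq (\<lambda>n. padic_abs p (X n))"
    using padic_cauchy_convergent[OF assms] by (rule convergent_imp_Bseq)
  then obtain B where "B > 0" "\<And>n. norm (padic_abs p (X n)) \<le> B"
    unfolding Bseq_def by blast
  then show ?thesis using that by (simp add: p)
qed

lemma padic_abs_mult_diff:
  assumes "padic_abs p x \<le> A" "padic_abs p y' \<le> B"
  shows "padic_abs p (x * y - x' * y')
    \<le> max A B * padic_abs p (x - x') + max A B * padic_abs p (y - y')"
proof -
  have "padic_abs p (x * y - x' * y') = padic_abs p ((x - x') * y' + x * (y - y'))"
    by (simp add: algebra_simps)
  also have "\<dots> \<le> padic_abs p ((x - x') * y') + padic_abs p (x * (y - y'))"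
    by (rule padic_abs_triangle[OF p])
  also have "\<dots> = padic_abs p y' * padic_abs p (x - x') + padic_abs p x * padic_abs p (y - y')"
    by (simp add: padic_abs_mult p)
  also have "\<dots> \<le> max A B * padic_abs p (x - x') + max A B * padic_abs p (y - y')"
    using assms by (intro add_mono mult_right_mono) (auto simp: p)
  finally show ?thesis .
qed

lemma padic_cauchy_mult:
  assumes "padic_cauchy p X" "padic_cauchy p Y"
  shows "padic_cauchy p (\<lambda>n. X n * Y n)"
proof -
  obtain A where A: "A > 0" "\<And>n. padic_abs p (X n) \<le> A"
    using padic_cauchy_bounded[OF assms(1)] by blast
  obtain B where B: "B > 0" "\<And>n. padic_abs p (Y n) \<le> B"
    using padic_cauchy_bounded[OF assms(2)] by blast
  have "max A B > 0" using A(1) by auto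
  then show ?thesis
    by (rule padic_cauchy_dominated[OF assms]) (rule padic_abs_mult_diff[OF A(2) B(2)])
qed

lemma padic_not_null_bound:
  assumes "padic_cauchy p X" "\<not> padic_null p X"
  obtains c N where "c > 0" "\<And>n. n \<ge> N \<Longrightarrow> padic_abs p (X n) > c"
proof -
  obtain L where L: "(\<lambda>n. padic_abs p (X n)) \<longlonglongrightarrow> L"
    using padic_cauchy_convergent[OF assms(1)] unfolding convergent_def by blast
  then have "L \<ge> 0" by (rule LIMSEQ_le_const) (simp add: p)
  moreover have "L \<noteq> 0" using L assms(2) unfolding padic_null_def by auto
  ultimately have "L / 2 > 0" "L / 2 < L" by auto
  with order_tendstoD(1)[OF L this(2)] that show ?thesis
    unfolding eventually_sequentially by blast
qed

lemma padic_abs_inverse_diff: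
  assumes "c > 0" "padic_abs p x > c" "padic_abs p y > c"
  shows "padic_abs p (inverse x - inverse y) \<le> (1 / c\<^sup>2) * padic_abs p (x - y)"
proof -
  have nz: "x \<noteq> 0" "y \<noteq> 0" using assms p by auto
  have "inverse x - inverse y = - (inverse x * (x - y) * inverse y)"
    using nz by (simp add: field_simps)
  then have "padic_abs p (inverse x - inverse y)
      = (inverse (padic_abs p x) * inverse (padic_abs p y)) * padic_abs p (x - y)"
    by (simp add: padic_abs_mult padic_abs_inverse padic_abs_minus p del: minus_mult_left)
  also have "\<dots> \<le> (inverse c * inverse c) * padic_abs p (x - y)"
    using assms by (intro mult_right_mono mult_mono le_imp_inverse_le) (auto simp: p)
  finally show ?thesis using assms(1) by (simp add: field_simps power2_eq_square)
qed

lemma padic_cauchy_inverse: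
  assumes "padic_cauchy p X" "\<not> padic_null p X"
  shows "padic_cauchy p (\<lambda>n. inverse (X n))"
proof -
  obtain c N where c: "c > 0" "\<And>n. n \<ge> N \<Longrightarrow> padic_abs p (X n) > c"
    using padic_not_null_bound[OF assms] by blast
  show ?thesis
  proof (rule padic_cauchy_dominated[OF assms(1,1)])
    show "1 / c\<^sup>2 > 0" using c by simp
    fix m n assume mn: "m \<ge> N" "n \<ge> N"
    have "0 \<le> 1 / c\<^sup>2 * padic_abs p (X m - X n)" by (simp add: p)
    then show "padic_abs p (inverse (X m) - inverse (X n))
        \<le> 1 / c\<^sup>2 * padic_abs p (X m - X n) + 1 / c\<^sup>2 * padic_abs p (X m - X n)"
      using padic_abs_inverse_diff[OF c(1) c(2)[OF mn(1)] c(2)[OF mn(2)]] by linarith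
  qed
qed

lemma padic_null_minus: "padic_null p X \<Longrightarrow> padic_null p (\<lambda>n. - X n)"
  by (simp add: padic_null_def p)

lemma padic_null_add:
  assumes "padic_null p X" "padic_null p Y"
  shows "padic_null p (\<lambda>n. X n + Y n)"
  using padic_abs_triangle[OF p]
  by (intro padic_null_dominated[OF assms, of 0 _ 1]) simp

lemma padic_rel_refl: "padic_cauchy p X \<Longrightarrow> padic_rel p X X"
  by (simp add: padic_rel_def padic_null_def p)

lemma padic_rel_null:
  assumes "padic_rel p X Y"
  shows "padic_null p X \<longleftrightarrow> padic_null p Y"
  using assms padic_null_add[of "\<lambda>n. X n - Y n" Y] padic_null_add[OF padic_null_minus, of "\<lambda>n. X n - Y n" X]
  by (auto simp: padic_rel_def)

lemma padic_rel_part_equivp: "part_equivp (padic_rel p)"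
proof (rule part_equivpI)
  show "\<exists>X. padic_rel p X X" using padic_rel_refl[OF padic_cauchy_const] by blast
  show "symp (padic_rel p)"
    using padic_null_minus by (fastforce intro!: sympI simp: padic_rel_def)
  show "transp (padic_rel p)"
    using padic_null_add by (fastforce intro!: transpI simp: padic_rel_def)
qed

end

text \<open>The prime is \<open>CARD('p)\<close>; the type \<open>'p\<close> plays no other role.\<close>

typedef ('p::prime_card) padic =
  "{C. \<exists>X. padic_rel CARD('p) X X \<and> C = Collect (padic_rel CARD('p) X)}"
  using padic_rel_refl[OF prime_card padic_cauchy_const[OF prime_card]] by blast

interpretation padic: quot_type "padic_rel CARD('p::prime_card)"
  "Abs_padic :: _ \<Rightarrow> 'p padic" Rep_padic
  using Rep_padic Abs_padic_inverse
  by unfold_locales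
    (auto simp: padic_rel_part_equivp[OF prime_card] Rep_padic_inverse Rep_padic_inject)

definition padic_of_seq :: "(nat \<Rightarrow> rat) \<Rightarrow> 'p::prime_card padic" where
  "padic_of_seq X = Abs_padic (Collect (padic_rel CARD('p) X))"

definition cr_padic :: "(nat \<Rightarrow> rat) \<Rightarrow> 'p::prime_card padic \<Rightarrow> bool" where
  "cr_padic X x \<longleftrightarrow> padic_rel CARD('p) X X \<and> padic_of_seq X = x"

lemma Quotient_padic:
  "Quotient (padic_rel CARD('p)) (padic_of_seq :: _ \<Rightarrow> 'p::prime_card padic)
    (quot_type.rep Rep_padic) cr_padic"
proof (rule Quotient3_to_Quotient)
  have "quot_type.abs (padic_rel CARD('p)) Abs_padic = (padic_of_seq :: _ \<Rightarrow> 'p padic)"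
    by (simp add: fun_eq_iff padic.abs_def padic_of_seq_def)
  then show "Quotient3 (padic_rel CARD('p)) (padic_of_seq :: _ \<Rightarrow> 'p padic)
      (quot_type.rep Rep_padic)"
    using padic.Quotient[where 'p = 'p] by simp
  show "cr_padic \<equiv> \<lambda>X (x :: 'p padic). padic_rel CARD('p) X X \<and> padic_of_seq X = x"
    by (simp add: cr_padic_def[abs_def])
qed

setup_lifting Quotient_padic

instantiation padic :: (prime_card) field
begin

lift_definition zero_padic :: "'a padic" is "\<lambda>_. 0"
  by (rule padic_rel_refl[OF prime_card padic_cauchy_const[OF prime_card]])

lift_definition one_padic :: "'a padic" is "\<lambda>_. 1"
  by (rule padic_rel_refl[OF prime_card padic_cauchy_const[OF prime_card]])

lift_definition plus_padic :: "'a padic \<Rightarrow> 'a padic \<Rightarrow> 'a padic" is "\<lambda>X Y n. X n + Y n"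
  unfolding padic_rel_def add_diff_add
  by (auto intro: padic_cauchy_add[OF prime_card] padic_null_add[OF prime_card])

lift_definition uminus_padic :: "'a padic \<Rightarrow> 'a padic" is "\<lambda>X n. - X n"
  unfolding padic_rel_def
  by (auto intro: padic_cauchy_minus[OF prime_card] dest: padic_null_minus[OF prime_card])

definition minus_padic :: "'a padic \<Rightarrow> 'a padic \<Rightarrow> 'a padic" where
  "minus_padic x y = x + - y"

lift_definition times_padic :: "'a padic \<Rightarrow> 'a padic \<Rightarrow> 'a padic" is "\<lambda>X Y n. X n * Y n"
proof -
  fix X X' Y Y' :: "nat \<Rightarrow> rat"
  assume *: "padic_rel CARD('a) X X'" "padic_rel CARD('a) Y Y'"
  then obtain A B where A: "\<And>n. padic_abs CARD('a) (X n) \<le> A"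
    and B: "\<And>n. padic_abs CARD('a) (Y' n) \<le> B"
    by (metis padic_cauchy_bounded[OF prime_card] padic_rel_def)
  have "padic_null CARD('a) (\<lambda>n. X n * Y n - X' n * Y' n)"
    using padic_null_dominated[OF prime_card, of "\<lambda>n. X n - X' n" "\<lambda>n. Y n - Y' n" 0
        "\<lambda>n. X n * Y n - X' n * Y' n" "max A B"]
      padic_abs_mult_diff[OF prime_card A B] * unfolding padic_rel_def by blast
  then show "padic_rel CARD('a) (\<lambda>n. X n * Y n) (\<lambda>n. X' n * Y' n)"
    using * by (auto simp: padic_rel_def intro: padic_cauchy_mult[OF prime_card])
qed

lift_definition inverse_padic :: "'a padic \<Rightarrow> 'a padic" is
  "\<lambda>X. if padic_null CARD('a) X then (\<lambda>_. 0) else (\<lambda>n. inverse (X n))"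
proof -
  fix X Y :: "nat \<Rightarrow> rat"
  let ?R = "padic_rel CARD('a)"
  assume *: "?R X Y"
  note null = padic_rel_null[OF prime_card *]
  show "?R (if padic_null CARD('a) X then (\<lambda>_. 0) else (\<lambda>n. inverse (X n)))
      (if padic_null CARD('a) Y then (\<lambda>_. 0) else (\<lambda>n. inverse (Y n)))"
  proof (cases "padic_null CARD('a) X")
    case True
    then show ?thesis
      using null padic_rel_refl[OF prime_card padic_cauchy_const[OF prime_card]] by simp
  next
    case False
    have XY: "padic_cauchy CARD('a) X" "padic_cauchy CARD('a) Y"
      "padic_null CARD('a) (\<lambda>n. X n - Y n)" using * by (auto simp: padic_rel_def)
    obtain c M where c: "c > 0" "\<And>n. n \<ge> M \<Longrightarrow> padic_abs CARD('a) (X n) > c"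
      using padic_not_null_bound[OF prime_card XY(1) False] by blast
    obtain d N where d: "d > 0" "\<And>n. n \<ge> N \<Longrightarrow> padic_abs CARD('a) (Y n) > d"
      using padic_not_null_bound[OF prime_card XY(2)] False null by blast
    define e where "e = min c d"
    have e: "e > 0" using c d by (simp add: e_def)
    have "padic_null CARD('a) (\<lambda>n. inverse (X n) - inverse (Y n))"
    proof (rule padic_null_dominated[OF prime_card XY(3,3)])
      fix n assume "n \<ge> max M N"
      then have "padic_abs CARD('a) (X n) > e" "padic_abs CARD('a) (Y n) > e"
        using c(2)[of n] d(2)[of n] by (auto simp: e_def)
      from padic_abs_inverse_diff[OF prime_card e this]
      show "padic_abs CARD('a) (inverse (X n) - inverse (Y n)) \<le>
          1 / e\<^sup>2 * padic_abs CARD('a) (X n - Y n) + 1 / e\<^sup>2 * padic_abs CARD('a) (X n - Y n)"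
        using padic_abs_nonneg[OF prime_card[where 'a = 'a], of "X n - Y n"]
        by (smt (verit) zero_le_divide_1_iff zero_le_power2 mult_nonneg_nonneg)
    qed
    then show ?thesis
      using False null XY padic_cauchy_inverse[OF prime_card] by (auto simp: padic_rel_def)
  qed
qed

definition divide_padic :: "'a padic \<Rightarrow> 'a padic \<Rightarrow> 'a padic" where
  "divide_padic x y = x * inverse y"

instance
proof
  fix a b c :: "'a padic"
  have R: "padic_rel CARD('a) X X \<longleftrightarrow> padic_cauchy CARD('a) X" for X
    using padic_rel_refl[OF prime_card] by (auto simp: padic_rel_def)
  note I = padic_cauchy_add[OF prime_card] padic_cauchy_mult[OF prime_card]
    padic_cauchy_minus[OF prime_card] padic_cauchy_const[OF prime_card]
  show "a + b + c = a + (b + c)" by transfer (auto simp: R add.assoc intro!: I)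
  show "a + b = b + a" by transfer (auto simp: R add.commute intro!: I)
  show "0 + a = a" by transfer (simp add: R)
  show "- a + a = 0" by transfer (auto simp: R intro!: I)
  show "a - b = a + - b" by (rule minus_padic_def)
  show "a * b * c = a * (b * c)" by transfer (auto simp: R mult.assoc intro!: I)
  show "a * b = b * a" by transfer (auto simp: R mult.commute intro!: I)
  show "1 * a = a" by transfer (simp add: R)
  show "(a + b) * c = a * c + b * c" by transfer (auto simp: R distrib_right intro!: I)
  show "0 \<noteq> (1 :: 'a padic)"
    by transfer (auto simp: R padic_rel_def padic_null_def
        padic_abs_1[OF prime_card] padic_abs_minus[OF prime_card] LIMSEQ_const_iff)
  show "inverse 0 = (0 :: 'a padic)"
    by transfer (auto simp: R padic_null_def padic_abs_0[OF prime_card] intro!: I)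
  show "a div b = a * inverse b" by (rule divide_padic_def)
  show "a \<noteq> 0 \<Longrightarrow> inverse a * a = 1"
  proof (transfer, goal_cases)
    case (1 X)
    then have X: "padic_cauchy CARD('a) X" "\<not> padic_null CARD('a) X"
      by (auto simp: padic_rel_def padic_cauchy_const[OF prime_card])
    obtain d N where d: "d > 0" "\<And>n. n \<ge> N \<Longrightarrow> padic_abs CARD('a) (X n) > d"
      using padic_not_null_bound[OF prime_card X] by blast
    have "X n \<noteq> 0" if "n \<ge> N" for n
      using d(1) d(2)[OF that] padic_abs_0[OF prime_card[where 'a = 'a]] by auto
    then have "\<forall>\<^sub>F n in sequentially. padic_abs CARD('a) (inverse (X n) * X n - 1) = 0"
      by (auto simp: eventually_sequentially padic_abs_0[OF prime_card] intro!: exI[of _ N])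
    then have "padic_null CARD('a) (\<lambda>n. inverse (X n) * X n - 1)"
      unfolding padic_null_def by (rule tendsto_eventually)
    then show ?case
      using X padic_cauchy_inverse[OF prime_card X]
      by (auto simp: padic_rel_def intro!: I)
  qed
qed

end

lift_definition padic_norm :: "'p::prime_card padic \<Rightarrow> real" is
  "\<lambda>X. lim (\<lambda>n. padic_abs CARD('p) (X n))"
proof -
  fix X Y :: "nat \<Rightarrow> rat"
  assume *: "padic_rel CARD('p) X Y"
  obtain L where L: "(\<lambda>n. padic_abs CARD('p) (X n)) \<longlonglongrightarrow> L"
    using padic_cauchy_convergent[OF prime_card, of X] * unfolding padic_rel_def convergent_def by blast
  have "(\<lambda>n. padic_abs CARD('p) (Y n) - padic_abs CARD('p) (X n)) \<longlonglongrightarrow> 0"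
  proof (rule Lim_null_comparison)
    show "(\<lambda>n. padic_abs CARD('p) (X n - Y n)) \<longlonglongrightarrow> 0"
      using * by (simp add: padic_rel_def padic_null_def)
    show "\<forall>\<^sub>F n in sequentially. norm (padic_abs CARD('p) (Y n) - padic_abs CARD('p) (X n))
        \<le> padic_abs CARD('p) (X n - Y n)"
      using padic_abs_diff_bound[OF prime_card[where 'a = 'p]]
      by (auto simp: abs_minus_commute)
  qed
  from tendsto_add[OF L this] have "(\<lambda>n. padic_abs CARD('p) (Y n)) \<longlonglongrightarrow> L" by simp
  with L show "lim (\<lambda>n. padic_abs CARD('p) (X n)) = lim (\<lambda>n. padic_abs CARD('p) (Y n))"
    by (simp add: limI)
qed

lemma padic_norm_tendsto:
  assumes "padic_rel CARD('p::prime_card) X X"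
  shows "(\<lambda>n. padic_abs CARD('p) (X n)) \<longlonglongrightarrow> lim (\<lambda>n. padic_abs CARD('p) (X n))"
  using padic_cauchy_convergent[OF prime_card[where 'a = 'p], of X] assms
  by (simp add: padic_rel_def convergent_LIMSEQ_iff)

lemma padic_norm_eq_0_iff [simp]: "padic_norm x = 0 \<longleftrightarrow> x = 0"
proof (transfer, goal_cases)
  case (1 X)
  have "lim (\<lambda>n. padic_abs CARD('a) (X n)) = 0 \<longleftrightarrow> padic_null CARD('a) X"
    unfolding padic_null_def using padic_norm_tendsto[OF 1] by (auto intro: limI)
  then show ?case
    using 1 by (simp add: padic_rel_def padic_cauchy_const[OF prime_card])
qed

lemma padic_norm_minus [simp]: "padic_norm (- x) = padic_norm x"
  by transfer (simp add: padic_abs_minus[OF prime_card])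

lemma padic_norm_triangle: "padic_norm (x + y) \<le> padic_norm x + padic_norm y"
proof (transfer, goal_cases)
  case (1 X Y)
  then have XY: "padic_rel CARD('a) (\<lambda>n. X n + Y n) (\<lambda>n. X n + Y n)"
    by (intro padic_rel_refl[OF prime_card] padic_cauchy_add[OF prime_card])
      (auto simp: padic_rel_def)
  show ?case
    by (rule LIMSEQ_le[OF padic_norm_tendsto[OF XY]
          tendsto_add[OF padic_norm_tendsto[OF 1(1)] padic_norm_tendsto[OF 1(2)]]])
      (auto intro: padic_abs_triangle[OF prime_card])
qed

instantiation padic :: (prime_card) metric_space
begin

definition dist_padic :: "'a padic \<Rightarrow> 'a padic \<Rightarrow> real" where
  "dist_padic x y = padic_norm (x - y)"

definition uniformity_padic :: "('a padic \<times> 'a padic) filter" where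
  "uniformity_padic = (INF e\<in>{0<..}. principal {(x, y). dist x y < e})"

definition open_padic :: "'a padic set \<Rightarrow> bool" where
  "open_padic U \<longleftrightarrow> (\<forall>x\<in>U. \<forall>\<^sub>F (x', y) in uniformity. x' = x \<longrightarrow> y \<in> U)"

instance
proof
  fix x y z :: "'a padic"
  show "dist x y = 0 \<longleftrightarrow> x = y" by (simp add: dist_padic_def)
  show "dist x y \<le> dist x z + dist y z"
    using padic_norm_triangle[of "x - z" "z - y"] padic_norm_minus[of "y - z"]
    by (simp add: dist_padic_def)
qed (simp_all add: uniformity_padic_def open_padic_def)

end


section \<open>\<open>GL\<^sub>2(\<rat>\<^sub>p)\<close>, its square, and Haar measures\<close>

text \<open>Groups are carried by a subset of a topological type and are given the subspace topology.
  For \<open>GL2\<close> over a topological field this is the group topology, inversion being continuous.\<close>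

type_synonym 'p padic_mat = "'p padic^2^2"

definition GL2 :: "('a::field^2^2) monoid" where
  "GL2 = \<lparr>carrier = {A. invertible A}, mult = (**), one = mat 1\<rparr>"

definition padic_integers :: "'p::prime_card padic set" where
  "padic_integers = {x. padic_norm x \<le> 1}"

definition GL2_Zp :: "('p::prime_card padic_mat) set" where
  "GL2_Zp = {A. \<exists>B. (\<forall>i j. A $ i $ j \<in> padic_integers) \<and> (\<forall>i j. B $ i $ j \<in> padic_integers)
     \<and> A ** B = mat 1 \<and> B ** A = mat 1}"

abbreviation Hp :: "('p::prime_card padic_mat) monoid" where
  "Hp \<equiv> GL2"

abbreviation Hp0 :: "('p::prime_card padic_mat) set" where
  "Hp0 \<equiv> GL2_Zp"

abbreviation Gp :: "('p::prime_card padic_mat \<times> 'p padic_mat) monoid" where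
  "Gp \<equiv> Hp \<times>\<times> Hp"

abbreviation Gp0 :: "('p::prime_card padic_mat \<times> 'p padic_mat) set" where
  "Gp0 \<equiv> Hp0 \<times> Hp0"

text \<open>Left Haar measures on the Borel sets. The groups above are second countable and locally
  compact, so regularity follows from finiteness on compact sets.\<close>

definition haar_measure :: "('a::topological_space, 'b) monoid_scheme \<Rightarrow> 'a measure \<Rightarrow> bool" where
  "haar_measure G \<mu> \<longleftrightarrow>
     sets \<mu> = sets (restrict_space borel (carrier G)) \<and>
     (\<forall>g\<in>carrier G. \<forall>A\<in>sets \<mu>. emeasure \<mu> ((\<lambda>x. g \<otimes>\<^bsub>G\<^esub> x) ` A) = emeasure \<mu> A) \<and>
     (\<forall>C. compact C \<and> C \<subseteq> carrier G \<longrightarrow> emeasure \<mu> C < \<infinity>) \<and>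
     emeasure \<mu> (carrier G) \<noteq> 0"


section \<open>Spherical Hecke algebras and their tensor product\<close>

text \<open>Functions on a group are represented by functions vanishing off its carrier.\<close>

definition compactly_supported ::
  "('a::topological_space, 'b) monoid_scheme \<Rightarrow> ('a \<Rightarrow> complex) \<Rightarrow> bool" where
  "compactly_supported G f \<longleftrightarrow>
     (\<exists>C. compact C \<and> C \<subseteq> carrier G \<and> (\<forall>x. f x \<noteq> 0 \<longrightarrow> x \<in> C))"

definition convolution ::
  "('a, 'b) monoid_scheme \<Rightarrow> 'a measure \<Rightarrow> ('a \<Rightarrow> complex) \<Rightarrow> ('a \<Rightarrow> complex) \<Rightarrow> 'a \<Rightarrow> complex"
where
  "convolution G \<mu> \<theta>\<^sub>1 \<theta>\<^sub>2 = (\<lambda>x. if x \<in> carrier G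
     then \<integral>\<gamma>. \<theta>\<^sub>1 \<gamma> * \<theta>\<^sub>2 (inv\<^bsub>G\<^esub> \<gamma> \<otimes>\<^bsub>G\<^esub> x) \<partial>\<mu> else 0)"

definition hecke_algebra ::
  "('a::topological_space, 'b) monoid_scheme \<Rightarrow> 'a set \<Rightarrow> 'a measure \<Rightarrow> ('a \<Rightarrow> complex) ring"
where
  "hecke_algebra G K \<mu> =
     \<lparr>carrier = {\<theta>. compactly_supported G \<theta> \<and>
        (\<forall>k\<in>K. \<forall>x\<in>carrier G. \<theta> (k \<otimes>\<^bsub>G\<^esub> x) = \<theta> x \<and> \<theta> (x \<otimes>\<^bsub>G\<^esub> k) = \<theta> x)},
      mult = convolution G \<mu>,
      one = indicator K,
      zero = (\<lambda>_. 0),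
      add = (\<lambda>\<theta>\<^sub>1 \<theta>\<^sub>2 x. \<theta>\<^sub>1 x + \<theta>\<^sub>2 x)\<rparr>"

definition pure_tensor :: "('a \<Rightarrow> complex) \<Rightarrow> ('b \<Rightarrow> complex) \<Rightarrow> 'a \<times> 'b \<Rightarrow> complex" where
  "pure_tensor \<theta>\<^sub>1 \<theta>\<^sub>2 = (\<lambda>(g, h). \<theta>\<^sub>1 g * \<theta>\<^sub>2 h)"

text \<open>Two function spaces have their tensor product over \<open>\<complex>\<close> inside the functions on the
  product, \<open>\<theta>\<^sub>1 \<otimes> \<theta>\<^sub>2\<close> being \<open>(g, h) \<mapsto> \<theta>\<^sub>1 g * \<theta>\<^sub>2 h\<close>: this identification is injective by
  \<open>pure_tensor_independent\<close> below, and the product is the one of the tensor product of algebras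
  by \<open>hecke_tensor_mult_pure\<close>.\<close>

definition hecke_tensor ::
  "('a::topological_space, 'c) monoid_scheme \<Rightarrow> 'a set \<Rightarrow> 'a measure \<Rightarrow>
   ('b::topological_space, 'd) monoid_scheme \<Rightarrow> 'b set \<Rightarrow> 'b measure \<Rightarrow> ('a \<times> 'b \<Rightarrow> complex) ring"
where
  "hecke_tensor G K \<mu> H L \<nu> =
     \<lparr>carrier = {\<Phi>. \<exists>(n::nat) \<theta>\<^sub>1 \<theta>\<^sub>2.
        (\<forall>i<n. \<theta>\<^sub>1 i \<in> carrier (hecke_algebra G K \<mu>) \<and> \<theta>\<^sub>2 i \<in> carrier (hecke_algebra H L \<nu>)) \<and>
        \<Phi> = (\<lambda>z. \<Sum>i<n. pure_tensor (\<theta>\<^sub>1 i) (\<theta>\<^sub>2 i) z)},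
      mult = (\<lambda>\<Phi> \<Psi> (x, y). if x \<in> carrier G \<and> y \<in> carrier H
        then \<integral>g. (\<integral>h. \<Phi> (g, h) * \<Psi> (inv\<^bsub>G\<^esub> g \<otimes>\<^bsub>G\<^esub> x, inv\<^bsub>H\<^esub> h \<otimes>\<^bsub>H\<^esub> y) \<partial>\<nu>) \<partial>\<mu> else 0),
      one = pure_tensor \<one>\<^bsub>hecke_algebra G K \<mu>\<^esub> \<one>\<^bsub>hecke_algebra H L \<nu>\<^esub>,
      zero = (\<lambda>_. 0),
      add = (\<lambda>\<Phi> \<Psi> z. \<Phi> z + \<Psi> z)\<rparr>"

lemma hecke_tensor_mult_pure:
  "pure_tensor \<theta>\<^sub>1 \<theta>\<^sub>2 \<otimes>\<^bsub>hecke_tensor G K \<mu> H L \<nu>\<^esub> pure_tensor \<theta>\<^sub>1' \<theta>\<^sub>2' =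
   pure_tensor (\<theta>\<^sub>1 \<otimes>\<^bsub>hecke_algebra G K \<mu>\<^esub> \<theta>\<^sub>1') (\<theta>\<^sub>2 \<otimes>\<^bsub>hecke_algebra H L \<nu>\<^esub> \<theta>\<^sub>2')"
proof -
  have "(\<integral>g. (\<integral>h. (\<theta>\<^sub>1 g * \<theta>\<^sub>2 h) * (a g * b h) \<partial>\<nu>) \<partial>\<mu>) =
      (\<integral>g. \<theta>\<^sub>1 g * a g \<partial>\<mu>) * (\<integral>h. \<theta>\<^sub>2 h * b h \<partial>\<nu>)" for a b
  proof -
    have "(\<integral>h. (\<theta>\<^sub>1 g * \<theta>\<^sub>2 h) * (a g * b h) \<partial>\<nu>) = (\<theta>\<^sub>1 g * a g) * (\<integral>h. \<theta>\<^sub>2 h * b h \<partial>\<nu>)" for g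
      by (subst integral_mult_right_zero[symmetric]) (simp add: mult_ac)
    then show ?thesis by simp
  qed
  then show ?thesis
    by (auto simp: hecke_tensor_def hecke_algebra_def convolution_def pure_tensor_def fun_eq_iff)
qed

lemma pure_tensor_independent:
  fixes n :: nat
  assumes "\<And>z. (\<Sum>i<n. pure_tensor (\<phi> i) (\<psi> i) z) = 0"
    and "\<And>c. (\<And>h. (\<Sum>i<n. c i * \<psi> i h) = 0) \<Longrightarrow> (\<And>i. i < n \<Longrightarrow> c i = (0::complex))"
    and "i < n"
  shows "\<phi> i g = 0"
  using assms(1)[of "(g, h)" for h] assms(2)[of "\<lambda>i. \<phi> i g"] assms(3)
  by (simp add: pure_tensor_def)


section \<open>Modules over rings that need not be commutative; cyclic modules\<close>

text \<open>\<open>module\<close> from the library assumes a commutative ring. Commutativity of the spherical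
  Hecke algebras is a theorem, not part of their definition.\<close>

locale left_module = R?: ring R + M?: abelian_group M
  for R :: "('r, 's) ring_scheme" (structure) and M :: "('r, 'm, 't) module_scheme" (structure) +
  assumes smult_closed:
      "\<lbrakk>a \<in> carrier R; x \<in> carrier M\<rbrakk> \<Longrightarrow> a \<odot>\<^bsub>M\<^esub> x \<in> carrier M"
    and smult_l_distr:
      "\<lbrakk>a \<in> carrier R; b \<in> carrier R; x \<in> carrier M\<rbrakk> \<Longrightarrow>
        (a \<oplus>\<^bsub>R\<^esub> b) \<odot>\<^bsub>M\<^esub> x = a \<odot>\<^bsub>M\<^esub> x \<oplus>\<^bsub>M\<^esub> b \<odot>\<^bsub>M\<^esub> x"
    and smult_r_distr:
      "\<lbrakk>a \<in> carrier R; x \<in> carrier M; y \<in> carrier M\<rbrakk> \<Longrightarrow>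
        a \<odot>\<^bsub>M\<^esub> (x \<oplus>\<^bsub>M\<^esub> y) = a \<odot>\<^bsub>M\<^esub> x \<oplus>\<^bsub>M\<^esub> a \<odot>\<^bsub>M\<^esub> y"
    and smult_assoc1:
      "\<lbrakk>a \<in> carrier R; b \<in> carrier R; x \<in> carrier M\<rbrakk> \<Longrightarrow>
        (a \<otimes>\<^bsub>R\<^esub> b) \<odot>\<^bsub>M\<^esub> x = a \<odot>\<^bsub>M\<^esub> (b \<odot>\<^bsub>M\<^esub> x)"
    and smult_one:
      "x \<in> carrier M \<Longrightarrow> \<one>\<^bsub>R\<^esub> \<odot>\<^bsub>M\<^esub> x = x"

definition cyclic_module_generated_by ::
  "('r, 's) ring_scheme \<Rightarrow> ('r, 'm, 't) module_scheme \<Rightarrow> 'm \<Rightarrow> bool" where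
  "cyclic_module_generated_by R M m \<longleftrightarrow>
     left_module R M \<and> m \<in> carrier M \<and> carrier M = {r \<odot>\<^bsub>M\<^esub> m | r. r \<in> carrier R}"


section \<open>The module \<open>C\<^sub>c\<^sup>\<infinity>(H\<^sub>p\<^sup>\<circ>\<backslash>G\<^sub>p/G\<^sub>p\<^sup>\<circ>)\<close>\<close>

definition hecke_ring ::
  "('p::prime_card padic_mat \<times> 'p padic_mat) measure \<Rightarrow> ('p padic_mat) measure \<Rightarrow>
   (('p padic_mat \<times> 'p padic_mat) \<times> 'p padic_mat \<Rightarrow> complex) ring" where
  "hecke_ring \<mu>G \<mu>H = hecke_tensor Gp Gp0 \<mu>G Hp Hp0 \<mu>H"

text \<open>The \<open>mult\<close> and \<open>one\<close> fields of a \<open>module\<close> record are not part of the module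
  structure. On pure tensors the scalar multiplication is the double integral of
  \<open>\<theta>\<^sub>1 g * \<theta>\<^sub>2 h * f (h\<^sup>-\<^sup>1 x g)\<close>; it is written here for the linear extension.\<close>

definition coset_module ::
  "('p::prime_card padic_mat \<times> 'p padic_mat) measure \<Rightarrow> ('p padic_mat) measure \<Rightarrow>
   (('p padic_mat \<times> 'p padic_mat) \<times> 'p padic_mat \<Rightarrow> complex,
    'p padic_mat \<times> 'p padic_mat \<Rightarrow> complex) module" where
  "coset_module \<mu>G \<mu>H =
     \<lparr>carrier = {f. compactly_supported Gp f \<and>
        (\<forall>k\<in>Hp0. \<forall>x\<in>carrier Gp. f ((k, k) \<otimes>\<^bsub>Gp\<^esub> x) = f x) \<and>
        (\<forall>k\<in>Gp0. \<forall>x\<in>carrier Gp. f (x \<otimes>\<^bsub>Gp\<^esub> k) = f x)},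
      mult = undefined,
      one = undefined,
      zero = (\<lambda>_. 0),
      add = (\<lambda>f f' x. f x + f' x),
      smult = (\<lambda>\<Phi> f x. if x \<in> carrier Gp
        then \<integral>g. (\<integral>h. \<Phi> (g, h) * f (inv\<^bsub>Gp\<^esub> (h, h) \<otimes>\<^bsub>Gp\<^esub> x \<otimes>\<^bsub>Gp\<^esub> g) \<partial>\<mu>H) \<partial>\<mu>G else 0)\<rparr>"

end

theory Submission
  imports Defs
begin

text \<open>A function in the module is a finitely supported function on triples of lattices
  \<open>(L, A L, B L)\<close> in \<open>\<rat>\<^sub>p\<^sup>2\<close> that only depends on the triple up to \<open>GL\<^sub>2(\<rat>\<^sub>p)\<close>, and the three Hecke
  algebras act at the three vertices. In the Bruhat--Tits tree three vertices span a tripod, and the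
  orbit of the triple is determined by the leg lengths \<open>a\<close>, \<open>b\<close>, \<open>c\<close> and by two determinants
  (the relative homotheties). Apply to \<open>ch(G\<^sub>p\<^sup>\<circ>)\<close> the Hecke operator that moves the three vertices by distances
  \<open>a\<close>, \<open>b\<close>, \<open>c\<close>: a triple in the support of the result has a vertex at these distances from its
  three members, so by the triangle inequality its perimeter is at most \<open>2 (a + b + c)\<close>, and equality
  forces it into the given orbit, where the value is positive. By induction on the perimeter the
  indicator functions of all orbits lie in the submodule generated by \<open>ch(G\<^sub>p\<^sup>\<circ>)\<close>.\<close>

section \<open>The \<open>p\<close>-adic numbers: norm, compactness, topology\<close>

text \<open>The operators are integrals, but each integrand is right invariant under a compact open
  subgroup of volume 1, so each integral is a finite sum over coset representatives. Associativity
  of convolution and the module law then become algebra in an abstract group; the topology and the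
  measures enter only through this translation. No tree is built. With \<open>disp\<close> equal to
  \<open>p\<close> to the power of the distance, the triangle inequality is the submultiplicativity
  of the maximum norm divided by the determinant, and the centre of a triple is found by matrix
  elimination. As \<open>disp\<close> does not see homotheties, orbits need two determinants besides
  the three distances, and the chosen operator has to prescribe determinants as well as distances.
  The bound on the perimeter is three bounds multiplied together: each side is at most a sum of two
  legs. Equality of the products forces equality in each of the three. The leading value cannot
  cancel, because the operator and the generator only take the values 0 and 1, so the result counts
  cosets.\<close>

lemma padic_rel_refl_iff: "padic_rel CARD('p::prime_card) X X \<longleftrightarrow> padic_cauchy CARD('p) X"
  using padic_rel_refl[OF prime_card] by (auto simp: padic_rel_def)

lemma padic_norm_one [simp]: "padic_norm (1::'p::prime_card padic) = 1"
  by transfer (simp add: padic_abs_1[OF prime_card] limI)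

lemma padic_norm_zero [simp]: "padic_norm 0 = 0"
  by simp

lemma padic_norm_nonneg [simp]: "0 \<le> padic_norm x"
  using padic_norm_triangle[of x "- x"] by simp

lemma padic_norm_pos_iff [simp]: "0 < padic_norm x \<longleftrightarrow> x \<noteq> 0"
  by (simp add: order_less_le eq_commute[of 0])

lemma padic_norm_mult: "padic_norm (x * y) = padic_norm x * padic_norm y"
proof (transfer, goal_cases)
  case (1 X Y)
  then have "(\<lambda>n. padic_abs CARD('a) (X n * Y n))
      \<longlonglongrightarrow> lim (\<lambda>n. padic_abs CARD('a) (X n)) * lim (\<lambda>n. padic_abs CARD('a) (Y n))"
    unfolding padic_abs_mult[OF prime_card]
    by (intro tendsto_mult padic_norm_tendsto 1)
  then show ?case by (rule limI)
qed

lemma padic_norm_ultrametric: "padic_norm (x + y) \<le> max (padic_norm x) (padic_norm y)"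
proof (transfer, goal_cases)
  case (1 X Y)
  then have XY: "padic_rel CARD('a) (\<lambda>n. X n + Y n) (\<lambda>n. X n + Y n)"
    by (auto simp: padic_rel_refl_iff intro: padic_cauchy_add[OF prime_card])
  show ?case
    by (rule LIMSEQ_le[OF padic_norm_tendsto[OF XY]
          tendsto_max[OF padic_norm_tendsto[OF 1(1)] padic_norm_tendsto[OF 1(2)]]])
      (auto intro: padic_abs_ultrametric[OF prime_card])
qed

lemma padic_norm_add_le: "padic_norm x \<le> c \<Longrightarrow> padic_norm y \<le> c \<Longrightarrow> padic_norm (x + y) \<le> c"
  using padic_norm_ultrametric[of x y] by linarith

lemma padic_norm_diff_le: "padic_norm x \<le> c \<Longrightarrow> padic_norm y \<le> c \<Longrightarrow> padic_norm (x - y) \<le> c"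
  using padic_norm_add_le[of x c "- y"] by simp

lemma padic_norm_diff_less: "padic_norm x < c \<Longrightarrow> padic_norm y < c \<Longrightarrow> padic_norm (x - y) < c"
  using padic_norm_ultrametric[of x "- y"] by simp

text \<open>In an ultrametric triangle the two longest sides are equal. So the norm is constant near
  every nonzero point, which makes its values those of rationals and makes the units an open
  set.\<close>

lemma padic_norm_diff_eq:
  assumes "padic_norm (x - y) < padic_norm x"
  shows "padic_norm y = padic_norm x"
proof -
  have "padic_norm y \<le> padic_norm x"
    using padic_norm_diff_le[of x "padic_norm x" "x - y"] assms by simp
  moreover have "padic_norm x \<le> max (padic_norm (x - y)) (padic_norm y)"
    using padic_norm_ultrametric[of "x - y" y] by simp
  ultimately show ?thesis using assms by linarith
qed

lemma padic_norm_inverse: "padic_norm (inverse x) = inverse (padic_norm x)"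
proof (cases "x = 0")
  case False
  then have "padic_norm x * padic_norm (inverse x) = 1"
    by (simp flip: padic_norm_mult)
  then show ?thesis by (metis inverse_unique)
qed auto

lemma padic_norm_divide: "padic_norm (x / y) = padic_norm x / padic_norm y"
  by (simp add: divide_inverse padic_norm_mult padic_norm_inverse)

lemma padic_norm_power: "padic_norm (x ^ n) = padic_norm x ^ n"
  by (induction n) (auto simp: padic_norm_mult)

section \<open>Density of the rationals and completeness\<close>

lift_definition padic_of_rat :: "rat \<Rightarrow> 'p::prime_card padic" is "\<lambda>q _. q"
  by (simp add: padic_rel_refl_iff padic_cauchy_const[OF prime_card])

lemma padic_norm_of_rat: "padic_norm (padic_of_rat q :: 'p::prime_card padic) = padic_abs CARD('p) q"
  by transfer (simp add: limI)

lemma padic_of_rat_diff: "padic_of_rat a - padic_of_rat b = padic_of_rat (a - b)"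
  unfolding minus_padic_def
  by transfer (simp add: padic_rel_refl_iff padic_cauchy_const[OF prime_card])

text \<open>A bound on the late terms of a Cauchy sequence survives in the limit that defines the
  norm of its class, but only as a non-strict bound; hence the \<open>e / 2\<close> where it is
  applied.\<close>

lemma padic_norm_seq_diff_le:
  assumes "padic_cauchy CARD('p::prime_card) X"
    and "\<And>m. m \<ge> N \<Longrightarrow> padic_abs CARD('p) (X m - q) \<le> e"
  shows "padic_norm (padic_of_seq X - padic_of_rat q :: 'p padic) \<le> e"
proof -
  have X: "cr_padic X (padic_of_seq X :: 'p padic)"
    using assms(1) by (simp add: cr_padic_def padic_rel_refl_iff)
  have c: "padic_cauchy CARD('p) (\<lambda>n. X n + - q)"
    by (intro padic_cauchy_add[OF prime_card] assms(1) padic_cauchy_const[OF prime_card])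
  have q: "cr_padic (\<lambda>_. q) (padic_of_rat q :: 'p padic)"
    by (simp add: cr_padic_def padic_rel_refl_iff padic_cauchy_const[OF prime_card] padic_of_rat.abs_eq)
  have "padic_of_seq X - padic_of_rat q = (padic_of_seq (\<lambda>n. X n + - q) :: 'p padic)"
    unfolding minus_padic_def
    using assms(1) by (simp add: padic_of_rat.abs_eq uminus_padic.abs_eq plus_padic.abs_eq
      padic_rel_refl_iff padic_cauchy_const[OF prime_card])
  then have "padic_norm (padic_of_seq X - padic_of_rat q :: 'p padic)
      = lim (\<lambda>n. padic_abs CARD('p) (X n + - q))"
    using c by (simp add: padic_norm.abs_eq padic_rel_refl_iff)
  moreover have "(\<lambda>n. padic_abs CARD('p) (X n + - q)) \<longlonglongrightarrow> lim (\<lambda>n. padic_abs CARD('p) (X n + - q))"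
    using c padic_norm_tendsto by (simp add: padic_rel_refl_iff)
  ultimately show ?thesis
    using LIMSEQ_le_const2[of "\<lambda>n. padic_abs CARD('p) (X n + - q)" _ e] assms(2) by auto
qed

lemma padic_of_rat_dense:
  assumes "e > 0"
  obtains q where "padic_norm (x - padic_of_rat q) < e"
proof -
  obtain X where X: "padic_cauchy CARD('a) X" "x = padic_of_seq X"
    by (metis Quotient_padic Quotient_rel_rep Quotient_abs_rep padic_rel_refl_iff)
  obtain N where "\<And>m n. m \<ge> N \<Longrightarrow> n \<ge> N \<Longrightarrow> padic_abs CARD('a) (X m - X n) < e / 2"
    using X(1) assms unfolding padic_cauchy_def by (metis half_gt_zero)
  then have "padic_norm (x - padic_of_rat (X N)) \<le> e / 2"
    unfolding X(2) by (intro padic_norm_seq_diff_le[OF X(1), of N]) (auto intro: less_imp_le)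
  then show ?thesis using assms by (intro that[of "X N"]) linarith
qed

text \<open>Replace the \<open>n\<close>-th term of a Cauchy sequence by a rational at distance less
  than \<open>1 / (n + 1)\<close>. These rationals form a Cauchy sequence, and this sequence itself
  represents the limit.\<close>

lemma complete_padic: "complete (UNIV :: 'p::prime_card padic set)"
proof (rule completeI)
  fix f :: "nat \<Rightarrow> 'p padic" assume f: "Cauchy f"
  have "\<exists>q. \<forall>n. padic_norm (f n - padic_of_rat (q n)) < inverse (real (Suc n))"
    by (intro choice allI) (metis padic_of_rat_dense inverse_positive_iff_positive of_nat_0_less_iff zero_less_Suc)
  then obtain q where q: "\<And>n. padic_norm (f n - padic_of_rat (q n)) < inverse (real (Suc n))"
    by blast
  \<comment> \<open>The first estimate makes \<open>q\<close> Cauchy, the second ties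
    \<open>f\<close> to \<open>q\<close>; the final limit argument needs both beyond one
    threshold.\<close>
  have small: "\<exists>N. \<forall>m\<ge>N. \<forall>n\<ge>N. padic_abs CARD('p) (q m - q n) < e \<and> padic_norm (f n - padic_of_rat (q n)) < e"
    if e: "e > 0" for e
  proof -
    obtain M where M: "\<And>m n. m \<ge> M \<Longrightarrow> n \<ge> M \<Longrightarrow> padic_norm (f m - f n) < e"
      using f e unfolding Cauchy_def dist_padic_def by blast
    obtain L where L: "inverse (real (Suc L)) < e" using e reals_Archimedean by blast
    have *: "padic_norm (f n - padic_of_rat (q n)) < e" if "n \<ge> L" for n
    proof -
      have "inverse (real (Suc n)) \<le> inverse (real (Suc L))" using that by (intro le_imp_inverse_le) auto
      then show ?thesis using q[of n] L by linarith
    qed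
    have "padic_abs CARD('p) (q m - q n) < e" if "m \<ge> max L M" "n \<ge> max L M" for m n
    proof -
      have "padic_of_rat (q m) - padic_of_rat (q n) =
         (f m - f n) - ((f m - padic_of_rat (q m)) - (f n - padic_of_rat (q n)) :: 'p padic)" by simp
      moreover have "padic_norm \<dots> < e"
        by (rule padic_norm_diff_less[OF M padic_norm_diff_less[OF * *]]) (use that in auto)
      ultimately show ?thesis by (simp add: padic_of_rat_diff padic_norm_of_rat)
    qed
    then show ?thesis using * by (intro exI[of _ "max L M"]) auto
  qed
  then have c: "padic_cauchy CARD('p) q" unfolding padic_cauchy_def by blast
  have "f \<longlonglongrightarrow> padic_of_seq q"
  proof (rule metric_LIMSEQ_I)
    fix e :: real assume "e > 0"
    then obtain N where N: "\<And>m n. m \<ge> N \<Longrightarrow> n \<ge> N \<Longrightarrow> padic_abs CARD('p) (q m - q n) < e / 2"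
      "\<And>n. n \<ge> N \<Longrightarrow> padic_norm (f n - padic_of_rat (q n)) < e / 2"
      using small[of "e/2"] by (metis half_gt_zero order_refl)
    have "dist (f n) (padic_of_seq q) < e" if "n \<ge> N" for n
    proof -
      have "padic_norm (padic_of_seq q - padic_of_rat (q n) :: 'p padic) \<le> e / 2"
        using N(1) that by (intro padic_norm_seq_diff_le[OF c, of N]) (auto intro: less_imp_le)
      moreover have "padic_norm (f n - padic_of_seq q) \<le>
          padic_norm (f n - padic_of_rat (q n)) + padic_norm (- (padic_of_seq q - padic_of_rat (q n)) :: 'p padic)"
        using padic_norm_triangle[of "f n - padic_of_rat (q n)" "- (padic_of_seq q - padic_of_rat (q n))"] by simp
      moreover have "padic_norm (- (padic_of_seq q - padic_of_rat (q n)) :: 'p padic) =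
          padic_norm (padic_of_seq q - padic_of_rat (q n) :: 'p padic)" by (rule padic_norm_minus)
      ultimately show ?thesis using N(2)[OF that] unfolding dist_padic_def by linarith
    qed
    then show "\<exists>N. \<forall>n\<ge>N. dist (f n) (padic_of_seq q) < e" by blast
  qed
  then show "\<exists>l\<in>UNIV. f \<longlonglongrightarrow> l" by blast
qed

section \<open>Discreteness of the norm and compactness of balls\<close>

lemma card_gt_1: "real CARD('p::prime_card) > 1"
  using prime_gt_1_nat[OF prime_card[where 'a='p]] by simp

lemma padic_abs_powi:
  assumes "x \<noteq> 0" obtains k where "padic_abs p x = real p powi k"
  using assms that by (cases "quotient_of x") (auto simp: padic_abs_def)

text \<open>A rational closer to \<open>x\<close> than \<open>padic_norm x\<close> has the same norm
  as \<open>x\<close>, and the absolute value of a nonzero rational is a power of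
  \<open>p\<close>.\<close>

lemma padic_norm_powi:
  assumes "x \<noteq> (0::'p::prime_card padic)"
  obtains k where "padic_norm x = real CARD('p) powi k"
proof -
  obtain q where q: "padic_norm (x - padic_of_rat q) < padic_norm x"
    using padic_of_rat_dense[of "padic_norm x" x] assms by auto
  then have *: "padic_norm x = padic_abs CARD('p) q"
    using padic_norm_diff_eq[OF q] by (simp add: padic_norm_of_rat)
  then have "q \<noteq> 0" using assms by (auto simp: padic_abs_0[OF prime_card])
  then show ?thesis using padic_abs_powi that * by metis
qed

lemma padic_abs_of_int:
  assumes "int p ^ k dvd n" and p: "prime p"
  shows "padic_abs p (of_int n) \<le> inverse (real p ^ k)"
proof (cases "n = 0")
  case False
  then have "k \<le> multiplicity (int p) n"
    using assms by (intro multiplicity_geI) auto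
  moreover have "padic_abs p (of_int n) = inverse (real p ^ multiplicity (int p) n)"
    using padic_abs_frac[OF p False, of 1] by (simp add: power_int_minus)
  moreover have "real p ^ k \<le> real p ^ multiplicity (int p) n"
    using calculation(1) prime_ge_1_nat[OF p] by (intro power_increasing) auto
  ultimately show ?thesis
    using prime_gt_0_nat[OF p] by (simp add: le_imp_inverse_le)
qed (simp add: padic_abs_0[OF p])

text \<open>In lowest terms the denominator of a \<open>p\<close>-integral rational is prime to
  \<open>p\<close>, hence invertible modulo \<open>p ^ k\<close>; the residue of the fraction modulo
  \<open>p ^ k\<close> is the approximant. The bound \<open>n < p ^ k\<close> leaves finitely many
  approximants for a given precision, as total boundedness requires.\<close>

lemma padic_abs_nat_dense:
  assumes q: "padic_abs p q \<le> 1" and p: "prime p"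
  obtains n where "n < p ^ k" "padic_abs p (q - of_nat n) \<le> inverse (real p ^ k)"
proof -
  have p1: "p > 1" using p prime_gt_1_nat by blast
  obtain a b where ab: "quotient_of q = (a, b)" by force
  have b: "b > 0" and cop: "coprime a b" and q_eq: "q = of_int a / of_int b"
    using ab quotient_of_denom_pos quotient_of_coprime quotient_of_div by blast+
  have nd: "\<not> int p dvd b"
  proof
    assume d: "int p dvd b"
    then have "\<not> int p dvd a" using cop p p1
      by (metis coprime_common_divisor int_dvd_int_iff not_prime_1 prime_nat_iff of_nat_1 zdvd1_eq abs_of_nat of_nat_eq_1_iff)
    then have a: "multiplicity (int p) a = 0" by (simp add: not_dvd_imp_multiplicity_0)
    have m: "multiplicity (int p) b \<ge> 1" using d b p1 by (intro multiplicity_geI) auto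
    have "a \<noteq> 0" using \<open>\<not> int p dvd a\<close> by auto
    then have "padic_abs p q = real p ^ multiplicity (int p) b"
      using padic_abs_frac[OF p, of a b] b a by (simp add: q_eq)
    moreover have "real p ^ 1 \<le> real p ^ multiplicity (int p) b" using m p1 by (intro power_increasing) auto
    ultimately show False using q p1 by (metis less_le_not_le of_nat_less_iff of_nat_1 order_trans power_one_right)
  qed
  have pi: "prime (int p)" using p by simp
  have "coprime b (int p ^ k)"
    using nd pi by (metis coprime_commute coprime_power_left_iff prime_imp_coprime)
  then obtain c where c: "[b * c = 1] (mod int p ^ k)" using cong_solve_coprime_int by blast
  define n where "n = nat ((a * c) mod int p ^ k)"
  have pos: "int p ^ k > 0" using p1 by simp
  have "n < p ^ k" unfolding n_def using pos by (simp add: nat_less_iff)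
  have "[b * int n = b * (a * c)] (mod int p ^ k)"
    unfolding n_def using pos by (simp add: cong_def mod_mult_right_eq)
  also have "[b * (a * c) = a * 1] (mod int p ^ k)"
    using c by (metis cong_scalar_left mult.left_commute)
  finally have "int p ^ k dvd a - b * int n" by (simp add: cong_iff_dvd_diff dvd_diff_commute)
  then have "padic_abs p (of_int (a - b * int n)) \<le> inverse (real p ^ k)"
    by (rule padic_abs_of_int[OF _ p])
  moreover have "q - of_nat n = of_int (a - b * int n) * inverse (of_int b)"
    using b by (simp add: q_eq field_simps)
  moreover have "padic_abs p (of_int b) = 1"
    using padic_abs_frac[OF p, of b 1] b nd by (simp add: not_dvd_imp_multiplicity_0)
  ultimately have "padic_abs p (q - of_nat n) \<le> inverse (real p ^ k)"
    by (simp add: padic_abs_mult[OF p] padic_abs_inverse[OF p] del: of_int_diff)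
  then show ?thesis using that \<open>n < p ^ k\<close> by blast
qed

text \<open>The unit ball is closed in a complete space, hence complete, and the residues below
  \<open>p ^ k\<close> are a finite net in it.\<close>

lemma compact_padic_integers: "compact {x::'p::prime_card padic. padic_norm x \<le> 1}"
  unfolding compact_eq_totally_bounded
proof (intro conjI allI impI)
  let ?Z = "{x::'p padic. padic_norm x \<le> 1}"
  have "closed ?Z"
    unfolding closed_sequential_limits
  proof (intro allI impI, elim conjE)
    fix f l assume f: "\<forall>n. f n \<in> ?Z" "f \<longlonglongrightarrow> l"
    then obtain n where "dist (f n) l < 1" by (metis LIMSEQ_iff_nz metric_LIMSEQ_D order_refl zero_less_one)
    then show "l \<in> ?Z" using f(1) padic_norm_diff_le[of "f n" 1 "f n - l"] by (auto simp: dist_padic_def)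
  qed
  then show "complete ?Z" using complete_Int_closed[OF complete_padic] by auto
  fix e :: real assume "0 < e"
  define p where "p = CARD('p)"
  have p: "prime p" unfolding p_def by (rule prime_card)
  have "1 / real p < 1" using prime_gt_1_nat[OF p] by simp
  then obtain k where k: "(1 / real p) ^ k < e" using \<open>0 < e\<close> real_arch_pow_inv by blast
  have "\<exists>n<p^k. dist (padic_of_rat (of_nat n)) x < e" if x: "x \<in> ?Z" for x
  proof -
    \<comment> \<open>Distance below 1 keeps the rational \<open>q\<close> integral, so that it has
      a residue; distance below \<open>e\<close> is the required precision.\<close>
    obtain q where q: "padic_norm (x - padic_of_rat q) < min e 1"
      using padic_of_rat_dense[of "min e 1" x] \<open>0 < e\<close> by auto
    have "padic_norm (padic_of_rat q :: 'p padic) \<le> 1"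
      using padic_norm_diff_le[of x 1 "x - padic_of_rat q"] q x by auto
    then have "padic_abs p q \<le> 1" by (simp add: padic_norm_of_rat p_def)
    then obtain n where n: "n < p ^ k" "padic_abs p (q - of_nat n) \<le> inverse (real p ^ k)"
      using padic_abs_nat_dense p by metis
    have "padic_norm (padic_of_rat q - padic_of_rat (of_nat n) :: 'p padic) < e"
      using n(2) k by (simp add: padic_of_rat_diff padic_norm_of_rat p_def power_divide inverse_eq_divide)
    then have "padic_norm ((padic_of_rat (of_nat n) - padic_of_rat q) - (x - padic_of_rat q)) < e"
      using q padic_norm_minus[of "padic_of_rat q - padic_of_rat (of_nat n) :: 'p padic"]
      by (intro padic_norm_diff_less[of "padic_of_rat (of_nat n) - padic_of_rat q" e "x - padic_of_rat q"]) simp_all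
    then show ?thesis using n(1) by (auto simp: dist_padic_def)
  qed
  then show "\<exists>k. finite k \<and> ?Z \<subseteq> (\<Union>x\<in>k. ball x e)"
    by (intro exI[of _ "(\<lambda>n. padic_of_rat (of_nat n)) ` {..<p^k}"]) fastforce
qed

section \<open>Continuity of the ring operations\<close>

lemma continuous_padic_add: "continuous_on UNIV (\<lambda>z :: 'p::prime_card padic \<times> 'p padic. fst z + snd z)"
proof -
  have "((\<lambda>z. fst z + snd z) \<longlongrightarrow> a + b) (at (a, b))" for a b :: "'p padic"
    unfolding tendsto_iff
  proof safe
    fix e :: real assume e: "0 < e"
    have "\<forall>\<^sub>F z in at (a, b). dist (fst z) a < e" "\<forall>\<^sub>F z in at (a, b). dist (snd z) b < e"
      using tendsto_fst[OF tendsto_ident_at, of "(a,b)" UNIV] tendsto_snd[OF tendsto_ident_at, of "(a,b)" UNIV] e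
      by (auto simp: tendsto_iff)
    then show "\<forall>\<^sub>F z in at (a, b). dist (fst z + snd z) (a + b) < e"
    proof eventually_elim
      case (elim z)
      have "fst z + snd z - (a + b) = (fst z - a) - (b - snd z)" by simp
      then show ?case using elim padic_norm_diff_less[of "fst z - a" e "b - snd z"]
        by (metis dist_padic_def dist_commute)
    qed
  qed
  then show ?thesis by (auto simp: continuous_on_def)
qed

instance padic :: (prime_card) topological_monoid_add
proof
  fix a b :: "'a padic"
  have "isCont (\<lambda>z::'a padic \<times> 'a padic. fst z + snd z) (a, b)"
    using continuous_padic_add by (auto simp: continuous_on_eq_continuous_at simp del: split_paired_All)
  then show "((\<lambda>x. fst x + snd x) \<longlongrightarrow> a + b) (nhds a \<times>\<^sub>F nhds b)"
    by (simp add: isCont_def nhds_prod[symmetric] tendsto_nhds_iff)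
qed

lemma tendsto_padic_norm_null_iff: "(f \<longlongrightarrow> l) F \<longleftrightarrow> ((\<lambda>x. padic_norm (f x - l)) \<longlongrightarrow> 0) F"
  by (simp add: tendsto_dist_iff[of f] dist_padic_def)

lemma tendsto_padic_norm: "(f \<longlongrightarrow> l) F \<Longrightarrow> ((\<lambda>x. padic_norm (f x)) \<longlongrightarrow> padic_norm l) F"
  using tendsto_dist[of f l F "\<lambda>_. 0" 0] by (simp add: dist_padic_def)

instance padic :: (prime_card) topological_semigroup_mult
proof
  fix a b :: "'a padic"
  \<comment> \<open>The argument of the norm is \<open>fst z * snd z - a * b\<close>, split so that
    each summand has one factor tending to 0 and one that stays bounded.\<close>
  have *: "((\<lambda>z. padic_norm (fst z * (snd z - b) + (fst z - a) * b)) \<longlongrightarrow> 0) (nhds a \<times>\<^sub>F nhds b)"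
  proof (rule tendsto_sandwich[where f = "\<lambda>_. 0"])
    have 1: "((\<lambda>z. fst z) \<longlongrightarrow> a) (nhds a \<times>\<^sub>F nhds b)" and 2: "((\<lambda>z. snd z) \<longlongrightarrow> b) (nhds a \<times>\<^sub>F nhds b)"
      by (simp_all add: filterlim_fst filterlim_snd)
    have "((\<lambda>z. padic_norm (fst z) * padic_norm (snd z - b) + padic_norm (fst z - a) * padic_norm b)
      \<longlongrightarrow> padic_norm a * 0 + 0 * padic_norm b) (nhds a \<times>\<^sub>F nhds b)"
      using 1 2 tendsto_padic_norm[OF 1]
      by (intro tendsto_intros) (simp_all add: tendsto_padic_norm_null_iff)
    then show "((\<lambda>z. padic_norm (fst z) * padic_norm (snd z - b) + padic_norm (fst z - a) * padic_norm b)
      \<longlongrightarrow> 0) (nhds a \<times>\<^sub>F nhds b)" by simp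
    show "\<forall>\<^sub>F z in nhds a \<times>\<^sub>F nhds b. padic_norm (fst z * (snd z - b) + (fst z - a) * b)
      \<le> padic_norm (fst z) * padic_norm (snd z - b) + padic_norm (fst z - a) * padic_norm b"
      by (intro always_eventually allI order_trans[OF padic_norm_triangle]) (simp add: padic_norm_mult)
  qed auto
  show "((\<lambda>x. fst x * snd x) \<longlongrightarrow> a * b) (nhds a \<times>\<^sub>F nhds b)"
    unfolding tendsto_padic_norm_null_iff using * by (simp add: algebra_simps)
qed

lemma continuous_on_padic_norm [continuous_intros]:
  "continuous_on S f \<Longrightarrow> continuous_on S (\<lambda>x. padic_norm (f x))"
  unfolding continuous_on_def by (auto intro: tendsto_padic_norm)

lemma continuous_on_padic_minus [continuous_intros]:
  fixes f :: "'a::topological_space \<Rightarrow> 'p::prime_card padic"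
  assumes "continuous_on S f" shows "continuous_on S (\<lambda>x. - f x)"
proof -
  have "continuous_on S (\<lambda>x. (-1) * f x)" by (intro continuous_intros assms)
  then show ?thesis by simp
qed

definition padic_unif :: "'p::prime_card padic" where
  "padic_unif = padic_of_rat (of_nat CARD('p))"

lemma padic_norm_unif: "padic_norm (padic_unif :: 'p::prime_card padic) = inverse (real CARD('p))"
proof -
  have "multiplicity (int CARD('p)) (int CARD('p)) = 1"
    using prime_card[where 'a='p] by (simp add: multiplicity_self not_prime_0)
  then show ?thesis
    unfolding padic_unif_def padic_norm_of_rat
    using padic_abs_frac[OF prime_card[where 'a='p], of "int CARD('p)" 1] by (simp add: power_int_minus)
qed

text \<open>Multiplication by a large negative power of the uniformizer maps the unit ball onto a
  compact ball that contains this one. As \<open>c\<close> need not be a value of the norm, the ball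
  is cut out as a closed subset.\<close>

lemma compact_padic_ball: "compact {x::'p::prime_card padic. padic_norm x \<le> c}"
proof -
  obtain k where k: "c < real CARD('p) ^ k" using real_arch_pow card_gt_1 by blast
  define u :: "'p padic" where "u = inverse padic_unif ^ k"
  have nu: "padic_norm u = real CARD('p) ^ k"
    by (simp add: u_def padic_norm_power padic_norm_inverse padic_norm_unif)
  have u0: "u \<noteq> 0" using nu card_gt_1[where 'p='p] by (metis less_trans padic_norm_eq_0_iff power_eq_0_iff zero_less_one less_irrefl)
  have pos: "real CARD('p) ^ k > 0" using card_gt_1[where 'p='p] by simp
  have "compact ((\<lambda>x. u * x) ` {x. padic_norm x \<le> 1})"
    by (intro compact_continuous_image compact_padic_integers continuous_intros)
  moreover have "closed {x::'p padic. padic_norm x \<le> c}"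
    by (intro closed_Collect_le continuous_intros)
  moreover have "{x. padic_norm x \<le> c} \<subseteq> (\<lambda>x. u * x) ` {x. padic_norm x \<le> 1}"
  proof
    fix x :: "'p padic" assume "x \<in> {x. padic_norm x \<le> c}"
    then have "padic_norm (x / u) \<le> 1" using k pos by (simp add: padic_norm_divide nu)
    moreover have "x = u * (x / u)" using u0 by simp
    ultimately show "x \<in> (\<lambda>x. u * x) ` {x. padic_norm x \<le> 1}" by blast
  qed
  ultimately show ?thesis by (metis compact_Int_closed inf.absorb_iff2)
qed


section \<open>Two-by-two matrices over the \<open>p\<close>-adic numbers\<close>

definition mat2 :: "'a \<Rightarrow> 'a \<Rightarrow> 'a \<Rightarrow> 'a \<Rightarrow> 'a^2^2" where
  "mat2 a b c d = (\<chi> i j. if i = 1 then if j = 1 then a else b else if j = 1 then c else d)"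

lemma mat2_nth [simp]:
  "mat2 a b c d $ 1 $ 1 = a" "mat2 a b c d $ 1 $ 2 = b"
  "mat2 a b c d $ 2 $ 1 = c" "mat2 a b c d $ 2 $ 2 = d"
  by (simp_all add: mat2_def)

lemma mat2_eta: "mat2 (A $ 1 $ 1) (A $ 1 $ 2) (A $ 2 $ 1) (A $ 2 $ 2) = A"
  by (simp add: vec_eq_iff forall_2)

lemma mat2_cases [case_names mat2, cases type]:
  obtains a b c d where "A = mat2 a b c d"
  by (metis mat2_eta)

lemma mat2_eq_iff: "mat2 a b c d = mat2 a' b' c' d' \<longleftrightarrow> a = a' \<and> b = b' \<and> c = c' \<and> d = d'"
  by (metis mat2_nth)

lemma mat2_mult: "mat2 a b c d ** mat2 a' b' c' d' =
  mat2 (a * a' + b * c') (a * b' + b * d') (c * a' + d * c') (c * b' + d * d')"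
  by (simp add: vec_eq_iff forall_2 matrix_matrix_mult_def sum_2)

lemma mat2_one: "mat 1 = mat2 1 0 0 1"
  by (simp add: vec_eq_iff forall_2 mat_def)

lemma det_mat2: "det (mat2 a b c d) = a * d - b * (c::'a::comm_ring_1)"
  by (simp add: det_2)

text \<open>The adjugate divided by the determinant. The entrywise formula makes norms of inverses
  computable, and division by 0 makes it the zero matrix at singular matrices.\<close>

definition minv :: "'a::field^2^2 \<Rightarrow> 'a^2^2" where
  "minv A = mat2 (A $ 2 $ 2 / det A) (- A $ 1 $ 2 / det A) (- A $ 2 $ 1 / det A) (A $ 1 $ 1 / det A)"

lemma minv_mat2: "minv (mat2 a b c d) =
  mat2 (d / (a * d - b * c)) (- b / (a * d - b * c)) (- c / (a * d - b * c)) (a / (a * d - b * c))"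
  by (simp add: minv_def det_mat2)

lemma minv_right:
  assumes "det A \<noteq> 0" shows "A ** minv A = mat 1"
proof (cases A)
  case (mat2 a b c d)
  define D where "D = a * d - b * c"
  have "D \<noteq> 0" using assms by (simp add: mat2 det_mat2 D_def)
  then show ?thesis
    unfolding mat2 minv_mat2 mat2_mult mat2_one mat2_eq_iff D_def[symmetric]
    by (simp add: divide_simps) (simp add: D_def algebra_simps)
qed

lemma minv_left: "det A \<noteq> 0 \<Longrightarrow> minv A ** A = mat 1"
  using minv_right matrix_left_right_inverse by blast

lemma carrier_GL2: "carrier GL2 = {A. det A \<noteq> 0}"
  by (simp add: GL2_def invertible_det_nz)

lemma mult_GL2 [simp]: "x \<otimes>\<^bsub>GL2\<^esub> y = x ** y"
  by (simp add: GL2_def)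

lemma one_GL2 [simp]: "\<one>\<^bsub>GL2\<^esub> = mat 1"
  by (simp add: GL2_def)

lemma det_minv: "det A \<noteq> 0 \<Longrightarrow> det (minv A) = inverse (det A)"
  by (metis det_I det_mul minv_right inverse_unique)

lemma group_GL2: "group (GL2 :: ('a::field^2^2) monoid)"
proof (rule groupI)
  show "\<exists>y\<in>carrier GL2. y \<otimes>\<^bsub>GL2\<^esub> x = \<one>\<^bsub>GL2\<^esub>" if "x \<in> carrier GL2" for x :: "'a^2^2"
    using that by (intro bexI[of _ "minv x"]) (auto simp: carrier_GL2 minv_left det_minv)
qed (auto simp: carrier_GL2 det_mul matrix_mul_assoc)

lemma inv_GL2: "det A \<noteq> 0 \<Longrightarrow> inv\<^bsub>GL2\<^esub> A = minv A"
  by (intro group.inv_equality[OF group_GL2]) (auto simp: carrier_GL2 minv_left det_minv)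

lemma minv_minv: "det A \<noteq> 0 \<Longrightarrow> minv (minv A) = A"
  using group.inv_inv[OF group_GL2, of A] by (simp add: inv_GL2 det_minv carrier_GL2)

lemma minv_mult: "det A \<noteq> 0 \<Longrightarrow> det B \<noteq> 0 \<Longrightarrow> minv (A ** B) = minv B ** minv A"
  using group.inv_mult_group[OF group_GL2, of A B] by (simp add: inv_GL2 det_mul carrier_GL2)


section \<open>The maximum norm, \<open>GL2_Zp\<close> and distances of lattices\<close>

definition mnorm :: "'p::prime_card padic_mat \<Rightarrow> real" where
  "mnorm A = max (max (padic_norm (A $ 1 $ 1)) (padic_norm (A $ 1 $ 2)))
                 (max (padic_norm (A $ 2 $ 1)) (padic_norm (A $ 2 $ 2)))"

lemma mnorm_mat2: "mnorm (mat2 a b c d) =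
    max (max (padic_norm a) (padic_norm b)) (max (padic_norm c) (padic_norm d))"
  by (simp add: mnorm_def)

lemma mnorm_le_iff: "mnorm A \<le> c \<longleftrightarrow> (\<forall>i j. padic_norm (A $ i $ j) \<le> c)"
  by (auto simp: mnorm_def forall_2)

lemma mnorm_nonneg [simp]: "0 \<le> mnorm A"
  by (simp add: mnorm_def le_max_iff_disj)

lemma mnorm_entry: "padic_norm (A $ i $ j) \<le> mnorm A"
  using mnorm_le_iff[of A "mnorm A"] by simp

lemma mnorm_mult_le: "mnorm (A ** B) \<le> mnorm A * mnorm B"
  unfolding mnorm_le_iff
proof (intro allI)
  fix i j
  have *: "padic_norm (A $ i $ k * B $ k $ j) \<le> mnorm A * mnorm B" for k
    unfolding padic_norm_mult by (intro mult_mono mnorm_entry) auto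
  show "padic_norm ((A ** B) $ i $ j) \<le> mnorm A * mnorm B"
    by (simp add: matrix_matrix_mult_def sum_2 padic_norm_add_le *)
qed

lemma det_norm_le: "padic_norm (det A) \<le> (mnorm A)\<^sup>2"
  unfolding det_2 power2_eq_square
  by (intro padic_norm_diff_le) (auto simp: padic_norm_mult intro!: mult_mono mnorm_entry)

lemma padic_norm_le_0_iff [simp]: "padic_norm x \<le> 0 \<longleftrightarrow> x = 0"
  using padic_norm_nonneg[of x] by (metis order_antisym padic_norm_eq_0_iff order_refl)

text \<open>The determinants of two integral inverse matrices have norm at most 1 and product 1, so
  both norms are 1; conversely the adjugate formula gives an integral inverse. In this form the
  group is visibly open and closed.\<close>

lemma GL2_Zp_iff: "A \<in> GL2_Zp \<longleftrightarrow> mnorm A \<le> 1 \<and> padic_norm (det A) = 1"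
proof
  assume "A \<in> GL2_Zp"
  then obtain B where A: "mnorm A \<le> 1" and B: "mnorm B \<le> 1" and AB: "A ** B = mat 1"
    by (auto simp: GL2_Zp_def padic_integers_def mnorm_le_iff)
  have "padic_norm (det A) * padic_norm (det B) = 1"
    using AB by (metis det_I det_mul padic_norm_mult padic_norm_one)
  moreover have "(mnorm A)\<^sup>2 \<le> 1" "(mnorm B)\<^sup>2 \<le> 1" using A B by (simp_all add: power_le_one)
  then have "padic_norm (det A) \<le> 1" "padic_norm (det B) \<le> 1"
    using det_norm_le order_trans by blast+
  ultimately have "padic_norm (det A) = 1"
    by (metis mult.right_neutral mult_left_mono order_antisym padic_norm_nonneg)
  then show "mnorm A \<le> 1 \<and> padic_norm (det A) = 1" using A by blast
next
  assume *: "mnorm A \<le> 1 \<and> padic_norm (det A) = 1"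
  then have d: "det A \<noteq> 0" by auto
  have "mnorm (minv A) \<le> 1"
    using * by (simp add: minv_def mnorm_mat2 padic_norm_divide) (simp add: mnorm_def)
  then show "A \<in> GL2_Zp"
    using * minv_left[OF d] minv_right[OF d]
    by (auto simp: GL2_Zp_def padic_integers_def mnorm_le_iff intro!: exI[of _ "minv A"])
qed

lemma mat2_GL2_Zp: "mat2 a b c d \<in> GL2_Zp \<longleftrightarrow> padic_norm a \<le> 1 \<and> padic_norm b \<le> 1 \<and>
    padic_norm c \<le> 1 \<and> padic_norm d \<le> 1 \<and> padic_norm (a * d - b * c) = 1"
  by (auto simp: GL2_Zp_iff mnorm_mat2 det_mat2)

lemma mat_1_GL2_Zp [simp]: "mat 1 \<in> GL2_Zp"
  by (simp add: mat2_one mat2_GL2_Zp)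

lemma GL2_Zp_det: "k \<in> GL2_Zp \<Longrightarrow> det k \<noteq> 0"
  by (auto simp: GL2_Zp_iff)

lemma GL2_Zp_mult: "k \<in> GL2_Zp \<Longrightarrow> l \<in> GL2_Zp \<Longrightarrow> k ** l \<in> GL2_Zp"
  using mnorm_mult_le[of k l] mult_le_one[of "mnorm k" "mnorm l"]
  by (auto simp: GL2_Zp_iff det_mul padic_norm_mult)

lemma GL2_Zp_minv: "k \<in> GL2_Zp \<Longrightarrow> minv k \<in> GL2_Zp"
  using det_minv[OF GL2_Zp_det, of k] unfolding GL2_Zp_iff
  by (simp add: padic_norm_inverse) (simp add: minv_def mnorm_mat2 padic_norm_divide mnorm_def)

lemma subgroup_GL2_Zp: "subgroup GL2_Zp GL2"
  by (rule group.subgroupI[OF group_GL2])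
    (auto simp: carrier_GL2 GL2_Zp_det inv_GL2 GL2_Zp_minv GL2_Zp_mult intro: mat_1_GL2_Zp)

lemma mnorm_right_le: "k \<in> GL2_Zp \<Longrightarrow> mnorm (A ** k) \<le> mnorm A"
  using mnorm_mult_le[of A k] mult_left_mono[of "mnorm k" 1 "mnorm A"] by (simp add: GL2_Zp_iff)

lemma mnorm_left_le: "k \<in> GL2_Zp \<Longrightarrow> mnorm (k ** A) \<le> mnorm A"
  using mnorm_mult_le[of k A] mult_right_mono[of "mnorm k" 1 "mnorm A"] by (simp add: GL2_Zp_iff)

lemma mnorm_right [simp]: assumes "k \<in> GL2_Zp" shows "mnorm (A ** k) = mnorm A"
proof -
  have "mnorm (A ** k ** minv k) \<le> mnorm (A ** k)" by (intro mnorm_right_le GL2_Zp_minv assms)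
  then show ?thesis using mnorm_right_le[OF assms, of A]
    by (simp add: matrix_mul_assoc[symmetric] minv_right GL2_Zp_det assms)
qed

lemma mnorm_left [simp]: assumes "k \<in> GL2_Zp" shows "mnorm (k ** A) = mnorm A"
proof -
  have "mnorm (minv k ** (k ** A)) \<le> mnorm (k ** A)" by (intro mnorm_left_le GL2_Zp_minv assms)
  then show ?thesis using mnorm_left_le[OF assms, of A]
    by (simp add: matrix_mul_assoc minv_left GL2_Zp_det assms)
qed

lemma det_norm_right [simp]: "k \<in> GL2_Zp \<Longrightarrow> padic_norm (det (A ** k)) = padic_norm (det A)"
  by (simp add: det_mul padic_norm_mult GL2_Zp_iff)

lemma det_norm_left [simp]: "k \<in> GL2_Zp \<Longrightarrow> padic_norm (det (k ** A)) = padic_norm (det A)"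
  by (simp add: det_mul padic_norm_mult GL2_Zp_iff)


text \<open>\<open>log\<^sub>p (disp (g\<^sup>-\<^sup>1 h))\<close> is the distance of the vertices \<open>g L\<close> and \<open>h L\<close> in the
  Bruhat--Tits tree, where \<open>L\<close> is the standard lattice.\<close>

definition disp :: "'p::prime_card padic_mat \<Rightarrow> real" where
  "disp A = (mnorm A)\<^sup>2 / padic_norm (det A)"

lemma disp_right [simp]: "k \<in> GL2_Zp \<Longrightarrow> disp (A ** k) = disp A"
  by (simp add: disp_def)

lemma disp_left [simp]: "k \<in> GL2_Zp \<Longrightarrow> disp (k ** A) = disp A"
  by (simp add: disp_def)

lemma disp_ge_1: "det A \<noteq> 0 \<Longrightarrow> 1 \<le> disp A"
  using det_norm_le[of A] by (simp add: disp_def)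

text \<open>The triangle inequality in the tree, written multiplicatively.\<close>

lemma disp_mult_le:
  assumes "det A \<noteq> 0" "det B \<noteq> 0" shows "disp (A ** B) \<le> disp A * disp B"
proof -
  have "(mnorm (A ** B))\<^sup>2 \<le> (mnorm A * mnorm B)\<^sup>2" by (intro power_mono mnorm_mult_le) auto
  then have "(mnorm (A ** B))\<^sup>2 / (padic_norm (det A) * padic_norm (det B)) \<le>
      (mnorm A * mnorm B)\<^sup>2 / (padic_norm (det A) * padic_norm (det B))"
    by (intro divide_right_mono) auto
  then show ?thesis by (simp add: disp_def det_mul padic_norm_mult power_mult_distrib)
qed

text \<open>In size two the adjugate has the entries of \<open>A\<close> up to sign and position.
  This is what makes the distance symmetric in \<open>disp_minv\<close>.\<close>

lemma mnorm_minv: "mnorm (minv A) = mnorm A / padic_norm (det A)"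
proof (cases "det A = 0")
  case True then show ?thesis by (simp add: minv_def mnorm_mat2)
next
  case False
  then have "padic_norm (det A) > 0" by simp
  then show ?thesis
    by (simp add: minv_def mnorm_mat2 mnorm_def padic_norm_divide max_divide_distrib_right max.commute max.left_commute max.assoc)
qed

lemma disp_minv: "det A \<noteq> 0 \<Longrightarrow> disp (minv A) = disp A"
  by (simp add: disp_def mnorm_minv det_minv padic_norm_inverse power_divide power2_eq_square)

text \<open>The square of an entry of maximal norm, divided by the determinant, lies in the value
  group, and \<open>disp A\<close> is at least 1. The natural exponent later carries the induction
  on the perimeter.\<close>

lemma disp_power:
  fixes A :: "'p::prime_card padic_mat"
  assumes "det A \<noteq> 0" obtains n where "disp A = real CARD('p) ^ n"
proof -
  have "\<exists>i j. mnorm A = padic_norm (A $ i $ j)"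
    unfolding mnorm_def by (metis max_def)
  then obtain i j where ij: "mnorm A = padic_norm (A $ i $ j)" by blast
  have "(mnorm A)\<^sup>2 > 0" using det_norm_le[of A] assms
    by (metis dual_order.strict_trans1 padic_norm_pos_iff)
  then have "A $ i $ j \<noteq> 0" using ij by auto
  then have "A $ i $ j * A $ i $ j / det A \<noteq> 0" using assms by simp
  then obtain k where k: "padic_norm (A $ i $ j * A $ i $ j / det A) = real CARD('p) powi k"
    by (rule padic_norm_powi)
  then have k': "disp A = real CARD('p) powi k"
    by (simp add: disp_def ij padic_norm_divide padic_norm_mult power2_eq_square)
  have "k \<ge> 0"
  proof (rule ccontr)
    assume "\<not> k \<ge> 0"
    then have "real CARD('p) powi k < 1"
      using card_gt_1[where 'p='p] power_int_strict_increasing[of k 0 "real CARD('p)"] by simp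
    then show False using disp_ge_1[OF assms] k' by simp
  qed
  then have "disp A = real CARD('p) ^ nat k" using k' by (simp add: power_int_def)
  then show ?thesis using that by blast
qed


section \<open>Normal form of a triple of lattices\<close>

text \<open>For invertible matrices this says that \<open>A\<close> and \<open>B\<close> map the
  standard lattice to the same lattice.\<close>

definition same_lattice :: "'p::prime_card padic_mat \<Rightarrow> 'p padic_mat \<Rightarrow> bool" where
  "same_lattice A B \<longleftrightarrow> (\<exists>k\<in>GL2_Zp. A = B ** k)"

lemma same_lattice_refl [simp]: "same_lattice A A"
  unfolding same_lattice_def by (intro bexI[of _ "mat 1"]) auto

lemma same_lattice_sym: assumes "same_lattice A B" shows "same_lattice B A"
proof -
  obtain k where k: "k \<in> GL2_Zp" "A = B ** k" using assms by (auto simp: same_lattice_def)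
  then have "B = A ** minv k" by (simp add: matrix_mul_assoc[symmetric] minv_right GL2_Zp_det)
  then show ?thesis using GL2_Zp_minv k by (auto simp: same_lattice_def)
qed

lemma same_lattice_trans: "same_lattice A B \<Longrightarrow> same_lattice B C \<Longrightarrow> same_lattice A C"
  unfolding same_lattice_def using GL2_Zp_mult by (metis matrix_mul_assoc)

lemma same_lattice_left: "same_lattice A B \<Longrightarrow> same_lattice (C ** A) (C ** B)"
  unfolding same_lattice_def by (auto simp: matrix_mul_assoc)

lemma same_lattice_mult: "k \<in> GL2_Zp \<Longrightarrow> same_lattice (A ** k) A"
  by (auto simp: same_lattice_def)

lemma same_latticeI: "k \<in> GL2_Zp \<Longrightarrow> A = B ** k \<Longrightarrow> same_lattice A B"
  by (auto simp: same_lattice_def)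

lemma same_lattice_disp: "same_lattice A B \<Longrightarrow> disp (C ** A) = disp (C ** B)"
  by (auto simp: same_lattice_def matrix_mul_assoc)

lemma same_lattice_det: "same_lattice A B \<Longrightarrow> padic_norm (det A) = padic_norm (det B)"
  by (auto simp: same_lattice_def)

text \<open>Up to \<open>h\<close> and homotheties, the lattices \<open>L\<close>, \<open>A L\<close>, \<open>B L\<close> are the preimages in the
  standard lattice of the lines spanned by \<open>e\<^sub>1\<close>, \<open>e\<^sub>2\<close>, \<open>e\<^sub>1 + e\<^sub>2\<close> modulo \<open>a\<close>, \<open>b\<close>, \<open>c\<close>. So they are the
  end points of a tripod in the tree with centre \<open>h L\<close>. The scalars \<open>s\<close> and \<open>t\<close> record the homotheties.\<close>

definition tripod ::
  "'p::prime_card padic_mat \<Rightarrow> 'p padic \<Rightarrow> 'p padic \<Rightarrow> 'p padic \<Rightarrow> 'p padic \<Rightarrow> 'p padic \<Rightarrow>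
   'p padic_mat \<Rightarrow> 'p padic_mat \<Rightarrow> bool" where
  "tripod h a b c s t A B \<longleftrightarrow> det h \<noteq> 0 \<and>
     a \<noteq> 0 \<and> b \<noteq> 0 \<and> c \<noteq> 0 \<and> s \<noteq> 0 \<and> t \<noteq> 0 \<and>
     padic_norm a \<le> 1 \<and> padic_norm b \<le> 1 \<and> padic_norm c \<le> 1 \<and>
     same_lattice (mat 1) (h ** mat2 1 0 0 a) \<and>
     same_lattice A (h ** mat2 (s * b) 0 0 s) \<and>
     same_lattice B (h ** mat2 (t * c) t 0 t)"

text \<open>An element of \<open>GL2_Zp\<close> fixes the standard lattice, so the first vertex of a
  triple stays in place when the whole triple is moved by it.\<close>

lemma same_lattice_conj:
  assumes "k \<in> GL2_Zp" "same_lattice (mat 1) A"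
  shows "same_lattice (mat 1) (k ** A)"
proof -
  have "same_lattice (k ** mat 1) (k ** A)" by (intro same_lattice_left assms)
  moreover have "same_lattice (mat 1) (k ** mat 1)"
    using assms(1) by (intro same_latticeI[OF GL2_Zp_minv[of k]]) (simp_all add: minv_right GL2_Zp_det)
  ultimately show ?thesis using same_lattice_trans by blast
qed

lemma tripod_left:
  assumes "tripod h a b c s t A B" "k \<in> GL2_Zp"
  shows "tripod (k ** h) a b c s t (k ** A) (k ** B)"
  using assms unfolding tripod_def
  by (auto simp: det_mul GL2_Zp_det matrix_mul_assoc[symmetric] intro: same_lattice_left same_lattice_conj)

lemma tripod_right:
  assumes "tripod h a b c s t A B" "same_lattice A' A" "same_lattice B' B"
  shows "tripod h a b c s t A' B'"
  using assms unfolding tripod_def by (auto intro: same_lattice_trans)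

lemma scalar_commute: "mat2 s 0 0 s ** A = A ** mat2 s 0 (0::'a::comm_ring_1) s"
  by (cases A) (simp add: mat2_mult mat2_eq_iff)

lemma same_lattice_scalar:
  "same_lattice A B \<Longrightarrow> same_lattice (A ** mat2 s 0 0 s) (B ** mat2 s 0 0 s)"
  using same_lattice_left[of A B "mat2 s 0 0 s"] by (simp add: scalar_commute)

text \<open>Homotheties do not move vertices of the tree; only the two recorded scalars
  change.\<close>

lemma tripod_scalar:
  assumes "tripod h a b c s t A B" "s' \<noteq> 0" "t' \<noteq> 0"
  shows "tripod h a b c (s * s') (t * t') (A ** mat2 s' 0 0 s') (B ** mat2 t' 0 0 t')"
proof -
  have "h ** mat2 (s * b) 0 0 s ** mat2 s' 0 0 s' = h ** mat2 (s * s' * b) 0 0 (s * s')"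
    "h ** mat2 (t * c) t 0 t ** mat2 t' 0 0 t' = h ** mat2 (t * t' * c) (t * t') 0 (t * t')"
    by (simp_all add: matrix_mul_assoc[symmetric] mat2_mult mult_ac)
  then show ?thesis
    using assms unfolding tripod_def by (metis same_lattice_scalar mult_eq_0_iff)
qed


text \<open>Row and column swaps bring an entry of maximal norm to the lower right corner. With this
  pivot the rest of its row and column is cleared by integral unipotent matrices, and what remains
  is diagonal. The right factor is absorbed in \<open>same_lattice\<close>.\<close>

lemma cartan:
  fixes A :: "'p::prime_card padic_mat"
  assumes "det A \<noteq> 0"
  obtains k s m where "k \<in> GL2_Zp" "s \<noteq> 0" "m \<noteq> 0" "padic_norm m \<le> 1"
    "same_lattice A (k ** mat2 (s * m) 0 0 s)"
proof -
  let ?w = "mat2 0 1 1 (0 :: 'p padic)"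
  have w: "?w \<in> GL2_Zp" by (simp add: mat2_GL2_Zp)
  have ww: "?w ** ?w = mat 1" by (simp add: mat2_mult mat2_one)
  note result = that
  have max22: thesis if k: "k \<in> GL2_Zp" and B: "same_lattice A (k ** B)"
    and "mnorm B = padic_norm (B $ 2 $ 2)" for k B
  proof (cases B)
    case (mat2 a b c d)
    have m: "padic_norm a \<le> padic_norm d" "padic_norm b \<le> padic_norm d" "padic_norm c \<le> padic_norm d"
      using that(3) by (auto simp: mat2 mnorm_mat2 max_def split: if_splits)
    have dB: "det B \<noteq> 0"
      using assms same_lattice_det[OF B] by (metis det_mul mult_zero_right padic_norm_eq_0_iff)
    then have d: "d \<noteq> 0" using m by (auto simp: mat2 det_mat2)
    \<comment> \<open>Clearing with the pivot \<open>d\<close> leaves \<open>a - b * c / d\<close>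
      in the upper left corner, which is \<open>d * e\<close>.\<close>
    define e where "e = (a * d - b * c) / d\<^sup>2"
    have k1: "k ** mat2 1 (b / d) 0 1 \<in> GL2_Zp"
      using m d by (intro GL2_Zp_mult k) (simp add: mat2_GL2_Zp padic_norm_divide)
    have e: "e \<noteq> 0" using dB d by (simp add: e_def mat2 det_mat2)
    have "padic_norm (a * d - b * c) \<le> padic_norm d * padic_norm d"
      by (intro padic_norm_diff_le) (auto simp: padic_norm_mult intro!: mult_mono m)
    then have e1: "padic_norm e \<le> 1"
      using d by (simp add: e_def padic_norm_divide padic_norm_mult power2_eq_square divide_le_eq)
    have k2: "mat2 1 0 (c / d) 1 \<in> GL2_Zp" using m d by (simp add: mat2_GL2_Zp padic_norm_divide)
    have "k ** B = k ** mat2 1 (b / d) 0 1 ** mat2 (d * e) 0 0 d ** mat2 1 0 (c / d) 1"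
      using d by (simp add: mat2 matrix_mul_assoc[symmetric] mat2_mult mat2_eq_iff e_def field_simps power2_eq_square)
    then have "same_lattice (k ** B) (k ** mat2 1 (b / d) 0 1 ** mat2 (d * e) 0 0 d)"
      using k2 by (auto intro: same_latticeI)
    then show thesis by (rule result[OF k1 d e e1 same_lattice_trans[OF B]])
  qed
  consider "mnorm A = padic_norm (A $ 1 $ 1)" | "mnorm A = padic_norm (A $ 1 $ 2)"
    | "mnorm A = padic_norm (A $ 2 $ 1)" | "mnorm A = padic_norm (A $ 2 $ 2)"
    unfolding mnorm_def by (metis max_def)
  then show thesis
  proof cases
    case 1
    show thesis
    proof (rule max22[OF w])
      show "same_lattice A (?w ** (?w ** A ** ?w))"
        by (rule same_latticeI[OF w], cases A) (simp add: mat2_mult)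
      show "mnorm (?w ** A ** ?w) = padic_norm ((?w ** A ** ?w) $ 2 $ 2)"
        using 1 by (cases A) (simp add: mat2_mult mnorm_mat2 ac_simps)
    qed
  next
    case 2
    show thesis
    proof (rule max22[OF w])
      show "same_lattice A (?w ** (?w ** A))" by (simp add: matrix_mul_assoc ww)
      show "mnorm (?w ** A) = padic_norm ((?w ** A) $ 2 $ 2)"
        using 2 by (cases A) (simp add: mat2_mult mnorm_mat2 ac_simps)
    qed
  next
    case 3
    show thesis
    proof (rule max22[OF mat_1_GL2_Zp])
      show "same_lattice A (mat 1 ** (A ** ?w))"
        by (rule same_latticeI[OF w], cases A) (simp add: mat2_mult)
      show "mnorm (A ** ?w) = padic_norm ((A ** ?w) $ 2 $ 2)"
        using 3 by (cases A) (simp add: mat2_mult mnorm_mat2 ac_simps)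
    qed
  next
    case 4
    then show thesis by (intro max22[OF mat_1_GL2_Zp]) auto
  qed
qed


text \<open>After a homothety the lattice is integral and contains a vector with a unit coordinate.
  A unit second coordinate gives the upper form, a unit first coordinate the lower form.\<close>

lemma triangular_lattice:
  fixes B :: "'p::prime_card padic_mat"
  assumes "det B \<noteq> 0"
  obtains (upper) t r x where "t \<noteq> 0" "r \<noteq> 0" "padic_norm r \<le> 1" "padic_norm x \<le> 1"
      "same_lattice B (mat2 r x 0 1 ** mat2 t 0 0 t)"
    | (lower) t y e where "t \<noteq> 0" "e \<noteq> 0" "padic_norm y \<le> 1" "padic_norm e \<le> 1"
      "same_lattice B (mat2 1 0 y e ** mat2 t 0 0 t)"
proof -
  let ?w = "mat2 0 1 1 (0 :: 'p padic)"
  have w: "?w \<in> GL2_Zp" by (simp add: mat2_GL2_Zp)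
  have "\<exists>t r x. t \<noteq> 0 \<and> r \<noteq> 0 \<and> same_lattice C (mat2 r x 0 1 ** mat2 t 0 0 t)"
    if "det C \<noteq> 0" "padic_norm (C $ 2 $ 1) \<le> padic_norm (C $ 2 $ 2)" for C :: "'p padic_mat"
  proof (cases C)
    case (mat2 a b c d)
    have cd: "padic_norm c \<le> padic_norm d" "a * d - b * c \<noteq> 0"
      using that by (auto simp: mat2 det_mat2)
    then have d: "d \<noteq> 0" by auto
    have "same_lattice C (mat2 ((a * d - b * c) / d\<^sup>2) (b / d) 0 1 ** mat2 d 0 0 d)"
      by (rule same_latticeI[of "mat2 1 0 (c / d) 1"])
        (use cd d in \<open>auto simp: mat2 mat2_mult mat2_eq_iff mat2_GL2_Zp padic_norm_divide field_simps power2_eq_square\<close>)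
    moreover have "(a * d - b * c) / d\<^sup>2 \<noteq> 0" using cd d by simp
    ultimately show ?thesis using d by blast
  qed note * = this
  have "\<exists>t r x. t \<noteq> 0 \<and> r \<noteq> 0 \<and> same_lattice B (mat2 r x 0 1 ** mat2 t 0 0 t)"
  proof (cases "padic_norm (B $ 2 $ 1) \<le> padic_norm (B $ 2 $ 2)")
    case True
    then show ?thesis using * assms by blast
  next
    case False
    have "det (B ** ?w) \<noteq> 0" using assms by (simp add: det_mul det_mat2)
    moreover have "padic_norm ((B ** ?w) $ 2 $ 1) \<le> padic_norm ((B ** ?w) $ 2 $ 2)"
      using False by (cases B) (simp add: mat2_mult)
    moreover have "same_lattice B (B ** ?w)"
      using same_lattice_sym[OF same_lattice_mult[OF w]] .
    ultimately show ?thesis using *[of "B ** ?w"] same_lattice_trans by blast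
  qed
  then obtain t r x where t: "t \<noteq> 0" and r: "r \<noteq> 0"
    and B: "same_lattice B (mat2 r x 0 1 ** mat2 t 0 0 t)" by blast
  \<comment> \<open>The scaling factor is whichever of 1, \<open>r\<close>, \<open>x\<close> has the
    largest norm; dividing by it makes the matrix integral, and the factor goes into the
    scalar.\<close>
  consider "padic_norm r \<le> 1" "padic_norm x \<le> 1" | "padic_norm r > 1" "padic_norm x \<le> padic_norm r"
    | "padic_norm x > 1" "padic_norm x > padic_norm r" by linarith
  then show thesis
  proof cases
    case 1
    then show thesis using upper t r B by blast
  next
    case 2
    have "same_lattice (mat2 r x 0 1) (mat2 1 0 0 (1 / r) ** mat2 r 0 0 r)"
      by (rule same_latticeI[of "mat2 1 (x / r) 0 1"])
        (use 2 r in \<open>auto simp: mat2_mult mat2_eq_iff mat2_GL2_Zp padic_norm_divide\<close>)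
    from same_lattice_scalar[OF this, of t]
    have "same_lattice (mat2 r x 0 1 ** mat2 t 0 0 t) (mat2 1 0 0 (1 / r) ** mat2 (r * t) 0 0 (r * t))"
      by (simp add: matrix_mul_assoc[symmetric] mat2_mult r)
    then show thesis
      using 2 r t by (intro lower[of "r * t" "1 / r" 0] same_lattice_trans[OF B]) (auto simp: padic_norm_divide)
  next
    case 3
    then have x: "x \<noteq> 0" by auto
    have "same_lattice (mat2 r x 0 1) (mat2 1 0 (1 / x) (r / x\<^sup>2) ** mat2 x 0 0 x)"
      by (rule same_latticeI[of "mat2 (r / x) 1 (- 1) 0"])
        (use 3 x in \<open>auto simp: mat2_mult mat2_eq_iff mat2_GL2_Zp padic_norm_divide power2_eq_square\<close>)
    from same_lattice_scalar[OF this, of t]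
    have "same_lattice (mat2 r x 0 1 ** mat2 t 0 0 t) (mat2 1 0 (1 / x) (r / x\<^sup>2) ** mat2 (x * t) 0 0 (x * t))"
      by (simp add: matrix_mul_assoc[symmetric] mat2_mult x mult.assoc power2_eq_square)
    moreover have "padic_norm r \<le> padic_norm x * padic_norm x"
      using 3 mult_mono[of 1 "padic_norm x" "padic_norm r" "padic_norm x"] by simp
    ultimately show thesis
      using 3 r x t by (intro lower[of "x * t" "r / x\<^sup>2" "1 / x"] same_lattice_trans[OF B])
        (auto simp: padic_norm_divide padic_norm_mult power2_eq_square divide_le_eq)
  qed
qed

text \<open>The geodesics from the standard lattice to the two others begin along the lattices of
  \<open>mat2 u 0 0 1\<close> and part where \<open>padic_norm u\<close> has fallen to the largest
  norm among \<open>m\<close>, \<open>r\<close> and \<open>x\<close>. If this is \<open>r\<close> or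
  \<open>m\<close>, the third or the second vertex lies on the way to the other one and is itself
  the centre.\<close>

lemma tripod_upper:
  assumes "m \<noteq> 0" "padic_norm m \<le> 1" "r \<noteq> 0" "padic_norm r \<le> 1" "padic_norm x \<le> 1"
  shows "\<exists>h a b c s t. tripod h a b c s t (mat2 m 0 0 1) (mat2 r x 0 1)"
proof -
  consider "padic_norm m \<le> padic_norm r" "padic_norm x \<le> padic_norm r"
    | "padic_norm r \<le> padic_norm m" "padic_norm x \<le> padic_norm m"
    | "x \<noteq> 0" "padic_norm r \<le> padic_norm x" "padic_norm m \<le> padic_norm x"
    by (smt (verit) padic_norm_eq_0_iff padic_norm_nonneg)
  then show ?thesis
  proof cases
    case 1
    have "same_lattice (mat2 r x 0 1) (mat2 1 0 0 (1 / r) ** mat2 (r * 1) r 0 r)"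
      by (rule same_latticeI[of "mat2 1 (x / r - 1) 0 1"])
        (use 1 assms in \<open>auto simp: mat2_mult mat2_eq_iff mat2_GL2_Zp padic_norm_divide field_simps
            intro!: padic_norm_diff_le\<close>)
    then have "tripod (mat2 1 0 0 (1 / r)) r (m / r) 1 r r (mat2 m 0 0 1) (mat2 r x 0 1)"
      using 1 assms by (simp add: tripod_def det_mat2 mat2_mult mat2_one padic_norm_divide)
    then show ?thesis by blast
  next
    case 2
    \<comment> \<open>The centre must be the lattice of \<open>mat2 m 0 0 1\<close>, but a tripod
      also asks for the third line to be spanned by the sum of the other two directions. The shear
      by \<open>x - m\<close> adjusts that line: the upper right entry becomes
      \<open>m + (x - m) = x\<close>.\<close>
    have xm: "padic_norm ((x - m) / m) \<le> 1"
      using 2 assms padic_norm_diff_le[of x "padic_norm m" m] by (simp add: padic_norm_divide)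
    have "padic_norm (x - m) \<le> 1" using assms by (intro padic_norm_diff_le)
    then have "same_lattice (mat 1) (mat2 1 ((x - m) / m) 0 (1 / m) ** mat2 1 0 0 m)"
      by (intro same_latticeI[of "mat2 1 (m - x) 0 1"])
        (use assms in \<open>auto simp: mat2_mult mat2_one mat2_eq_iff mat2_GL2_Zp padic_norm_divide
            intro!: padic_norm_diff_le\<close>)
    moreover have "same_lattice (mat2 m 0 0 1) (mat2 1 ((x - m) / m) 0 (1 / m) ** mat2 (m * 1) 0 0 m)"
      by (rule same_latticeI[of "mat2 1 (- ((x - m) / m)) 0 1"])
        (use assms xm in \<open>auto simp: mat2_mult mat2_eq_iff mat2_GL2_Zp\<close>)
    moreover have "mat2 r x 0 1 = mat2 1 ((x - m) / m) 0 (1 / m) ** mat2 (m * (r / m)) m 0 m"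
      using assms by (simp add: mat2_mult mat2_eq_iff)
    ultimately have "tripod (mat2 1 ((x - m) / m) 0 (1 / m)) m 1 (r / m) m m (mat2 m 0 0 1) (mat2 r x 0 1)"
      using 2 assms by (simp add: tripod_def det_mat2 padic_norm_divide)
    then show ?thesis by blast
  next
    case 3
    have "tripod (mat2 1 0 0 (1 / x)) x (m / x) (r / x) x x (mat2 m 0 0 1) (mat2 r x 0 1)"
      using 3 assms by (simp add: tripod_def det_mat2 mat2_mult mat2_one padic_norm_divide)
    then show ?thesis by blast
  qed
qed

text \<open>Here the two geodesics leave the standard lattice in different directions, so the centre
  is the standard lattice and the first leg is trivial. The matrix \<open>?h\<close> is integral,
  fixes the second basis vector and maps (1, 1) to (1, y).\<close>

lemma tripod_lower:
  assumes "m \<noteq> 0" "padic_norm m \<le> 1" "e \<noteq> 0" "padic_norm e \<le> 1" "padic_norm y \<le> 1"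
  shows "\<exists>h a b c s t. tripod h a b c s t (mat2 m 0 0 1) (mat2 1 0 y e)"
proof -
  let ?h = "mat2 1 0 (y - 1) 1"
  have y: "padic_norm (y - 1) \<le> 1" "padic_norm (1 - y) \<le> 1" using assms by (auto intro!: padic_norm_diff_le)
  have ym: "padic_norm ((1 - y) * m) \<le> 1" using y assms by (simp add: padic_norm_mult mult_le_one)
  have "same_lattice (mat 1) (?h ** mat2 1 0 0 1)"
    by (rule same_latticeI[of "mat2 1 0 (1 - y) 1"])
      (use y in \<open>auto simp: mat2_mult mat2_one mat2_eq_iff mat2_GL2_Zp\<close>)
  moreover have "same_lattice (mat2 m 0 0 1) (?h ** mat2 (1 * m) 0 0 1)"
    by (rule same_latticeI[of "mat2 1 0 ((1 - y) * m) 1"])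
      (use ym in \<open>auto simp: mat2_mult mat2_eq_iff mat2_GL2_Zp algebra_simps\<close>)
  moreover have "same_lattice (mat2 1 0 y e) (?h ** mat2 (1 * e) 1 0 1)"
    by (rule same_latticeI[of "mat2 0 (- 1) 1 e"])
      (use assms in \<open>auto simp: mat2_mult mat2_eq_iff mat2_GL2_Zp algebra_simps\<close>)
  ultimately have "tripod ?h 1 m e 1 1 (mat2 m 0 0 1) (mat2 1 0 y e)"
    using assms unfolding tripod_def by (simp add: det_mat2)
  then show ?thesis by blast
qed

text \<open>The Cartan form of \<open>A\<close> fixes coordinates in which the first two lattices
  are diagonal; the triangular form of the third lattice in these coordinates decides between the
  two preceding lemmas.\<close>

lemma tripod_exists:
  assumes "det A \<noteq> 0" "det B \<noteq> 0"
  obtains h a b c s t where "tripod h a b c s t A B"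
proof -
  obtain k s m where k: "k \<in> GL2_Zp" and s: "s \<noteq> 0" and m: "m \<noteq> 0" "padic_norm m \<le> 1"
    and A: "same_lattice A (k ** mat2 (s * m) 0 0 s)"
    using cartan[OF assms(1)] by blast
  have A': "same_lattice A (k ** (mat2 m 0 0 1 ** mat2 s 0 0 s))"
    using A by (simp add: mat2_mult mult.commute)
  \<comment> \<open>A tripod found for the normalised pair is carried back by restoring both
    homotheties and then multiplying by \<open>k\<close>.\<close>
  have final: thesis if "tripod h a b c s' t' (mat2 m 0 0 1) C" "t \<noteq> 0"
    "same_lattice (minv k ** B) (C ** mat2 t 0 0 t)" for h a b c s' t' C t
  proof -
    have "B = k ** (minv k ** B)" by (simp add: matrix_mul_assoc minv_right GL2_Zp_det k)
    then have "same_lattice B (k ** (C ** mat2 t 0 0 t))"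
      using same_lattice_left[OF that(3)] by metis
    from tripod_right[OF tripod_left[OF tripod_scalar[OF that(1) s that(2)] k] A' this]
    show thesis by (rule \<open>\<And>h a b c s t. tripod h a b c s t A B \<Longrightarrow> thesis\<close>)
  qed
  have "det (minv k ** B) \<noteq> 0"
    using assms k by (simp add: det_mul det_minv GL2_Zp_det)
  then show thesis
  proof (cases rule: triangular_lattice)
    case (upper t r x)
    then show thesis using tripod_upper[of m r x] m final by blast
  next
    case (lower t y e)
    then show thesis using tripod_lower[of m e y] m final by blast
  qed
qed

text \<open>The path between two ends runs through the centre, so the pairwise distances are sums of
  two legs, which are products here. The determinants recover the norms of the two scalars.\<close>

lemma tripod_disp:
  assumes "tripod h a b c s t A B"
  shows "disp h = 1 / padic_norm a" "disp (minv A ** h) = 1 / padic_norm b"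
    "disp (minv B ** h) = 1 / padic_norm c"
    "disp A = 1 / (padic_norm a * padic_norm b)" "disp B = 1 / (padic_norm a * padic_norm c)"
    "disp (minv A ** B) = 1 / (padic_norm b * padic_norm c)"
    "padic_norm (det A) = padic_norm s ^ 2 * padic_norm b / padic_norm a"
    "padic_norm (det B) = padic_norm t ^ 2 * padic_norm c / padic_norm a"
proof -
  define n0 n1 n2 where n: "n0 = mat2 1 0 0 a" "n1 = mat2 (s * b) 0 0 s" "n2 = mat2 (t * c) t 0 t"
  have nz: "a \<noteq> 0" "b \<noteq> 0" "c \<noteq> 0" "s \<noteq> 0" "t \<noteq> 0" and h: "det h \<noteq> 0"
    and le: "padic_norm a \<le> 1" "padic_norm b \<le> 1" "padic_norm c \<le> 1"
    and 0: "same_lattice (mat 1) (h ** n0)" and 1: "same_lattice A (h ** n1)"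
    and 2: "same_lattice B (h ** n2)"
    using assms by (auto simp: tripod_def n)
  have dn: "det n0 \<noteq> 0" "det n1 \<noteq> 0" "det n2 \<noteq> 0" using nz by (auto simp: n det_mat2)
  obtain k where k: "k \<in> GL2_Zp" "h ** n0 = k" using same_lattice_sym[OF 0] by (auto simp: same_lattice_def)
  \<comment> \<open>The first leg alone determines the centre up to \<open>GL2_Zp\<close>, so norms
    that involve \<open>h\<close> are computed from \<open>n0\<close>.\<close>
  then have hk: "h = k ** minv n0" using dn by (metis matrix_mul_assoc matrix_mul_rid minv_right)
  have cancel: "minv h ** (h ** C) = C" for C using h by (simp add: matrix_mul_assoc minv_left)
  have dA: "det A \<noteq> 0" "det B \<noteq> 0"
    using h dn same_lattice_det[OF 1] same_lattice_det[OF 2]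
    by (metis det_mul mult_eq_0_iff padic_norm_eq_0_iff)+
  have dh: "padic_norm (det h) = 1 / padic_norm a"
  proof -
    have "padic_norm (det h * det n0) = 1" using k by (metis det_mul GL2_Zp_iff)
    then show ?thesis using nz by (simp add: padic_norm_mult n det_mat2 field_simps)
  qed
  show "padic_norm (det A) = padic_norm s ^ 2 * padic_norm b / padic_norm a"
    "padic_norm (det B) = padic_norm t ^ 2 * padic_norm c / padic_norm a"
    using same_lattice_det[OF 1] same_lattice_det[OF 2]
    by (simp_all add: det_mul padic_norm_mult dh n det_mat2 power2_eq_square)
  show "disp h = 1 / padic_norm a"
    using k le nz dn by (simp add: hk disp_minv) (simp add: disp_def n mnorm_mat2 det_mat2 max_def)
  \<comment> \<open>Passing to the inverse puts \<open>A\<close> on the right, where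
    \<open>same_lattice\<close> allows it to be replaced.\<close>
  have "disp (minv A ** h) = disp (minv (minv h ** A))"
    using h dA by (simp add: minv_mult minv_minv det_minv)
  also have "\<dots> = disp n1"
    using h dA by (simp add: disp_minv det_mul det_minv same_lattice_disp[OF 1] cancel)
  also have "\<dots> = 1 / padic_norm b"
    using le nz by (simp add: disp_def n mnorm_mat2 det_mat2 max_def padic_norm_mult power2_eq_square mult_le_cancel_left1)
  finally show "disp (minv A ** h) = 1 / padic_norm b" .
  have "disp (minv B ** h) = disp (minv (minv h ** B))"
    using h dA by (simp add: minv_mult minv_minv det_minv)
  also have "\<dots> = disp n2"
    using h dA by (simp add: disp_minv det_mul det_minv same_lattice_disp[OF 2] cancel)
  also have "\<dots> = 1 / padic_norm c"
    using le nz by (simp add: disp_def n mnorm_mat2 det_mat2 max_def padic_norm_mult power2_eq_square mult_le_cancel_left1)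
  finally show "disp (minv B ** h) = 1 / padic_norm c" .
  have n01: "minv n0 ** n1 = mat2 (s * b) 0 0 (s / a)" "minv n0 ** n2 = mat2 (t * c) t 0 (t / a)"
    using nz by (simp_all add: n minv_mat2 mat2_mult)
  have "disp A = disp (minv n0 ** n1)"
    using same_lattice_disp[OF 1, of "mat 1"] k by (simp add: hk matrix_mul_assoc[symmetric])
  also have "\<dots> = 1 / (padic_norm a * padic_norm b)"
  proof -
    have "padic_norm b * padic_norm a \<le> 1" using le by (simp add: mult_le_one)
    then show ?thesis
      using nz unfolding n01 by (simp add: disp_def mnorm_mat2 det_mat2 max_def padic_norm_mult
         padic_norm_divide power2_eq_square field_simps mult_le_cancel_left1)
  qed
  finally show "disp A = 1 / (padic_norm a * padic_norm b)" .
  have "disp B = disp (minv n0 ** n2)"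
    using same_lattice_disp[OF 2, of "mat 1"] k by (simp add: hk matrix_mul_assoc[symmetric])
  also have "\<dots> = 1 / (padic_norm a * padic_norm c)"
  proof -
    have "padic_norm c * padic_norm a \<le> 1" using le by (simp add: mult_le_one)
    then show ?thesis
      using nz le unfolding n01 by (simp add: disp_def mnorm_mat2 det_mat2 max_def padic_norm_mult
         padic_norm_divide power2_eq_square field_simps mult_le_cancel_left1)
  qed
  finally show "disp B = 1 / (padic_norm a * padic_norm c)" .
  have "minv A ** B = minv (minv h ** A) ** (minv h ** B)"
    using h dA by (simp add: minv_mult minv_minv det_minv matrix_mul_assoc)
      (simp add: matrix_mul_assoc[symmetric] minv_right)
  moreover obtain k1 k2 where k12: "k1 \<in> GL2_Zp" "minv h ** A = n1 ** k1" "k2 \<in> GL2_Zp" "minv h ** B = n2 ** k2"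
    using 1 2 unfolding same_lattice_def by (metis cancel matrix_mul_assoc)
  ultimately have "minv A ** B = minv k1 ** (minv n1 ** n2) ** k2"
    using dn by (simp add: minv_mult GL2_Zp_det matrix_mul_assoc)
  then have "disp (minv A ** B) = disp (minv n1 ** n2)" using k12 by (simp add: GL2_Zp_minv)
  also have "minv n1 ** n2 = mat2 (t * c / (s * b)) (t / (s * b)) 0 (t / s)"
    using nz by (simp add: n minv_mat2 mat2_mult)
  also have "disp \<dots> = 1 / (padic_norm b * padic_norm c)"
  proof -
    have "padic_norm b * padic_norm c \<le> 1" using le by (simp add: mult_le_one)
    then show ?thesis
      using nz le by (simp add: disp_def mnorm_mat2 det_mat2 max_def padic_norm_mult
         padic_norm_divide power2_eq_square field_simps mult_le_cancel_left1)
  qed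
  finally show "disp (minv A ** B) = 1 / (padic_norm b * padic_norm c)" .
qed


text \<open>The distances determine the triangle of vertices up to the group; the two determinants
  fix the lattices within their homothety classes relative to the standard one.\<close>

definition triple_invariant :: "'p::prime_card padic_mat \<times> 'p padic_mat \<Rightarrow> real \<times> real \<times> real \<times> real \<times> real" where
  "triple_invariant = (\<lambda>(A, B). (disp A, disp B, disp (minv A ** B), padic_norm (det A), padic_norm (det B)))"

lemma same_lattice_diagonal:
  assumes "padic_norm a' = padic_norm a" "padic_norm d' = padic_norm d" "a \<noteq> 0" "d \<noteq> 0"
  shows "same_lattice (mat2 a' 0 0 d') (mat2 a 0 0 d)"
  by (rule same_latticeI[of "mat2 (a' / a) 0 0 (d' / d)"])
    (use assms in \<open>auto simp: mat2_mult mat2_eq_iff mat2_GL2_Zp padic_norm_divide padic_norm_mult\<close>)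

lemma same_lattice_third:
  assumes "padic_norm c' = padic_norm c" "padic_norm t' = padic_norm t" "c \<noteq> 0" "t \<noteq> 0"
  shows "same_lattice (mat2 (t' * c') t' 0 t') (mat2 (t * c) t 0 t)"
  by (rule same_latticeI[of "mat2 (t' / t * (c' / c)) 0 0 (t' / t)"])
    (use assms in \<open>auto simp: mat2_mult mat2_eq_iff mat2_GL2_Zp padic_norm_divide padic_norm_mult\<close>)

text \<open>Both triples have tripod forms, and the invariants determine the norms of all five
  parameters, hence the same model lattices. The element that carries one centre matrix to the other
  therefore carries the whole triple along.\<close>

lemma triple_invariant_eq_imp_orbit:
  assumes det: "det A \<noteq> 0" "det B \<noteq> 0" "det A' \<noteq> 0" "det B' \<noteq> 0"
    and eq: "triple_invariant (A, B) = triple_invariant (A', B')"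
  obtains k k1 k2 where "k \<in> GL2_Zp" "k1 \<in> GL2_Zp" "k2 \<in> GL2_Zp" "A' = k ** A ** k1" "B' = k ** B ** k2"
proof -
  obtain h a b c s t where T: "tripod h a b c s t A B" using tripod_exists det(1,2) by blast
  obtain h' a' b' c' s' t' where T': "tripod h' a' b' c' s' t' A' B'" using tripod_exists det(3,4) by blast
  note D = tripod_disp[OF T] and D' = tripod_disp[OF T']
  have nz: "a \<noteq> 0" "b \<noteq> 0" "c \<noteq> 0" "s \<noteq> 0" "t \<noteq> 0" "a' \<noteq> 0" "b' \<noteq> 0" "c' \<noteq> 0" "s' \<noteq> 0" "t' \<noteq> 0"
    and h: "det h \<noteq> 0" "det h' \<noteq> 0"
    using T T' by (auto simp: tripod_def)
  define x y z x' y' z' where xyz: "x = padic_norm a" "y = padic_norm b" "z = padic_norm c"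
    "x' = padic_norm a'" "y' = padic_norm b'" "z' = padic_norm c'"
  have pos: "x > 0" "y > 0" "z > 0" "x' > 0" "y' > 0" "z' > 0" using nz by (simp_all add: xyz)
  have e: "x * y = x' * y'" "x * z = x' * z'" "y * z = y' * z'"
    using eq D D' by (simp_all add: triple_invariant_def xyz)
  \<comment> \<open>Three positive numbers are determined by their pairwise products, since
    \<open>(x * y) * (x * z) / (y * z)\<close> is the square of \<open>x\<close>.\<close>
  have "(x * y) * (x * z) * (y' * z') = (x' * y') * (x' * z') * (y * z)" by (simp add: e)
  then have "x\<^sup>2 * (y * z * y' * z') = x'\<^sup>2 * (y * z * y' * z')" by (simp add: algebra_simps power2_eq_square)
  then have "x\<^sup>2 = x'\<^sup>2" using pos by simp
  then have x: "x' = x" using pos by (simp add: power2_eq_iff_nonneg)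
  then have yz: "y' = y" "z' = z" using e pos by simp_all
  have "(padic_norm s')\<^sup>2 = (padic_norm s)\<^sup>2" "(padic_norm t')\<^sup>2 = (padic_norm t)\<^sup>2"
    using eq D D' x yz pos by (simp_all add: triple_invariant_def xyz)
  then have st: "padic_norm s' = padic_norm s" "padic_norm t' = padic_norm t"
    by (simp_all add: power2_eq_iff_nonneg)
  have n0: "same_lattice (mat2 1 0 0 a') (mat2 1 0 0 a)"
    using nz x by (intro same_lattice_diagonal) (auto simp: xyz)
  have n1: "same_lattice (mat2 (s' * b') 0 0 s') (mat2 (s * b) 0 0 s)"
    using nz yz st by (intro same_lattice_diagonal) (auto simp: xyz padic_norm_mult)
  have n2: "same_lattice (mat2 (t' * c') t' 0 t') (mat2 (t * c) t 0 t)"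
    using nz yz st by (intro same_lattice_third) (auto simp: xyz)
  define k where "k = h' ** minv h"
  have kh: "k ** h = h'" using h by (simp add: k_def matrix_mul_assoc[symmetric] minv_left)
  have tr: "same_lattice X' (k ** X)" if "same_lattice X' (h' ** Y')" "same_lattice Y' Y" "same_lattice X (h ** Y)"
    for X' X Y' Y
  proof -
    have "same_lattice (h' ** Y') (h' ** Y)" using that by (intro same_lattice_left)
    moreover have "same_lattice (h' ** Y) (k ** X)"
      using same_lattice_left[OF same_lattice_sym[OF that(3)], of k] by (simp add: matrix_mul_assoc kh)
    ultimately show ?thesis using that same_lattice_trans by blast
  qed
  \<comment> \<open>The first members of both triples are the standard lattice, so \<open>k\<close>
    stabilises it and lies in \<open>GL2_Zp\<close>.\<close>
  have "same_lattice (mat 1) (k ** mat 1)" using T T' n0 by (intro tr) (auto simp: tripod_def)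
  then have k: "k \<in> GL2_Zp"
    by (metis same_lattice_sym same_lattice_def matrix_mul_lid matrix_mul_rid)
  have "same_lattice A' (k ** A)" using T T' n1 by (intro tr) (auto simp: tripod_def)
  moreover have "same_lattice B' (k ** B)" using T T' n2 by (intro tr) (auto simp: tripod_def)
  ultimately show thesis using that k by (auto simp: same_lattice_def)
qed

text \<open>At the centre the three triangle inequalities are equalities. This \<open>h\<close>
  decides which Hecke operator is applied to the generator.\<close>

lemma tripod_centre:
  assumes "det A \<noteq> 0" "det B \<noteq> 0"
  obtains h where "det h \<noteq> 0" "disp h * disp (minv A ** h) = disp A"
    "disp h * disp (minv B ** h) = disp B"
    "disp (minv A ** h) * disp (minv B ** h) = disp (minv A ** B)"
proof -
  obtain h a b c s t where T: "tripod h a b c s t A B" using tripod_exists assms by blast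
  then have "det h \<noteq> 0" by (simp add: tripod_def)
  then show thesis using tripod_disp[OF T] by (intro that) (auto simp: mult.commute)
qed

lemma triple_invariant_orbit:
  assumes "k \<in> GL2_Zp" "k1 \<in> GL2_Zp" "k2 \<in> GL2_Zp" "det A \<noteq> 0"
  shows "triple_invariant (k ** A ** k1, k ** B ** k2) = triple_invariant (A, B)"
proof -
  have "minv (k ** A ** k1) ** (k ** B ** k2) = minv k1 ** (minv A ** (minv k ** k) ** B) ** k2"
    using assms by (simp add: minv_mult GL2_Zp_det det_mul matrix_mul_assoc)
  then show ?thesis using assms
    by (simp add: triple_invariant_def minv_left GL2_Zp_det GL2_Zp_minv)
qed


section \<open>Sums over coset representatives\<close>

definition transversal :: "('a, 'b) monoid_scheme \<Rightarrow> 'a set \<Rightarrow> 'a set \<Rightarrow> bool" where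
  "transversal G K R \<longleftrightarrow> R \<subseteq> carrier G \<and>
     (\<forall>g\<in>carrier G. \<exists>!r. r \<in> R \<and> (\<exists>k\<in>K. g = r \<otimes>\<^bsub>G\<^esub> k))"

text \<open>The value is 0 if \<open>F\<close> has infinite support on \<open>R\<close>.\<close>

definition csum :: "'a set \<Rightarrow> ('a \<Rightarrow> complex) \<Rightarrow> complex" where
  "csum R F = sum F {r \<in> R. F r \<noteq> 0}"

lemma csum_eq_sum:
  assumes "finite S" "S \<subseteq> R" "\<And>r. r \<in> R \<Longrightarrow> F r \<noteq> 0 \<Longrightarrow> r \<in> S"
  shows "csum R F = sum F S"
  unfolding csum_def using assms by (intro sum.mono_neutral_left) auto

lemma csum_cong: "(\<And>r. r \<in> R \<Longrightarrow> F r = F' r) \<Longrightarrow> csum R F = csum R F'"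
  unfolding csum_def by (intro sum.cong) auto

lemma csum_mult_left: "csum R (\<lambda>r. c * F r) = c * csum R F"
  by (cases "c = 0") (auto simp: csum_def sum_distrib_left intro: sum.cong)

lemma csum_add:
  assumes "finite {r \<in> R. F r \<noteq> 0}" "finite {r \<in> R. F' r \<noteq> 0}"
  shows "csum R (\<lambda>r. F r + F' r) = csum R F + csum R F'"
proof -
  let ?S = "{r \<in> R. F r \<noteq> 0} \<union> {r \<in> R. F' r \<noteq> 0}"
  have S: "finite ?S" "?S \<subseteq> R" using assms by auto
  have "csum R (\<lambda>r. F r + F' r) = sum (\<lambda>r. F r + F' r) ?S" using S by (intro csum_eq_sum) auto
  also have "\<dots> = sum F ?S + sum F' ?S" by (rule sum.distrib)
  also have "sum F ?S = csum R F" using S by (intro csum_eq_sum[symmetric]) auto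
  also have "sum F' ?S = csum R F'" using S by (intro csum_eq_sum[symmetric]) auto
  finally show ?thesis .
qed

lemma csum_sum:
  assumes "\<And>i. i \<in> I \<Longrightarrow> finite {r \<in> R. F i r \<noteq> 0}" "finite I"
  shows "csum R (\<lambda>r. \<Sum>i\<in>I. F i r) = (\<Sum>i\<in>I. csum R (F i))"
proof -
  let ?S = "\<Union>i\<in>I. {r \<in> R. F i r \<noteq> 0}"
  have S: "finite ?S" "?S \<subseteq> R" using assms by auto
  have "csum R (\<lambda>r. \<Sum>i\<in>I. F i r) = (\<Sum>r\<in>?S. \<Sum>i\<in>I. F i r)"
    using S by (intro csum_eq_sum) (auto dest: sum.not_neutral_contains_not_neutral)
  also have "\<dots> = (\<Sum>i\<in>I. sum (F i) ?S)" by (rule sum.swap)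
  also have "\<dots> = (\<Sum>i\<in>I. csum R (F i))"
    using S by (intro sum.cong csum_eq_sum[symmetric]) auto
  finally show ?thesis .
qed

text \<open>Compact support is replaced by finite support on representatives, so that the algebra
  can be developed without topology or measure; \<open>hecke_algebra_carrier\<close> gives the
  comparison.\<close>

definition hecke_functions ::
  "('a, 'b) monoid_scheme \<Rightarrow> 'a set \<Rightarrow> 'a set \<Rightarrow> ('a \<Rightarrow> complex) set" where
  "hecke_functions G K R = {\<Phi>. (\<forall>x. \<Phi> x \<noteq> 0 \<longrightarrow> x \<in> carrier G) \<and> finite {r \<in> R. \<Phi> r \<noteq> 0} \<and>
     (\<forall>k\<in>K. \<forall>x\<in>carrier G. \<Phi> (k \<otimes>\<^bsub>G\<^esub> x) = \<Phi> x \<and> \<Phi> (x \<otimes>\<^bsub>G\<^esub> k) = \<Phi> x)}"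

locale coset_group = group G for G :: "('a, 'b) monoid_scheme" (structure) +
  fixes K R :: "'a set"
  assumes subgroup_K: "subgroup K G" and transversal_R: "transversal G K R"
begin

lemma K_carrier: "k \<in> K \<Longrightarrow> k \<in> carrier G"
  using subgroup.subset[OF subgroup_K] by blast

lemma R_carrier: "r \<in> R \<Longrightarrow> r \<in> carrier G"
  using transversal_R by (auto simp: transversal_def)

lemma K_inv: "k \<in> K \<Longrightarrow> inv k \<in> K"
  by (rule subgroup.m_inv_closed[OF subgroup_K])

lemma K_mult: "k \<in> K \<Longrightarrow> l \<in> K \<Longrightarrow> k \<otimes> l \<in> K"
  by (rule subgroup.m_closed[OF subgroup_K])

lemma K_one: "\<one> \<in> K"
  by (rule subgroup.one_closed[OF subgroup_K])

lemma R_exists: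
  assumes "g \<in> carrier G" obtains r k where "r \<in> R" "k \<in> K" "g = r \<otimes> k"
  using assms transversal_R unfolding transversal_def by metis

lemma R_unique:
  assumes "r \<in> R" "s \<in> R" "k \<in> K" "l \<in> K" "r \<otimes> k = s \<otimes> l" shows "r = s"
proof -
  have "r \<otimes> k \<in> carrier G" using assms R_carrier K_carrier by blast
  then show ?thesis using assms transversal_R unfolding transversal_def by metis
qed

definition rinv :: "('a \<Rightarrow> complex) \<Rightarrow> bool" where
  "rinv F \<longleftrightarrow> (\<forall>g\<in>carrier G. \<forall>k\<in>K. F (g \<otimes> k) = F g)"

text \<open>Left translation permutes the cosets of \<open>K\<close>, hence their representatives up
  to right factors in \<open>K\<close>.\<close>

lemma R_translate:
  assumes g: "g \<in> carrier G"
  obtains \<phi> where "bij_betw \<phi> R R" "\<And>r. r \<in> R \<Longrightarrow> \<exists>k\<in>K. g \<otimes> r = \<phi> r \<otimes> k"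
proof -
  have "\<forall>r\<in>R. \<exists>s. s \<in> R \<and> (\<exists>k\<in>K. g \<otimes> r = s \<otimes> k)"
    using R_exists g R_carrier by (metis m_closed)
  then obtain \<phi> where \<phi>: "\<And>r. r \<in> R \<Longrightarrow> \<phi> r \<in> R" "\<And>r. r \<in> R \<Longrightarrow> \<exists>k\<in>K. g \<otimes> r = \<phi> r \<otimes> k"
    by metis
  have "inj_on \<phi> R"
  proof (rule inj_onI)
    fix r s assume rs: "r \<in> R" "s \<in> R" "\<phi> r = \<phi> s"
    obtain k l where k: "k \<in> K" "g \<otimes> r = \<phi> r \<otimes> k" and l: "l \<in> K" "g \<otimes> s = \<phi> s \<otimes> l"
      using \<phi>(2) rs by metis
    have "(g \<otimes> r) \<otimes> inv k = \<phi> r" "(g \<otimes> s) \<otimes> inv l = \<phi> s"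
      unfolding k(2) l(2) using k(1) l(1) rs \<phi>(1) R_carrier K_carrier by (simp_all add: m_assoc)
    then have "(g \<otimes> r) \<otimes> inv k = (g \<otimes> s) \<otimes> inv l" using rs by simp
    then have "r \<otimes> inv k = s \<otimes> inv l"
      using g k(1) l(1) rs R_carrier K_carrier by (simp add: m_assoc)
    then show "r = s" using rs k l K_inv R_unique by blast
  qed
  moreover have "\<exists>r\<in>R. \<phi> r = s" if s: "s \<in> R" for s
  proof -
    obtain r k where r: "r \<in> R" "k \<in> K" "inv g \<otimes> s = r \<otimes> k"
      using R_exists g s R_carrier by (metis m_closed inv_closed)
    have "s = g \<otimes> (inv g \<otimes> s)" using g s R_carrier by (simp add: m_assoc[symmetric])
    also have "\<dots> = g \<otimes> r \<otimes> k" using r g R_carrier K_carrier by (simp add: m_assoc)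
    finally have s': "s = g \<otimes> r \<otimes> k" .
    obtain l where l: "l \<in> K" "g \<otimes> r = \<phi> r \<otimes> l" using \<phi>(2) r by blast
    have "s \<otimes> \<one> = \<phi> r \<otimes> (l \<otimes> k)"
      using s' l r s \<phi>(1) R_carrier K_carrier by (simp add: m_assoc)
    then have "s = \<phi> r" using R_unique s \<phi>(1) r K_one K_mult l by blast
    then show ?thesis using r by blast
  qed
  ultimately have "bij_betw \<phi> R R" using \<phi>(1) by (auto simp: bij_betw_def)
  then show thesis using that \<phi>(2) by blast
qed

text \<open>Left invariance of counting on the coset space: the discrete form of the invariance of
  Haar measure, and the substitution rule for all sums below.\<close>

lemma
  assumes F: "rinv F" and g: "g \<in> carrier G"
  shows csum_translate: "csum R (\<lambda>x. F (g \<otimes> x)) = csum R F"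
    and finite_translate: "finite {r \<in> R. F (g \<otimes> r) \<noteq> 0} \<longleftrightarrow> finite {r \<in> R. F r \<noteq> 0}"
proof -
  obtain \<phi> where \<phi>: "bij_betw \<phi> R R" "\<And>r. r \<in> R \<Longrightarrow> \<exists>k\<in>K. g \<otimes> r = \<phi> r \<otimes> k"
    using R_translate g by blast
  have eq: "F (g \<otimes> r) = F (\<phi> r)" if "r \<in> R" for r
  proof -
    have "\<phi> r \<in> carrier G" using \<phi>(1) that R_carrier by (meson bij_betwE)
    then show ?thesis using \<phi>(2)[OF that] F by (metis rinv_def)
  qed
  have bij: "bij_betw \<phi> {r \<in> R. F (g \<otimes> r) \<noteq> 0} {r \<in> R. F r \<noteq> 0}"
    using \<phi>(1) eq unfolding bij_betw_def by (fastforce intro: inj_on_subset)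
  show "finite {r \<in> R. F (g \<otimes> r) \<noteq> 0} \<longleftrightarrow> finite {r \<in> R. F r \<noteq> 0}"
    by (rule bij_betw_finite[OF bij])
  show "csum R (\<lambda>x. F (g \<otimes> x)) = csum R F"
    unfolding csum_def sum.reindex_bij_betw[OF bij, symmetric] by (intro sum.cong) (auto simp: eq)
qed

abbreviation hfun where "hfun \<equiv> hecke_functions G K R"

lemma hfun_carrier: "\<Phi> \<in> hfun \<Longrightarrow> \<Phi> x \<noteq> 0 \<Longrightarrow> x \<in> carrier G"
  by (auto simp: hecke_functions_def)

lemma hfun_finite: "\<Phi> \<in> hfun \<Longrightarrow> finite {r \<in> R. \<Phi> r \<noteq> 0}"
  by (auto simp: hecke_functions_def)

lemma hfun_left: "\<Phi> \<in> hfun \<Longrightarrow> k \<in> K \<Longrightarrow> x \<in> carrier G \<Longrightarrow> \<Phi> (k \<otimes> x) = \<Phi> x"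
  by (auto simp: hecke_functions_def)

lemma hfun_right: "\<Phi> \<in> hfun \<Longrightarrow> k \<in> K \<Longrightarrow> x \<in> carrier G \<Longrightarrow> \<Phi> (x \<otimes> k) = \<Phi> x"
  by (auto simp: hecke_functions_def)

lemma hfun_rinv: "\<Phi> \<in> hfun \<Longrightarrow> rinv \<Phi>"
  by (auto simp: rinv_def hfun_right)

lemma hfun_zero: "(\<lambda>_. 0) \<in> hfun"
  by (auto simp: hecke_functions_def)

lemma hfun_add:
  assumes "\<Phi> \<in> hfun" "\<Psi> \<in> hfun" shows "(\<lambda>z. \<Phi> z + \<Psi> z) \<in> hfun"
proof -
  have "finite {r \<in> R. \<Phi> r + \<Psi> r \<noteq> 0}"
    by (rule finite_subset[OF _ finite_UnI[OF assms[THEN hfun_finite]]]) auto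
  moreover have "x \<in> carrier G" if "\<Phi> x + \<Psi> x \<noteq> 0" for x
    using that assms[THEN hfun_carrier, of x] by (cases "\<Phi> x = 0") auto
  ultimately show ?thesis using assms by (auto simp: hecke_functions_def)
qed

lemma hfun_scale:
  assumes "\<Phi> \<in> hfun" shows "(\<lambda>z. c * \<Phi> z) \<in> hfun"
proof -
  have "finite {r \<in> R. c * \<Phi> r \<noteq> 0}"
    by (rule finite_subset[OF _ hfun_finite[OF assms]]) auto
  then show ?thesis using assms by (auto simp: hecke_functions_def)
qed

lemma hfun_indicator: "indicator K \<in> hfun"
proof -
  obtain r k where r: "r \<in> R" "k \<in> K" "\<one> = r \<otimes> k" using R_exists by blast
  have "s = r" if "s \<in> R" "s \<in> K" for s
  proof -
    have "s \<otimes> \<one> = r \<otimes> (k \<otimes> s)"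
      using r that by (simp add: m_assoc[symmetric] R_carrier K_carrier flip: r(3))
    then show ?thesis using R_unique that r K_one K_mult by blast
  qed
  then have "{r \<in> R. indicator K r \<noteq> (0::complex)} \<subseteq> {r}" by (auto simp: indicator_def)
  moreover have "k \<otimes> x \<in> K \<longleftrightarrow> x \<in> K" "x \<otimes> k \<in> K \<longleftrightarrow> x \<in> K" if "k \<in> K" "x \<in> carrier G" for k x
  proof -
    have "inv k \<otimes> (k \<otimes> x) = x" "x \<otimes> k \<otimes> inv k = x"
      using that K_carrier by (simp_all add: m_assoc[symmetric], simp add: m_assoc)
    then show "k \<otimes> x \<in> K \<longleftrightarrow> x \<in> K" "x \<otimes> k \<in> K \<longleftrightarrow> x \<in> K"
      using that K_mult K_inv by metis+
  qed
  ultimately show ?thesis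
    by (auto simp: hecke_functions_def indicator_def K_carrier intro: finite_subset)
qed

definition conv :: "('a \<Rightarrow> complex) \<Rightarrow> ('a \<Rightarrow> complex) \<Rightarrow> 'a \<Rightarrow> complex" where
  "conv \<Phi> \<Psi> x = (if x \<in> carrier G then csum R (\<lambda>\<gamma>. \<Phi> \<gamma> * \<Psi> (inv \<gamma> \<otimes> x)) else 0)"

end

text \<open>Here \<open>act \<gamma>\<close> plays the role of the action of \<open>\<gamma>\<^sup>-\<^sup>1\<close>, whence the contravariance. Convolution is the
  case of \<open>G\<close> acting on itself.\<close>

locale coset_group_action = coset_group +
  fixes X :: "'x set" and act :: "'a \<Rightarrow> 'x \<Rightarrow> 'x"
  assumes act_closed: "\<gamma> \<in> carrier G \<Longrightarrow> x \<in> X \<Longrightarrow> act \<gamma> x \<in> X"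
    and act_mult: "\<gamma> \<in> carrier G \<Longrightarrow> \<delta> \<in> carrier G \<Longrightarrow> x \<in> X \<Longrightarrow> act (\<gamma> \<otimes> \<delta>) x = act \<delta> (act \<gamma> x)"
begin

definition act_inv :: "('x \<Rightarrow> complex) \<Rightarrow> bool" where
  "act_inv f \<longleftrightarrow> (\<forall>k\<in>K. \<forall>x\<in>X. f (act k x) = f x)"

definition hact :: "('a \<Rightarrow> complex) \<Rightarrow> ('x \<Rightarrow> complex) \<Rightarrow> 'x \<Rightarrow> complex" where
  "hact \<Phi> f x = (if x \<in> X then csum R (\<lambda>\<gamma>. \<Phi> \<gamma> * f (act \<gamma> x)) else 0)"

lemma rinv_hact:
  assumes "\<Phi> \<in> hfun" "act_inv f" "x \<in> X"
  shows "rinv (\<lambda>\<gamma>. \<Phi> \<gamma> * f (act \<gamma> x))"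
  using assms by (auto simp: rinv_def hfun_right act_mult K_carrier act_inv_def act_closed)

lemma finite_hact: "\<Phi> \<in> hfun \<Longrightarrow> finite {r \<in> R. \<Phi> r * f r \<noteq> 0}"
  by (rule finite_subset[OF _ hfun_finite]) auto

lemma hact_eq_sum: "\<Phi> \<in> hfun \<Longrightarrow> x \<in> X \<Longrightarrow> hact \<Phi> f x = (\<Sum>\<gamma> | \<gamma> \<in> R \<and> \<Phi> \<gamma> \<noteq> 0. \<Phi> \<gamma> * f (act \<gamma> x))"
  unfolding hact_def by (auto intro!: csum_eq_sum simp: hfun_finite)

lemma hact_inv:
  assumes \<Phi>: "\<Phi> \<in> hfun" and f: "act_inv f"
  shows "act_inv (hact \<Phi> f)"
  unfolding act_inv_def
proof (intro ballI)
  fix k x assume k: "k \<in> K" and x: "x \<in> X"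
  let ?F = "\<lambda>\<gamma>. \<Phi> \<gamma> * f (act \<gamma> x)"
  have "hact \<Phi> f (act k x) = csum R (\<lambda>\<gamma>. ?F (k \<otimes> \<gamma>))"
    using k x \<Phi> unfolding hact_def
    by (auto simp: act_closed K_carrier act_mult R_carrier hfun_left intro!: csum_cong)
  also have "\<dots> = csum R ?F"
    by (intro csum_translate rinv_hact \<Phi> f x K_carrier k)
  finally show "hact \<Phi> f (act k x) = hact \<Phi> f x" using x by (simp add: hact_def)
qed

text \<open>For each fixed \<open>\<delta>\<close>, the sum over \<open>\<gamma>\<close> is
  translated by the inverse of \<open>\<delta>\<close>. Only finitely many \<open>\<delta>\<close>
  contribute, so the two sums may be exchanged.\<close>

lemma hact_conv:
  assumes \<Phi>: "\<Phi> \<in> hfun" and \<Psi>: "\<Psi> \<in> hfun" and f: "act_inv f"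
  shows "hact (conv \<Phi> \<Psi>) f = hact \<Phi> (hact \<Psi> f)"
proof
  fix x show "hact (conv \<Phi> \<Psi>) f x = hact \<Phi> (hact \<Psi> f) x"
  proof (cases "x \<in> X")
    case x: True
    define S where "S = {\<delta> \<in> R. \<Phi> \<delta> \<noteq> 0}"
    have S: "finite S" "S \<subseteq> R" "\<And>\<delta>. \<delta> \<in> S \<Longrightarrow> \<delta> \<in> carrier G"
      using hfun_finite[OF \<Phi>] R_carrier by (auto simp: S_def)
    define F where "F = (\<lambda>\<delta> \<gamma>. \<Psi> \<gamma> * f (act \<gamma> (act \<delta> x)))"
    have F: "rinv (F \<delta>)" if "\<delta> \<in> S" for \<delta>
      unfolding F_def by (intro rinv_hact \<Psi> f act_closed S(3) that x)
    have Ffin: "finite {r \<in> R. F \<delta> r \<noteq> 0}" for \<delta>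
      unfolding F_def by (rule finite_hact[OF \<Psi>])
    have Feq: "F \<delta> (inv \<delta> \<otimes> \<gamma>) = \<Psi> (inv \<delta> \<otimes> \<gamma>) * f (act \<gamma> x)" if "\<delta> \<in> S" "\<gamma> \<in> R" for \<delta> \<gamma>
    proof -
      have "act (inv \<delta> \<otimes> \<gamma>) (act \<delta> x) = act (\<delta> \<otimes> (inv \<delta> \<otimes> \<gamma>)) x"
        using that S R_carrier x by (simp add: act_mult del: m_assoc)
      also have "\<delta> \<otimes> (inv \<delta> \<otimes> \<gamma>) = \<gamma>" using that S R_carrier by (simp add: m_assoc[symmetric])
      finally show ?thesis by (simp add: F_def)
    qed
    have "hact (conv \<Phi> \<Psi>) f x = csum R (\<lambda>\<gamma>. \<Sum>\<delta>\<in>S. \<Phi> \<delta> * F \<delta> (inv \<delta> \<otimes> \<gamma>))"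
      unfolding hact_def if_P[OF x]
    proof (rule csum_cong)
      fix \<gamma> assume \<gamma>: "\<gamma> \<in> R"
      have "conv \<Phi> \<Psi> \<gamma> = (\<Sum>\<delta>\<in>S. \<Phi> \<delta> * \<Psi> (inv \<delta> \<otimes> \<gamma>))"
        unfolding conv_def using \<gamma> S by (auto intro!: csum_eq_sum simp: R_carrier S_def)
      then show "conv \<Phi> \<Psi> \<gamma> * f (act \<gamma> x) = (\<Sum>\<delta>\<in>S. \<Phi> \<delta> * F \<delta> (inv \<delta> \<otimes> \<gamma>))"
        using Feq \<gamma> by (auto simp: sum_distrib_right mult.assoc intro!: sum.cong)
    qed
    also have "\<dots> = (\<Sum>\<delta>\<in>S. csum R (\<lambda>\<gamma>. \<Phi> \<delta> * F \<delta> (inv \<delta> \<otimes> \<gamma>)))"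
    proof (rule csum_sum)
      fix \<delta> assume "\<delta> \<in> S"
      then have "finite {r \<in> R. F \<delta> (inv \<delta> \<otimes> r) \<noteq> 0}" using F Ffin finite_translate S by simp
      then show "finite {r \<in> R. \<Phi> \<delta> * F \<delta> (inv \<delta> \<otimes> r) \<noteq> 0}" by (rule rev_finite_subset) auto
    qed (rule S)
    also have "\<dots> = (\<Sum>\<delta>\<in>S. \<Phi> \<delta> * csum R (F \<delta>))"
      using F S by (intro sum.cong) (auto simp: csum_mult_left csum_translate)
    also have "\<dots> = (\<Sum>\<delta>\<in>S. \<Phi> \<delta> * hact \<Psi> f (act \<delta> x))"
      using S x by (intro sum.cong) (auto simp: F_def hact_def act_closed)
    also have "\<dots> = hact \<Phi> (hact \<Psi> f) x" by (simp add: hact_eq_sum \<Phi> x S_def)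
    finally show ?thesis .
  qed (simp add: hact_def)
qed

lemma hact_add_left:
  "\<Phi> \<in> hfun \<Longrightarrow> \<Psi> \<in> hfun \<Longrightarrow> hact (\<lambda>z. \<Phi> z + \<Psi> z) f = (\<lambda>x. hact \<Phi> f x + hact \<Psi> f x)"
  by (auto simp: hact_def fun_eq_iff distrib_right intro!: csum_add finite_hact)

lemma hact_add_right:
  "\<Phi> \<in> hfun \<Longrightarrow> hact \<Phi> (\<lambda>x. f x + f' x) = (\<lambda>x. hact \<Phi> f x + hact \<Phi> f' x)"
  by (auto simp: hact_def fun_eq_iff distrib_left intro!: csum_add finite_hact)

lemma hact_scale_left: "hact (\<lambda>z. c * \<Phi> z) f = (\<lambda>x. c * hact \<Phi> f x)"
  by (auto simp: hact_def fun_eq_iff csum_mult_left mult.assoc)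

text \<open>Exactly one representative lies in \<open>K\<close>. It need not be the identity, so the
  invariance of \<open>f\<close> removes it.\<close>

lemma hact_indicator:
  assumes f: "act_inv f" and x: "x \<in> X" and one: "act \<one> x = x"
  shows "hact (indicator K) f x = f x"
proof -
  obtain r k where r: "r \<in> R" "k \<in> K" "\<one> = r \<otimes> k" using R_exists by blast
  have rK: "r \<in> K"
    using r K_inv[of k] by (metis K_carrier R_carrier inv_equality inv_inv)
  have "s = r" if "s \<in> R" "s \<in> K" for s
  proof -
    have "s \<otimes> \<one> = r \<otimes> (k \<otimes> s)"
      using r that by (simp add: m_assoc[symmetric] R_carrier K_carrier flip: r(3))
    then show ?thesis using R_unique that r K_one K_mult by blast
  qed
  then have "hact (indicator K) f x = sum (\<lambda>\<gamma>. indicator K \<gamma> * f (act \<gamma> x)) {r}"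
    unfolding hact_def if_P[OF x] using r by (intro csum_eq_sum) (auto simp: indicator_def split: if_splits)
  then show ?thesis using rK f x by (simp add: act_inv_def)
qed

end

context coset_group begin

sublocale self: coset_group_action G K R "carrier G" "\<lambda>\<gamma> x. inv \<gamma> \<otimes> x"
  by unfold_locales (auto simp: inv_mult_group m_assoc)

lemma conv_eq_hact: "conv \<Phi> \<Psi> = self.hact \<Phi> \<Psi>"
  by (simp add: conv_def self.hact_def fun_eq_iff)

lemma hfun_act_inv: "\<Psi> \<in> hfun \<Longrightarrow> self.act_inv \<Psi>"
  by (auto simp: self.act_inv_def hfun_left K_inv)

lemma conv_closed:
  assumes \<Phi>: "\<Phi> \<in> hfun" and \<Psi>: "\<Psi> \<in> hfun" shows "conv \<Phi> \<Psi> \<in> hfun"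
proof -
  have inv: "self.act_inv (conv \<Phi> \<Psi>)"
    unfolding conv_eq_hact by (intro self.hact_inv \<Phi> hfun_act_inv \<Psi>)
  have left: "conv \<Phi> \<Psi> (k \<otimes> x) = conv \<Phi> \<Psi> x" if "k \<in> K" "x \<in> carrier G" for k x
    using inv that K_inv[of k] by (metis self.act_inv_def inv_inv K_carrier)
  have right: "conv \<Phi> \<Psi> (x \<otimes> k) = conv \<Phi> \<Psi> x" if "k \<in> K" "x \<in> carrier G" for k x
    using that \<Psi> by (auto simp: conv_def K_carrier R_carrier m_assoc[symmetric] hfun_right intro!: csum_cong)
  let ?S = "{\<delta> \<in> R. \<Phi> \<delta> \<noteq> 0}"
  \<comment> \<open>The support of a convolution lies in the translates of the second support by the
    finitely many representatives in the first.\<close>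
  have "finite (\<Union>\<delta>\<in>?S. {r \<in> R. \<Psi> (inv \<delta> \<otimes> r) \<noteq> 0})"
    using hfun_finite[OF \<Phi>] hfun_finite[OF \<Psi>] finite_translate[OF hfun_rinv[OF \<Psi>]] R_carrier by auto
  moreover have "{r \<in> R. conv \<Phi> \<Psi> r \<noteq> 0} \<subseteq> (\<Union>\<delta>\<in>?S. {r \<in> R. \<Psi> (inv \<delta> \<otimes> r) \<noteq> 0})"
    by (fastforce simp: conv_def csum_def elim!: sum.not_neutral_contains_not_neutral split: if_splits)
  ultimately have "finite {r \<in> R. conv \<Phi> \<Psi> r \<noteq> 0}" by (rule rev_finite_subset)
  moreover have "\<forall>x. conv \<Phi> \<Psi> x \<noteq> 0 \<longrightarrow> x \<in> carrier G" by (auto simp: conv_def)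
  ultimately show ?thesis using left right by (auto simp: hecke_functions_def)
qed

lemma conv_assoc:
  "\<Phi> \<in> hfun \<Longrightarrow> \<Psi> \<in> hfun \<Longrightarrow> \<Theta> \<in> hfun \<Longrightarrow> conv (conv \<Phi> \<Psi>) \<Theta> = conv \<Phi> (conv \<Psi> \<Theta>)"
  using self.hact_conv[of \<Phi> \<Psi> \<Theta>] by (simp add: conv_eq_hact hfun_act_inv)

lemma conv_one_left: "\<Phi> \<in> hfun \<Longrightarrow> conv (indicator K) \<Phi> = \<Phi>"
  using self.hact_indicator[OF hfun_act_inv, of \<Phi>] hfun_carrier[of \<Phi>]
  by (fastforce simp: fun_eq_iff conv_eq_hact self.hact_def)

text \<open>Only the representative of the coset of \<open>x\<close> contributes, and right
  invariance replaces it by \<open>x\<close>.\<close>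

lemma conv_one_right:
  assumes \<Phi>: "\<Phi> \<in> hfun" shows "conv \<Phi> (indicator K) = \<Phi>"
proof
  fix x show "conv \<Phi> (indicator K) x = \<Phi> x"
  proof (cases "x \<in> carrier G")
    case True
    then obtain r k where r: "r \<in> R" "k \<in> K" "x = r \<otimes> k" using R_exists by blast
    have "s = r" if "s \<in> R" "inv s \<otimes> x \<in> K" for s
    proof (rule R_unique[OF that(1) r(1) that(2) r(2)])
      show "s \<otimes> (inv s \<otimes> x) = r \<otimes> k"
        using that True r(3) by (simp add: m_assoc[symmetric] R_carrier)
    qed
    then have "conv \<Phi> (indicator K) x = sum (\<lambda>\<gamma>. \<Phi> \<gamma> * indicator K (inv \<gamma> \<otimes> x)) {r}"
      unfolding conv_def if_P[OF True] using r(1)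
      by (intro csum_eq_sum) (auto simp: indicator_def split: if_splits)
    moreover have "inv r \<otimes> x = k" using r by (simp add: m_assoc[symmetric] R_carrier K_carrier)
    moreover have "sum F {r} = F r" for F :: "'a \<Rightarrow> complex" by simp
    ultimately have "conv \<Phi> (indicator K) x = \<Phi> r * indicator K k" by (simp only:)
    then show ?thesis using r \<Phi> by (simp add: hfun_right R_carrier)
  next
    case False
    then show ?thesis using hfun_carrier[OF \<Phi>] by (auto simp: conv_def)
  qed
qed

lemma conv_add_left:
  "\<Phi> \<in> hfun \<Longrightarrow> \<Psi> \<in> hfun \<Longrightarrow> conv (\<lambda>z. \<Phi> z + \<Psi> z) \<Theta> = (\<lambda>x. conv \<Phi> \<Theta> x + conv \<Psi> \<Theta> x)"
  by (simp add: conv_eq_hact self.hact_add_left)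

lemma conv_add_right:
  "\<Phi> \<in> hfun \<Longrightarrow> conv \<Phi> (\<lambda>x. \<Psi> x + \<Theta> x) = (\<lambda>x. conv \<Phi> \<Psi> x + conv \<Phi> \<Theta> x)"
  by (simp add: conv_eq_hact self.hact_add_right)

end

section \<open>Existence of representatives, also for products\<close>

lemma transversal_exists:
  fixes G (structure)
  assumes "group G" and K: "subgroup K G"
  obtains R where "transversal G K R"
proof -
  interpret group G by fact
  interpret subgroup K G by fact
  define E where "E g h \<longleftrightarrow> (\<exists>k\<in>K. g = h \<otimes> k)" for g h
  have sym: "E h g" if e: "E g h" and "g \<in> carrier G" "h \<in> carrier G" for g h
  proof -
    obtain k where "k \<in> K" "g = h \<otimes> k" using e unfolding E_def by blast
    then have "h = g \<otimes> inv k" using that by (simp add: m_assoc)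
    then show ?thesis using \<open>k \<in> K\<close> by (auto simp: E_def)
  qed
  have trans: "E f h" if "E f g" "E g h" "h \<in> carrier G" for f g h
    using that by (auto simp: E_def m_assoc intro!: bexI[of _ "_ \<otimes> _"])
  have refl: "E g g" if "g \<in> carrier G" for g
    using that by (auto simp: E_def intro!: bexI[of _ \<one>])
  define rep where "rep g = (SOME r. r \<in> carrier G \<and> E g r)" for g
  have rep: "rep g \<in> carrier G \<and> E g (rep g)" if "g \<in> carrier G" for g
    unfolding rep_def by (rule someI[of _ g]) (simp add: that refl)
  \<comment> \<open>Elements of one coset give the same predicate to the choice operator, hence
    literally the same representative.\<close>
  have same: "rep g = rep h" if "E g h" "g \<in> carrier G" "h \<in> carrier G" for g h
  proof -
    have "(r \<in> carrier G \<and> E g r) = (r \<in> carrier G \<and> E h r)" for r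
      using that sym trans by blast
    then show ?thesis by (simp add: rep_def)
  qed
  have "\<exists>!r. r \<in> rep ` carrier G \<and> E g r" if g: "g \<in> carrier G" for g
  proof (rule ex1I[of _ "rep g"])
    show "rep g \<in> rep ` carrier G \<and> E g (rep g)" using g rep by blast
    fix r assume r: "r \<in> rep ` carrier G \<and> E g r"
    then obtain h where h: "h \<in> carrier G" "r = rep h" by blast
    have hr: "r \<in> carrier G" "E h r" using h rep[OF h(1)] by simp_all
    note h(2)
    also have "rep h = rep r" by (rule same[OF hr(2) h(1) hr(1)])
    also have "rep r = rep g" by (rule same[OF conjunct2[OF r] g hr(1), symmetric])
    finally show "r = rep g" .
  qed
  then have "transversal G K (rep ` carrier G)"
    using rep by (auto simp: transversal_def E_def)
  then show thesis by (rule that)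
qed

lemma transversal_DirProd:
  assumes "transversal G K R" "transversal H L S"
  shows "transversal (G \<times>\<times> H) (K \<times> L) (R \<times> S)"
  unfolding transversal_def
proof (intro conjI ballI)
  show "R \<times> S \<subseteq> carrier (G \<times>\<times> H)" using assms by (auto simp: transversal_def)
  fix z assume "z \<in> carrier (G \<times>\<times> H)"
  then obtain g h where z: "z = (g, h)" "g \<in> carrier G" "h \<in> carrier H" by (auto simp: DirProd_def)
  have 1: "\<exists>!r. r \<in> R \<and> (\<exists>k\<in>K. g = r \<otimes>\<^bsub>G\<^esub> k)" and 2: "\<exists>!r. r \<in> S \<and> (\<exists>k\<in>L. h = r \<otimes>\<^bsub>H\<^esub> k)"
    using assms z by (auto simp: transversal_def)
  obtain r where r: "r \<in> R" "\<exists>k\<in>K. g = r \<otimes>\<^bsub>G\<^esub> k" "\<And>r'. r' \<in> R \<Longrightarrow> \<exists>k\<in>K. g = r' \<otimes>\<^bsub>G\<^esub> k \<Longrightarrow> r' = r"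
    using 1 by (elim ex1E) blast
  obtain s where s: "s \<in> S" "\<exists>k\<in>L. h = s \<otimes>\<^bsub>H\<^esub> k" "\<And>s'. s' \<in> S \<Longrightarrow> \<exists>k\<in>L. h = s' \<otimes>\<^bsub>H\<^esub> k \<Longrightarrow> s' = s"
    using 2 by (elim ex1E) blast
  show "\<exists>!q. q \<in> R \<times> S \<and> (\<exists>k\<in>K \<times> L. z = q \<otimes>\<^bsub>G \<times>\<times> H\<^esub> k)"
  proof (rule ex1I[of _ "(r, s)"])
    show "(r, s) \<in> R \<times> S \<and> (\<exists>k\<in>K \<times> L. z = (r, s) \<otimes>\<^bsub>G \<times>\<times> H\<^esub> k)" using r(1,2) s(1,2) z by auto
    show "q = (r, s)" if "q \<in> R \<times> S \<and> (\<exists>k\<in>K \<times> L. z = q \<otimes>\<^bsub>G \<times>\<times> H\<^esub> k)" for q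
      using that r(3) s(3) z by (cases q) auto
  qed
qed


section \<open>Haar measures and spherical Hecke algebras\<close>

text \<open>Open cosets let a compact set meet only finitely many of them; compact cosets turn
  finite support on representatives back into compact support; the volume 1 removes all weights from
  the sums.\<close>

locale haar_pair = coset_group G K R
  for G :: "('a::topological_space, 'b) monoid_scheme" (structure) and K R +
  fixes \<mu> :: "'a measure"
  assumes open_coset: "g \<in> carrier G \<Longrightarrow> open ((\<lambda>x. g \<otimes> x) ` K)"
    and compact_coset: "g \<in> carrier G \<Longrightarrow> compact ((\<lambda>x. g \<otimes> x) ` K)"
    and haar: "haar_measure G \<mu>" and measure_K: "emeasure \<mu> K = 1"
begin

lemma space_mu: "space \<mu> = carrier G"
proof -
  have "space \<mu> = space (restrict_space borel (carrier G))"
    using haar by (intro sets_eq_imp_space_eq) (simp add: haar_measure_def)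
  then show ?thesis by (simp add: space_restrict_space)
qed

lemma coset_subset: "g \<in> carrier G \<Longrightarrow> (\<lambda>x. g \<otimes> x) ` K \<subseteq> carrier G"
  using K_carrier by auto

lemma coset_sets:
  assumes "g \<in> carrier G" shows "(\<lambda>x. g \<otimes> x) ` K \<in> sets \<mu>"
proof -
  have "(\<lambda>x. g \<otimes> x) ` K = carrier G \<inter> (\<lambda>x. g \<otimes> x) ` K" using coset_subset[OF assms] by blast
  moreover have "(\<lambda>x. g \<otimes> x) ` K \<in> sets borel" using open_coset[OF assms] by simp
  ultimately have "(\<lambda>x. g \<otimes> x) ` K \<in> sets (restrict_space borel (carrier G))"
    unfolding sets_restrict_space by (metis imageI)
  then show ?thesis using haar by (simp add: haar_measure_def)
qed

lemma emeasure_coset: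
  assumes "g \<in> carrier G" shows "emeasure \<mu> ((\<lambda>x. g \<otimes> x) ` K) = 1"
proof -
  have "(\<lambda>x. \<one> \<otimes> x) ` K = K" using K_carrier by (force simp: image_iff)
  then have "K \<in> sets \<mu>" using coset_sets[of \<one>] by simp
  then show ?thesis using haar measure_K assms by (simp add: haar_measure_def)
qed

text \<open>A right invariant function with finitely many nonzero values on representatives is a
  finite combination of indicators of cosets, and invariance gives each coset the volume of
  \<open>K\<close>.\<close>

lemma integral_eq_csum:
  assumes F: "rinv F" and fin: "finite {r \<in> R. F r \<noteq> 0}"
  shows "(\<integral>g. F g \<partial>\<mu>) = csum R F"
proof -
  define S where "S = {r \<in> R. F r \<noteq> 0}"
  define C where "C r = (\<lambda>x. r \<otimes> x) ` K" for r
  have "F g = (\<Sum>r\<in>S. indicator (C r) g *\<^sub>R F r)" if g: "g \<in> space \<mu>" for g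
  proof -
    obtain r k where r: "r \<in> R" "k \<in> K" "g = r \<otimes> k" using g space_mu R_exists by blast
    have Fg: "F g = F r" using F r R_carrier by (simp add: rinv_def)
    have C: "g \<in> C s \<longleftrightarrow> s = r" if "s \<in> R" for s
      using r R_unique[OF that r(1) _ r(2)] that by (auto simp: C_def)
    have "(\<Sum>s\<in>S. indicator (C s) g *\<^sub>R F s) = (\<Sum>s\<in>S. if s = r then F s else 0)"
      using C by (intro sum.cong) (auto simp: S_def)
    also have "\<dots> = F g" using fin r Fg by (simp add: S_def)
    finally show ?thesis by simp
  qed
  then have "(\<integral>g. F g \<partial>\<mu>) = (\<integral>g. (\<Sum>r\<in>S. indicator (C r) g *\<^sub>R F r) \<partial>\<mu>)"
    by (intro Bochner_Integration.integral_cong) auto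
  also have "\<dots> = (\<Sum>r\<in>S. F r)"
  proof (rule has_bochner_integral_integral_eq, rule has_bochner_integral_sum)
    fix r assume "r \<in> S"
    then have r: "r \<in> carrier G" using R_carrier by (simp add: S_def)
    have "has_bochner_integral \<mu> (indicator (C r) :: 'a \<Rightarrow> real) (measure \<mu> (C r))"
      using coset_sets[OF r] emeasure_coset[OF r] unfolding C_def
      by (intro has_bochner_integral_real_indicator) auto
    then have "has_bochner_integral \<mu> (\<lambda>g. indicator (C r) g *\<^sub>R F r) (measure \<mu> (C r) *\<^sub>R F r)"
      by (intro has_bochner_integral_scaleR_left) auto
    moreover have "measure \<mu> (C r) = 1" using emeasure_coset[OF r] by (simp add: C_def measure_def)
    ultimately show "has_bochner_integral \<mu> (\<lambda>g. indicator (C r) g *\<^sub>R F r) (F r)" by simp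
  qed
  finally show ?thesis by (simp add: csum_def S_def)
qed

text \<open>The open cosets cover the compact set, and since they are disjoint a finite subcover has
  to contain every representative in the support.\<close>

lemma compactly_supported_imp_finite:
  assumes "compactly_supported G F" shows "finite {r \<in> R. F r \<noteq> 0}"
proof -
  obtain C where C: "compact C" "C \<subseteq> carrier G" "\<And>x. F x \<noteq> 0 \<Longrightarrow> x \<in> C"
    using assms by (auto simp: compactly_supported_def)
  have "C \<subseteq> (\<Union>r\<in>R. (\<lambda>x. r \<otimes> x) ` K)"
  proof
    fix x assume "x \<in> C"
    then obtain r k where "r \<in> R" "k \<in> K" "x = r \<otimes> k" using C(2) R_exists by blast
    then show "x \<in> (\<Union>r\<in>R. (\<lambda>x. r \<otimes> x) ` K)" by blast
  qed
  then obtain D where D: "D \<subseteq> R" "finite D" "C \<subseteq> (\<Union>r\<in>D. (\<lambda>x. r \<otimes> x) ` K)"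
    by (rule compactE_image[OF C(1), rotated]) (auto intro: open_coset R_carrier)
  have "{r \<in> R. F r \<noteq> 0} \<subseteq> D"
  proof safe
    fix r assume r: "r \<in> R" "F r \<noteq> 0"
    then obtain s k where s: "s \<in> D" "k \<in> K" "r = s \<otimes> k" using C(3) D(3) by blast
    then have "r \<otimes> \<one> = s \<otimes> k" using r R_carrier by simp
    then have "r = s" using R_unique r s D(1) K_one by blast
    then show "r \<in> D" using s by simp
  qed
  then show ?thesis using D(2) finite_subset by blast
qed

lemma finite_imp_compactly_supported:
  assumes F: "rinv F" and fin: "finite {r \<in> R. F r \<noteq> 0}" and supp: "\<And>x. F x \<noteq> 0 \<Longrightarrow> x \<in> carrier G"
  shows "compactly_supported G F"
  unfolding compactly_supported_def
proof (intro exI[of _ "\<Union>r\<in>{r \<in> R. F r \<noteq> 0}. (\<lambda>x. r \<otimes> x) ` K"] conjI allI impI)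
  show "compact (\<Union>r\<in>{r \<in> R. F r \<noteq> 0}. (\<lambda>x. r \<otimes> x) ` K)"
    using fin by (intro compact_UN compact_coset) (auto intro: R_carrier)
  show "(\<Union>r\<in>{r \<in> R. F r \<noteq> 0}. (\<lambda>x. r \<otimes> x) ` K) \<subseteq> carrier G"
    using coset_subset R_carrier by blast
  fix x assume x: "F x \<noteq> 0"
  then obtain r k where r: "r \<in> R" "k \<in> K" "x = r \<otimes> k" using supp R_exists by blast
  then have "F r \<noteq> 0" using x F R_carrier by (simp add: rinv_def)
  then show "x \<in> (\<Union>r\<in>{r \<in> R. F r \<noteq> 0}. (\<lambda>x. r \<otimes> x) ` K)" using r by blast
qed

lemma hecke_algebra_carrier: "carrier (hecke_algebra G K \<mu>) = hfun"
proof -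
  have "compactly_supported G \<theta> \<and> (\<forall>k\<in>K. \<forall>x\<in>carrier G. \<theta> (k \<otimes> x) = \<theta> x \<and> \<theta> (x \<otimes> k) = \<theta> x) \<longleftrightarrow> \<theta> \<in> hfun" for \<theta>
  proof
    assume *: "compactly_supported G \<theta> \<and> (\<forall>k\<in>K. \<forall>x\<in>carrier G. \<theta> (k \<otimes> x) = \<theta> x \<and> \<theta> (x \<otimes> k) = \<theta> x)"
    moreover from * have "\<forall>x. \<theta> x \<noteq> 0 \<longrightarrow> x \<in> carrier G" by (auto simp: compactly_supported_def)
    ultimately show "\<theta> \<in> hfun"
      using compactly_supported_imp_finite[of \<theta>] by (simp add: hecke_functions_def)
  next
    assume *: "\<theta> \<in> hfun"
    then have "compactly_supported G \<theta>"
      using hfun_rinv hfun_finite hfun_carrier by (intro finite_imp_compactly_supported) blast+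
    then show "compactly_supported G \<theta> \<and> (\<forall>k\<in>K. \<forall>x\<in>carrier G. \<theta> (k \<otimes> x) = \<theta> x \<and> \<theta> (x \<otimes> k) = \<theta> x)"
      using * by (simp add: hfun_left hfun_right)
  qed
  then show ?thesis by (auto simp: hecke_algebra_def)
qed

end

section \<open>The tensor product as the Hecke algebra of the product group\<close>

locale haar_pair_product = A: haar_pair G K R \<mu> + B: haar_pair H L S \<nu>
  for G :: "('a::topological_space, 'c) monoid_scheme" and K R \<mu>
    and H :: "('b::topological_space, 'd) monoid_scheme" and L S \<nu>
begin

sublocale P: coset_group "G \<times>\<times> H" "K \<times> L" "R \<times> S"
  by (intro coset_group.intro coset_group_axioms.intro DirProd_group DirProd_subgroups transversal_DirProd
      A.group_axioms B.group_axioms A.subgroup_K B.subgroup_K A.transversal_R B.transversal_R)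

lemma P_inv: "g \<in> carrier G \<Longrightarrow> h \<in> carrier H \<Longrightarrow> inv\<^bsub>G \<times>\<times> H\<^esub> (g, h) = (inv\<^bsub>G\<^esub> g, inv\<^bsub>H\<^esub> h)"
  by (rule inv_DirProd[OF A.group_axioms B.group_axioms])

text \<open>Each of the two integrations is a finite sum, so the iterated integral is compared with
  a sum over pairs instead of an integral for a product measure.\<close>

lemma double_integral_eq_csum:
  assumes F: "P.rinv F" and fin: "finite {r \<in> R \<times> S. F r \<noteq> 0}"
  shows "(\<integral>g. (\<integral>h. F (g, h) \<partial>\<nu>) \<partial>\<mu>) = csum (R \<times> S) F"
proof -
  let ?T = "{r \<in> R \<times> S. F r \<noteq> 0}"
  have F1: "F (g \<otimes>\<^bsub>G\<^esub> k, h) = F (g, h)" if "g \<in> carrier G" "h \<in> carrier H" "k \<in> K" for g h k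
    using F that B.K_one by (fastforce simp: P.rinv_def dest: bspec[of _ _ "(g, h)"] bspec[of _ _ "(k, \<one>\<^bsub>H\<^esub>)"])
  have F2: "F (g, h \<otimes>\<^bsub>H\<^esub> l) = F (g, h)" if "g \<in> carrier G" "h \<in> carrier H" "l \<in> L" for g h l
    using F that A.K_one by (fastforce simp: P.rinv_def dest: bspec[of _ _ "(g, h)"] bspec[of _ _ "(\<one>\<^bsub>G\<^esub>, l)"])
  have inner: "(\<integral>h. F (g, h) \<partial>\<nu>) = csum S (\<lambda>h. F (g, h))" if g: "g \<in> carrier G" for g
  proof (rule B.integral_eq_csum)
    show "B.rinv (\<lambda>h. F (g, h))" using F2 g by (simp add: B.rinv_def)
    obtain r k where r: "r \<in> R" "k \<in> K" "g = r \<otimes>\<^bsub>G\<^esub> k" using A.R_exists g by blast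
    have "{s \<in> S. F (g, s) \<noteq> 0} \<subseteq> snd ` ?T"
      using r F1 A.R_carrier B.R_carrier by (force simp: image_iff)
    then show "finite {s \<in> S. F (g, s) \<noteq> 0}" using fin finite_subset by blast
  qed
  define I where "I g = csum S (\<lambda>h. F (g, h))" for g
  have I0: "r \<in> fst ` ?T" if "r \<in> R" "I r \<noteq> 0" for r
  proof -
    have "\<exists>s\<in>S. F (r, s) \<noteq> 0"
      using that unfolding I_def csum_def by (auto elim: sum.not_neutral_contains_not_neutral)
    then show ?thesis using that by (force simp: image_iff)
  qed
  have "(\<integral>g. (\<integral>h. F (g, h) \<partial>\<nu>) \<partial>\<mu>) = (\<integral>g. I g \<partial>\<mu>)"
    by (intro Bochner_Integration.integral_cong) (auto simp: inner I_def A.space_mu)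
  also have "\<dots> = csum R I"
  proof (rule A.integral_eq_csum)
    show "A.rinv I" unfolding A.rinv_def I_def using F1 B.R_carrier by (auto intro!: csum_cong)
    have "{r \<in> R. I r \<noteq> 0} \<subseteq> fst ` ?T" using I0 by blast
    then show "finite {r \<in> R. I r \<noteq> 0}" using fin finite_subset by blast
  qed
  \<comment> \<open>Both sums are extended to the projections of the support, so that they run over
    a finite rectangle on which they combine.\<close>
  also have "\<dots> = sum I (fst ` ?T)" using I0 fin by (intro csum_eq_sum) auto
  also have "\<dots> = (\<Sum>g\<in>fst ` ?T. \<Sum>h\<in>snd ` ?T. F (g, h))"
  proof (rule sum.cong)
    fix g assume g: "g \<in> fst ` ?T"
    show "I g = (\<Sum>h\<in>snd ` ?T. F (g, h))"
      unfolding I_def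
    proof (rule csum_eq_sum)
      show "h \<in> snd ` ?T" if "h \<in> S" "F (g, h) \<noteq> 0" for h
        by (rule image_eqI[of _ _ "(g, h)"]) (use that g in auto)
    qed (use fin in auto)
  qed simp
  also have "\<dots> = sum F (fst ` ?T \<times> snd ` ?T)" by (simp add: sum.cartesian_product)
  also have "\<dots> = csum (R \<times> S) F"
  proof (rule csum_eq_sum[symmetric])
    show "q \<in> fst ` ?T \<times> snd ` ?T" if "q \<in> R \<times> S" "F q \<noteq> 0" for q
      using that imageI[of q ?T fst] imageI[of q ?T snd] by (cases q) auto
  qed (use fin in auto)
  finally show ?thesis .
qed

lemma pure_tensor_hfun:
  assumes "\<theta> \<in> A.hfun" "\<psi> \<in> B.hfun" shows "pure_tensor \<theta> \<psi> \<in> P.hfun"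
proof -
  have "finite ({r \<in> R. \<theta> r \<noteq> 0} \<times> {s \<in> S. \<psi> s \<noteq> 0})"
    using A.hfun_finite B.hfun_finite assms by blast
  moreover have "{z \<in> R \<times> S. pure_tensor \<theta> \<psi> z \<noteq> 0} \<subseteq> {r \<in> R. \<theta> r \<noteq> 0} \<times> {s \<in> S. \<psi> s \<noteq> 0}"
    by (auto simp: pure_tensor_def)
  ultimately have "finite {z \<in> R \<times> S. pure_tensor \<theta> \<psi> z \<noteq> 0}" by (rule rev_finite_subset)
  then show ?thesis
    using A.hfun_left[OF assms(1)] A.hfun_right[OF assms(1)] B.hfun_left[OF assms(2)]
      B.hfun_right[OF assms(2)] A.hfun_carrier[OF assms(1)] B.hfun_carrier[OF assms(2)]
    by (auto simp: hecke_functions_def pure_tensor_def)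
qed

lemma sum_pure_tensor_hfun:
  fixes n :: nat
  assumes "\<forall>i<n. \<theta> i \<in> A.hfun \<and> \<psi> i \<in> B.hfun"
  shows "(\<lambda>z. \<Sum>i<n. pure_tensor (\<theta> i) (\<psi> i) z) \<in> P.hfun"
  using assms
proof (induction n)
  case (Suc n)
  then have "(\<lambda>z. (\<Sum>i<n. pure_tensor (\<theta> i) (\<psi> i) z) + pure_tensor (\<theta> n) (\<psi> n) z) \<in> P.hfun"
    by (intro P.hfun_add pure_tensor_hfun) auto
  then show ?case by simp
qed (simp add: P.hfun_zero)

text \<open>A function of two variables that takes finitely many values as a function of the first one
  is a sum of pure tensors indexed by these values.\<close>

lemma hfun_sum_pure_tensor:
  assumes \<Phi>: "\<Phi> \<in> P.hfun"
  obtains n :: nat and \<theta> \<psi> where "\<forall>i<n. \<theta> i \<in> A.hfun \<and> \<psi> i \<in> B.hfun"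
    "\<Phi> = (\<lambda>z. \<Sum>i<n. pure_tensor (\<theta> i) (\<psi> i) z)"
proof -
  let ?T = "{r \<in> R \<times> S. \<Phi> r \<noteq> 0}"
  have fin: "finite ?T" by (rule P.hfun_finite[OF \<Phi>])
  define fib where "fib g = (\<lambda>h. \<Phi> (g, h))" for g
  have supp: "g \<in> carrier G \<and> h \<in> carrier H" if "\<Phi> (g, h) \<noteq> 0" for g h
    using P.hfun_carrier[OF \<Phi> that] by simp
  have \<Phi>1: "\<Phi> (k \<otimes>\<^bsub>G\<^esub> g, h) = \<Phi> (g, h)" "\<Phi> (g \<otimes>\<^bsub>G\<^esub> k, h) = \<Phi> (g, h)"
    if "g \<in> carrier G" "h \<in> carrier H" "k \<in> K" for g h k
    using P.hfun_left[OF \<Phi>, of "(k, \<one>\<^bsub>H\<^esub>)" "(g, h)"] P.hfun_right[OF \<Phi>, of "(k, \<one>\<^bsub>H\<^esub>)" "(g, h)"] that B.K_one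
    by simp_all
  have \<Phi>2: "\<Phi> (g, l \<otimes>\<^bsub>H\<^esub> h) = \<Phi> (g, h)" "\<Phi> (g, h \<otimes>\<^bsub>H\<^esub> l) = \<Phi> (g, h)"
    if "g \<in> carrier G" "h \<in> carrier H" "l \<in> L" for g h l
    using P.hfun_left[OF \<Phi>, of "(\<one>\<^bsub>G\<^esub>, l)" "(g, h)"] P.hfun_right[OF \<Phi>, of "(\<one>\<^bsub>G\<^esub>, l)" "(g, h)"] that A.K_one
    by simp_all
  have fib_inv: "fib (k \<otimes>\<^bsub>G\<^esub> g) = fib g" "fib (g \<otimes>\<^bsub>G\<^esub> k) = fib g" if "g \<in> carrier G" "k \<in> K" for g k
    unfolding fib_def using \<Phi>1[OF that(1) _ that(2)] supp by (metis (no_types))+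
  have fib_nz: "r \<in> fst ` ?T" if r: "r \<in> R" and nz: "fib r \<noteq> (\<lambda>_. 0)" for r
  proof -
    obtain h where h: "\<Phi> (r, h) \<noteq> 0" using nz by (auto simp: fib_def)
    then obtain s l where s: "s \<in> S" "l \<in> L" "h = s \<otimes>\<^bsub>H\<^esub> l" using supp B.R_exists by blast
    then have "\<Phi> (r, s) \<noteq> 0" using h \<Phi>2(2)[of r s l] r A.R_carrier B.R_carrier by simp
    then show ?thesis using r s by (force simp: image_iff)
  qed
  \<comment> \<open>Without the zero fibre every level set meets \<open>R\<close> in a finite set,
    so its indicator is a Hecke function.\<close>
  define V where "V = fib ` R - {\<lambda>_. 0}"
  have "V \<subseteq> fib ` (fst ` ?T)" using fib_nz by (auto simp: V_def)
  then have "finite V" using fin by (meson finite_imageI finite_subset)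
  then obtain e where "bij_betw e {0..<card V} V" using ex_bij_betw_nat_finite by blast
  then have e: "bij_betw e {..<card V} V" by (simp add: atLeast0LessThan)
  define \<theta> where "\<theta> \<psi> = (\<lambda>g. if g \<in> carrier G \<and> fib g = \<psi> then 1 else (0::complex))" for \<psi>
  have \<theta>: "\<theta> \<psi> \<in> A.hfun" if "\<psi> \<in> V" for \<psi>
  proof -
    have "{r \<in> R. \<theta> \<psi> r \<noteq> 0} \<subseteq> fst ` ?T" using fib_nz that by (auto simp: \<theta>_def V_def)
    then have "finite {r \<in> R. \<theta> \<psi> r \<noteq> 0}" using fin finite_subset by blast
    then show ?thesis by (auto simp: hecke_functions_def \<theta>_def fib_inv A.K_carrier)
  qed
  have \<psi>: "\<psi> \<in> B.hfun" if V: "\<psi> \<in> V" for \<psi>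
  proof -
    obtain r where r: "r \<in> R" "\<psi> = fib r" using V by (auto simp: V_def)
    have "{s \<in> S. \<psi> s \<noteq> 0} \<subseteq> snd ` ?T" using r by (force simp: fib_def image_iff)
    then have "finite {s \<in> S. \<psi> s \<noteq> 0}" using fin finite_subset by blast
    then show ?thesis using \<Phi>2 supp r A.R_carrier by (auto simp: hecke_functions_def fib_def)
  qed
  have "\<Phi> (g, h) = (\<Sum>i<card V. \<theta> (e i) g * e i h)" for g h
  proof -
    have "(\<Sum>i<card V. \<theta> (e i) g * e i h) = (\<Sum>\<psi>\<in>V. \<theta> \<psi> g * \<psi> h)"
      by (rule sum.reindex_bij_betw[OF e])
    also have "\<dots> = \<Phi> (g, h)"
    proof (cases "g \<in> carrier G \<and> fib g \<noteq> (\<lambda>_. 0)")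
      case True
      then obtain r k where "r \<in> R" "k \<in> K" "g = r \<otimes>\<^bsub>G\<^esub> k" using A.R_exists by blast
      then have "fib g \<in> V" using True fib_inv(2)[of r k] A.R_carrier by (auto simp: V_def)
      have "(\<Sum>\<psi>\<in>V. \<theta> \<psi> g * \<psi> h) = (\<Sum>\<psi>\<in>V. if \<psi> = fib g then fib g h else 0)"
        using True by (intro sum.cong) (auto simp: \<theta>_def)
      also have "\<dots> = fib g h" using \<open>finite V\<close> \<open>fib g \<in> V\<close> by simp
      finally show ?thesis by (simp add: fib_def)
    next
      case False
      then have "\<Phi> (g, h) = 0" using supp by (auto simp: fib_def fun_eq_iff)
      moreover have "\<theta> \<psi> g = 0" if "\<psi> \<in> V" for \<psi> using that False by (auto simp: \<theta>_def V_def)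
      ultimately show ?thesis by simp
    qed
    finally show ?thesis by simp
  qed
  then have "\<Phi> = (\<lambda>z. \<Sum>i<card V. pure_tensor (\<theta> (e i)) (e i) z)"
    by (auto simp: fun_eq_iff pure_tensor_def)
  moreover have "\<forall>i<card V. \<theta> (e i) \<in> A.hfun \<and> e i \<in> B.hfun"
    using \<theta> \<psi> bij_betwE[OF e] by auto
  ultimately show thesis by (intro that[of "card V" "\<lambda>i. \<theta> (e i)" e])
qed

abbreviation tensor where "tensor \<equiv> hecke_tensor G K \<mu> H L \<nu>"

text \<open>Sums of pure tensors exhaust the Hecke functions of the product group. The ring axioms
  and the module law then follow from convolution on that one group.\<close>

lemma tensor_carrier: "carrier tensor = P.hfun"
proof
  show "carrier tensor \<subseteq> P.hfun"
    by (auto simp: hecke_tensor_def A.hecke_algebra_carrier B.hecke_algebra_carrier intro!: sum_pure_tensor_hfun)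
  show "P.hfun \<subseteq> carrier tensor"
  proof
    fix \<Phi> assume "\<Phi> \<in> P.hfun"
    from hfun_sum_pure_tensor[OF this] show "\<Phi> \<in> carrier tensor"
      unfolding hecke_tensor_def A.hecke_algebra_carrier B.hecke_algebra_carrier by simp blast
  qed
qed

lemma tensor_mult:
  assumes \<Phi>: "\<Phi> \<in> P.hfun" and \<Psi>: "\<Psi> \<in> P.hfun"
  shows "\<Phi> \<otimes>\<^bsub>tensor\<^esub> \<Psi> = P.conv \<Phi> \<Psi>"
proof
  fix z :: "'a \<times> 'b"
  obtain x y where z: "z = (x, y)" by force
  show "(\<Phi> \<otimes>\<^bsub>tensor\<^esub> \<Psi>) z = P.conv \<Phi> \<Psi> z"
  proof (cases "x \<in> carrier G \<and> y \<in> carrier H")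
    case True
    let ?F = "\<lambda>q. \<Phi> q * \<Psi> (inv\<^bsub>G \<times>\<times> H\<^esub> q \<otimes>\<^bsub>G \<times>\<times> H\<^esub> z)"
    have "(\<Phi> \<otimes>\<^bsub>tensor\<^esub> \<Psi>) z =
        (\<integral>g. (\<integral>h. \<Phi> (g, h) * \<Psi> (inv\<^bsub>G\<^esub> g \<otimes>\<^bsub>G\<^esub> x, inv\<^bsub>H\<^esub> h \<otimes>\<^bsub>H\<^esub> y) \<partial>\<nu>) \<partial>\<mu>)"
      using True by (simp add: hecke_tensor_def z)
    also have "\<dots> = (\<integral>g. (\<integral>h. ?F (g, h) \<partial>\<nu>) \<partial>\<mu>)"
      by (intro Bochner_Integration.integral_cong refl) (simp add: A.space_mu B.space_mu P_inv z)
    also have "\<dots> = csum (R \<times> S) ?F"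
    proof (rule double_integral_eq_csum)
      show "P.rinv ?F"
        using True z by (intro P.self.rinv_hact \<Phi> P.hfun_act_inv \<Psi>) auto
      show "finite {r \<in> R \<times> S. ?F r \<noteq> 0}" by (rule P.self.finite_hact[OF \<Phi>])
    qed
    finally show ?thesis using True by (simp add: P.conv_def z)
  next
    case False
    then show ?thesis by (auto simp: hecke_tensor_def P.conv_def z)
  qed
qed

lemma tensor_one: "\<one>\<^bsub>tensor\<^esub> = indicator (K \<times> L)"
  by (auto simp: hecke_tensor_def hecke_algebra_def pure_tensor_def fun_eq_iff indicator_def)

lemma tensor_zero: "\<zero>\<^bsub>tensor\<^esub> = (\<lambda>_. 0)"
  by (simp add: hecke_tensor_def)

lemma tensor_add: "\<Phi> \<oplus>\<^bsub>tensor\<^esub> \<Psi> = (\<lambda>z. \<Phi> z + \<Psi> z)"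
  by (simp add: hecke_tensor_def)

lemma ring_tensor: "ring tensor"
proof (rule ringI)
  show "abelian_group tensor"
  proof (rule abelian_groupI)
    fix \<Phi> assume "\<Phi> \<in> carrier tensor"
    then have "(\<lambda>z. (- 1) * \<Phi> z) \<in> carrier tensor" unfolding tensor_carrier by (rule P.hfun_scale)
    then show "\<exists>\<Psi>\<in>carrier tensor. \<Psi> \<oplus>\<^bsub>tensor\<^esub> \<Phi> = \<zero>\<^bsub>tensor\<^esub>"
      by (rule bexI[rotated]) (simp add: tensor_add tensor_zero)
  qed (auto simp: tensor_carrier tensor_add tensor_zero P.hfun_zero P.hfun_add add_ac)
  show "Group.monoid tensor"
    by (rule monoidI)
      (auto simp: tensor_carrier tensor_mult tensor_one P.conv_closed P.conv_assoc P.hfun_indicator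
        P.conv_one_left P.conv_one_right)
qed (auto simp: tensor_carrier tensor_mult tensor_add P.hfun_add P.conv_add_left P.conv_add_right)

end


section \<open>The module\<close>

lemma continuous_on_entry [continuous_intros]:
  "continuous_on S f \<Longrightarrow> continuous_on S (\<lambda>x. f x $ i $ j)"
  by (intro continuous_on_component)

lemma continuous_on_mat2:
  assumes "continuous_on S a" "continuous_on S b" "continuous_on S c" "continuous_on S d"
  shows "continuous_on S (\<lambda>x. mat2 (a x) (b x) (c x) (d x))"
  unfolding mat2_def
proof (intro continuous_on_vec_lambda)
  show "continuous_on S (\<lambda>x. if i = 1 then if j = 1 then a x else b x else if j = 1 then c x else d x)" for i j :: 2
    using assms by (cases "i = 1"; cases "j = 1") simp_all
qed

lemma continuous_on_det2 [continuous_intros]: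
  fixes f :: "'a::topological_space \<Rightarrow> 'p::prime_card padic_mat"
  assumes "continuous_on S f" shows "continuous_on S (\<lambda>x. det (f x))"
  unfolding det_2 diff_conv_add_uminus using assms by (intro continuous_intros)

lemma continuous_on_matrix_mult [continuous_intros]:
  fixes f g :: "'a::topological_space \<Rightarrow> 'p::prime_card padic_mat"
  assumes "continuous_on S f" "continuous_on S g" shows "continuous_on S (\<lambda>x. f x ** g x)"
  unfolding matrix_matrix_mult_def sum_2
  using assms by (intro continuous_on_vec_lambda continuous_intros)

lemma continuous_on_mnorm [continuous_intros]:
  "continuous_on S f \<Longrightarrow> continuous_on S (\<lambda>x. mnorm (f x))"
  unfolding mnorm_def by (intro continuous_intros)

lemma open_padic_near:
  fixes U :: "'p::prime_card padic set"
  assumes "\<And>x y. x \<in> U \<Longrightarrow> padic_norm (y - x) < 1 \<Longrightarrow> y \<in> U"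
  shows "open U"
  unfolding open_dist dist_padic_def using assms by (metis zero_less_one)

lemma open_padic_integers: "open {x::'p::prime_card padic. padic_norm x \<le> 1}"
proof (rule open_padic_near, simp)
  fix x y :: "'p padic" assume "padic_norm x \<le> 1" "padic_norm (y - x) < 1"
  then show "padic_norm y \<le> 1" using padic_norm_add_le[of x 1 "y - x"] by simp
qed

lemma open_padic_units: "open {x::'p::prime_card padic. padic_norm x = 1}"
proof (rule open_padic_near, simp)
  fix x y :: "'p padic" assume *: "padic_norm x = 1" "padic_norm (y - x) < 1"
  then have "padic_norm (x - y) < padic_norm x" using padic_norm_minus[of "y - x"] by simp
  then show "padic_norm y = 1" using padic_norm_diff_eq[of x y] *(1) by simp
qed

lemma open_GL2_Zp: "open (GL2_Zp :: 'p::prime_card padic_mat set)"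
proof -
  have "(GL2_Zp :: 'p padic_mat set) =
      (\<Inter>i. \<Inter>j. (\<lambda>A. A $ i $ j) -` {x. padic_norm x \<le> 1}) \<inter> det -` {x. padic_norm x = 1}"
    by (simp add: set_eq_iff GL2_Zp_iff mnorm_le_iff)
  moreover have "open \<dots>"
    by (intro open_Int open_INT open_vimage open_padic_integers open_padic_units ballI
        continuous_on_entry continuous_on_det2 continuous_on_id finite) 
  ultimately show ?thesis by simp
qed

text \<open>Matrices with bounded entries are the image of a product of compact balls, and the
  determinant condition is closed. General \<open>c\<close> and \<open>d\<close> serve both
  \<open>GL2_Zp\<close> and the shells below.\<close>

lemma compact_norm_det: "compact {A :: 'p::prime_card padic_mat. mnorm A \<le> c \<and> padic_norm (det A) = d}"
proof -
  let ?B = "{x::'p padic. padic_norm x \<le> c}"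
  have "compact ((\<lambda>((x, y), z, w). mat2 x y z w) ` ((?B \<times> ?B) \<times> ?B \<times> ?B))"
    unfolding split_def
    by (intro compact_continuous_image compact_Times compact_padic_ball continuous_on_mat2 continuous_intros)
  also have "(\<lambda>((x, y), z, w). mat2 x y z w) ` ((?B \<times> ?B) \<times> ?B \<times> ?B) = {A. mnorm A \<le> c}"
  proof (intro equalityI subsetI)
    fix A :: "'p padic_mat" assume "A \<in> {A. mnorm A \<le> c}"
    then show "A \<in> (\<lambda>((x, y), z, w). mat2 x y z w) ` ((?B \<times> ?B) \<times> ?B \<times> ?B)"
      by (intro image_eqI[of _ _ "((A $ 1 $ 1, A $ 1 $ 2), A $ 2 $ 1, A $ 2 $ 2)"])
        (auto simp: mat2_eta mnorm_le_iff)
  qed (auto simp: mnorm_mat2)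
  finally have "compact {A :: 'p padic_mat. mnorm A \<le> c}" .
  moreover have "closed {A :: 'p padic_mat. padic_norm (det A) = d}"
    by (intro closed_Collect_eq continuous_intros)
  ultimately have "compact ({A :: 'p padic_mat. mnorm A \<le> c} \<inter> {A. padic_norm (det A) = d})"
    by (rule compact_Int_closed)
  then show ?thesis by (simp add: Collect_conj_eq)
qed

lemma compact_GL2_Zp: "compact (GL2_Zp :: 'p::prime_card padic_mat set)"
proof -
  have *: "(GL2_Zp :: 'p padic_mat set) = {A. mnorm A \<le> 1 \<and> padic_norm (det A) = 1}"
    by (simp add: set_eq_iff GL2_Zp_iff)
  show ?thesis unfolding * by (rule compact_norm_det)
qed

lemma open_coset_GL2:
  fixes g :: "'p::prime_card padic_mat"
  assumes "det g \<noteq> 0" shows "open ((\<lambda>x. g ** x) ` GL2_Zp)"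
proof -
  have "(\<lambda>x. g ** x) ` GL2_Zp = (\<lambda>x. minv g ** x) -` GL2_Zp"
    using minv_left[OF assms] minv_right[OF assms]
    by (auto simp: matrix_mul_assoc intro!: image_eqI[of _ _ "minv g ** _"])
  moreover have "open \<dots>" by (intro open_vimage open_GL2_Zp continuous_intros)
  ultimately show ?thesis by simp
qed

lemma compact_coset_GL2:
  fixes g :: "'p::prime_card padic_mat"
  shows "compact ((\<lambda>x. g ** x) ` GL2_Zp)"
  by (intro compact_continuous_image compact_GL2_Zp continuous_intros)

lemma haar_pair_Hp:
  assumes "haar_measure Hp \<mu>" "emeasure \<mu> Hp0 = 1" "transversal Hp Hp0 R"
  shows "haar_pair Hp Hp0 R \<mu>"
  by (intro haar_pair.intro coset_group.intro coset_group_axioms.intro haar_pair_axioms.intro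
      group_GL2 subgroup_GL2_Zp assms)
    (auto simp: carrier_GL2 open_coset_GL2 compact_coset_GL2)

lemma haar_pair_Gp:
  fixes \<mu> :: "('p::prime_card padic_mat \<times> 'p padic_mat) measure"
  assumes "haar_measure Gp \<mu>" "emeasure \<mu> Gp0 = 1" "transversal Gp Gp0 R"
  shows "haar_pair Gp Gp0 R \<mu>"
proof -
  have *: "(\<lambda>x. (g, h) \<otimes>\<^bsub>Gp\<^esub> x) ` Gp0 = ((\<lambda>x. g ** x) ` GL2_Zp) \<times> ((\<lambda>x. h ** x) ` GL2_Zp)"
    for g h :: "'p padic_mat" by (auto simp: image_iff)
  show ?thesis
    by (intro haar_pair.intro coset_group.intro coset_group_axioms.intro haar_pair_axioms.intro
        DirProd_group DirProd_subgroups group_GL2 subgroup_GL2_Zp assms)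
      (auto simp: carrier_GL2 * open_coset_GL2 compact_coset_GL2 open_Times compact_Times simp del: mult_DirProd)
qed

section \<open>The module as functions on pairs of matrices\<close>

locale hecke_module_setup =
  H: haar_pair "Hp :: ('p::prime_card padic_mat) monoid" Hp0 R \<mu>H +
  G: haar_pair "Gp :: ('p::prime_card padic_mat \<times> 'p padic_mat) monoid" Gp0 Q \<mu>G
  for R Q and \<mu>H :: "('p::prime_card padic_mat) measure"
    and \<mu>G :: "('p::prime_card padic_mat \<times> 'p padic_mat) measure"
begin

sublocale T: haar_pair_product "Gp :: ('p padic_mat \<times> 'p padic_mat) monoid" Gp0 Q \<mu>G Hp Hp0 R \<mu>H ..

text \<open>The substitution in the integrand of the module action, which reverses products as
  \<open>coset_group_action\<close> expects.\<close>

definition act :: "('p padic_mat \<times> 'p padic_mat) \<times> 'p padic_mat \<Rightarrow>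
    'p padic_mat \<times> 'p padic_mat \<Rightarrow> 'p padic_mat \<times> 'p padic_mat" where
  "act = (\<lambda>((g1, g2), h) (A, B). (minv h ** A ** g1, minv h ** B ** g2))"

lemma act_apply [simp]: "act ((g1, g2), h) (A, B) = (minv h ** A ** g1, minv h ** B ** g2)"
  by (simp add: act_def)

lemma act_eq:
  assumes "h \<in> carrier Hp"
  shows "act (g, h) x = inv\<^bsub>Gp\<^esub> (h, h) \<otimes>\<^bsub>Gp\<^esub> x \<otimes>\<^bsub>Gp\<^esub> g"
  using assms by (cases g, cases x) (simp add: inv_DirProd group_GL2 inv_GL2 carrier_GL2)

sublocale M: coset_group_action "(Gp \<times>\<times> Hp :: (('p padic_mat \<times> 'p padic_mat) \<times> 'p padic_mat) monoid)"
  "Gp0 \<times> Hp0" "Q \<times> R" "{A. det A \<noteq> 0} \<times> {B. det B \<noteq> 0}" act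
proof unfold_locales
  fix \<gamma> \<delta> :: "('p padic_mat \<times> 'p padic_mat) \<times> 'p padic_mat" and x :: "'p padic_mat \<times> 'p padic_mat"
  let ?X = "{A. det A \<noteq> 0} \<times> {B. det B \<noteq> 0} :: ('p padic_mat \<times> 'p padic_mat) set"
  assume \<gamma>: "\<gamma> \<in> carrier (Gp \<times>\<times> Hp)" and x: "x \<in> ?X"
  obtain g1 g2 h where \<gamma>': "\<gamma> = ((g1, g2), h)" by (metis prod.collapse)
  obtain A B where x': "x = (A, B)" by force
  show "act \<gamma> x \<in> ?X" using \<gamma> x by (simp add: \<gamma>' x' carrier_GL2 det_mul det_minv)
  assume \<delta>: "\<delta> \<in> carrier (Gp \<times>\<times> Hp)"
  obtain g1' g2' h' where \<delta>': "\<delta> = ((g1', g2'), h')" by (metis prod.collapse)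
  show "act (\<gamma> \<otimes>\<^bsub>Gp \<times>\<times> Hp\<^esub> \<delta>) x = act \<delta> (act \<gamma> x)"
    using \<gamma> \<delta> by (simp add: \<gamma>' \<delta>' x' carrier_GL2 minv_mult matrix_mul_assoc)
qed

abbreviation cmod where "cmod \<equiv> coset_module \<mu>G \<mu>H"

abbreviation orbit_fun :: "('p padic_mat \<times> 'p padic_mat \<Rightarrow> complex) \<Rightarrow> bool" where
  "orbit_fun \<equiv> M.act_inv"

lemma orbit_fun_apply:
  assumes "orbit_fun f" "k \<in> GL2_Zp" "k1 \<in> GL2_Zp" "k2 \<in> GL2_Zp" "det A \<noteq> 0" "det B \<noteq> 0"
  shows "f (k ** A ** k1, k ** B ** k2) = f (A, B)"
proof -
  have "f (act ((k1, k2), minv k) (A, B)) = f (A, B)"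
    using assms unfolding M.act_inv_def by (auto simp: carrier_GL2 GL2_Zp_minv simp del: act_apply)
  then show ?thesis using assms by (simp add: minv_minv GL2_Zp_det)
qed

text \<open>Left invariance under the diagonal and right invariance under \<open>Gp0\<close> combine
  to invariance under the single subgroup \<open>Gp0 \<times> Hp0\<close>, which is what
  \<open>hact\<close> works with.\<close>

lemma cmod_carrier: "f \<in> carrier cmod \<longleftrightarrow> compactly_supported Gp f \<and> orbit_fun f"
proof -
  have "(\<forall>k\<in>Hp0. \<forall>x\<in>carrier Gp. f ((k, k) \<otimes>\<^bsub>Gp\<^esub> x) = f x) \<and>
      (\<forall>k\<in>Gp0. \<forall>x\<in>carrier Gp. f (x \<otimes>\<^bsub>Gp\<^esub> k) = f x) \<longleftrightarrow> orbit_fun f" (is "?L \<and> ?R \<longleftrightarrow> _")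
  proof
    assume *: "?L \<and> ?R"
    show "orbit_fun f"
      unfolding M.act_inv_def
    proof safe
      fix k1 k2 k A B :: "'p padic_mat"
      assume k: "k1 \<in> Hp0" "k2 \<in> Hp0" "k \<in> Hp0" and "det A \<noteq> 0" "det B \<noteq> 0"
      then have AB: "(A, B) \<in> carrier Gp" by (simp add: carrier_GL2)
      have AB': "(minv k ** A, minv k ** B) \<in> carrier Gp"
        using AB k by (simp add: carrier_GL2 det_mul det_minv GL2_Zp_det)
      have "f (act ((k1, k2), k) (A, B)) = f (minv k ** A, minv k ** B)"
        using bspec[OF bspec[OF conjunct2[OF *], of "(k1, k2)"] AB'] k by simp
      also have "\<dots> = f (A, B)"
        using bspec[OF bspec[OF conjunct1[OF *], of "minv k"] AB] k by (simp add: GL2_Zp_minv)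
      finally show "f (act ((k1, k2), k) (A, B)) = f (A, B)" .
    qed
  next
    assume f: "orbit_fun f"
    show "?L \<and> ?R"
    proof safe
      fix k A B :: "'p padic_mat" assume "k \<in> Hp0" "(A, B) \<in> carrier Gp"
      then show "f ((k, k) \<otimes>\<^bsub>Gp\<^esub> (A, B)) = f (A, B)"
        using orbit_fun_apply[OF f, of k "mat 1" "mat 1" A B] by (simp add: carrier_GL2)
    next
      fix k1 k2 A B :: "'p padic_mat" assume "k1 \<in> Hp0" "k2 \<in> Hp0" "(A, B) \<in> carrier Gp"
      then show "f ((A, B) \<otimes>\<^bsub>Gp\<^esub> (k1, k2)) = f (A, B)"
        using orbit_fun_apply[OF f, of "mat 1" k1 k2 A B] by (simp add: carrier_GL2)
    qed
  qed
  then show ?thesis by (simp add: coset_module_def)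
qed

lemma cmod_smult:
  assumes \<Phi>: "\<Phi> \<in> T.P.hfun" and f: "orbit_fun f"
  shows "\<Phi> \<odot>\<^bsub>cmod\<^esub> f = M.hact \<Phi> f"
proof
  fix x show "(\<Phi> \<odot>\<^bsub>cmod\<^esub> f) x = M.hact \<Phi> f x"
  proof (cases "x \<in> carrier Gp")
    case True
    then have x: "x \<in> {A. det A \<noteq> 0} \<times> {B. det B \<noteq> 0}" by (simp add: carrier_GL2)
    have "(\<Phi> \<odot>\<^bsub>cmod\<^esub> f) x =
      (\<integral>g. (\<integral>h. \<Phi> (g, h) * f (inv\<^bsub>Gp\<^esub> (h, h) \<otimes>\<^bsub>Gp\<^esub> x \<otimes>\<^bsub>Gp\<^esub> g) \<partial>\<mu>H) \<partial>\<mu>G)"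
      using True by (simp add: coset_module_def)
    also have "\<dots> = (\<integral>g. (\<integral>h. \<Phi> (g, h) * f (act (g, h) x) \<partial>\<mu>H) \<partial>\<mu>G)"
      by (intro Bochner_Integration.integral_cong refl) (simp add: H.space_mu act_eq)
    also have "\<dots> = csum (Q \<times> R) (\<lambda>\<gamma>. \<Phi> \<gamma> * f (act \<gamma> x))"
      by (rule T.double_integral_eq_csum[OF M.rinv_hact[OF \<Phi> f x] M.finite_hact[OF \<Phi>]])
    finally show ?thesis using x by (simp add: M.hact_def)
  qed (auto simp: coset_module_def M.hact_def carrier_GL2)
qed

text \<open>The support lies in finitely many images of the support of \<open>f\<close> under the
  inverse maps \<open>unact\<close>, each of which is continuous.\<close>

lemma hact_compactly_supported:
  assumes \<Phi>: "\<Phi> \<in> T.P.hfun" and f: "compactly_supported Gp f"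
  shows "compactly_supported Gp (M.hact \<Phi> f)"
proof -
  obtain C where C: "compact C" "C \<subseteq> carrier Gp" "\<And>x. f x \<noteq> 0 \<Longrightarrow> x \<in> C"
    using f by (auto simp: compactly_supported_def)
  let ?S = "{\<gamma> \<in> Q \<times> R. \<Phi> \<gamma> \<noteq> 0}"
  define unact :: "('p padic_mat \<times> 'p padic_mat) \<times> 'p padic_mat \<Rightarrow> 'p padic_mat \<times> 'p padic_mat \<Rightarrow> _"
    where "unact \<gamma> x = (snd \<gamma> ** fst x ** minv (fst (fst \<gamma>)), snd \<gamma> ** snd x ** minv (snd (fst \<gamma>)))" for \<gamma> x
  have S: "\<gamma> \<in> carrier (Gp \<times>\<times> Hp)" if "\<gamma> \<in> ?S" for \<gamma> using that T.P.R_carrier by blast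
  have "compact (\<Union>\<gamma>\<in>?S. unact \<gamma> ` C)"
    unfolding unact_def using T.P.hfun_finite[OF \<Phi>]
    by (intro compact_UN compact_continuous_image C ballI continuous_intros)
  moreover have "(\<Union>\<gamma>\<in>?S. unact \<gamma> ` C) \<subseteq> carrier Gp"
    using S C(2) by (fastforce simp: unact_def carrier_GL2 det_mul det_minv)
  moreover have "x \<in> (\<Union>\<gamma>\<in>?S. unact \<gamma> ` C)" if nz: "M.hact \<Phi> f x \<noteq> 0" for x
  proof -
    have x: "x \<in> {A. det A \<noteq> 0} \<times> {B. det B \<noteq> 0}" using nz by (auto simp: M.hact_def split: if_splits)
    obtain \<gamma> where \<gamma>: "\<gamma> \<in> ?S" "f (act \<gamma> x) \<noteq> 0"
      using nz unfolding M.hact_eq_sum[OF \<Phi> x] by (auto elim!: sum.not_neutral_contains_not_neutral)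
    obtain g1 g2 h where \<gamma>': "\<gamma> = ((g1, g2), h)" by (metis prod.collapse)
    have d: "det g1 \<noteq> 0" "det g2 \<noteq> 0" "det h \<noteq> 0" using S[OF \<gamma>(1)] by (auto simp: \<gamma>' carrier_GL2)
    have "h ** (minv h ** A ** g) ** minv g = A" if "det g \<noteq> 0" for A g
    proof -
      have "h ** (minv h ** A ** g) ** minv g = (h ** minv h) ** A ** (g ** minv g)"
        by (simp only: matrix_mul_assoc)
      then show ?thesis using d that by (simp add: minv_right)
    qed
    then have "x = unact \<gamma> (act \<gamma> x)" using d by (cases x) (simp add: unact_def \<gamma>')
    then show ?thesis using \<gamma> C(3) by blast
  qed
  ultimately show ?thesis unfolding compactly_supported_def by blast
qed

lemma hact_closed: "\<Phi> \<in> T.P.hfun \<Longrightarrow> f \<in> carrier cmod \<Longrightarrow> M.hact \<Phi> f \<in> carrier cmod"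
  unfolding cmod_carrier using hact_compactly_supported M.hact_inv by blast

lemma cmod_scale:
  assumes "f \<in> carrier cmod" shows "(\<lambda>x. c * f x) \<in> carrier cmod"
proof -
  have "compactly_supported Gp (\<lambda>x. c * f x)"
    using assms unfolding cmod_carrier compactly_supported_def by (metis mult_zero_right)
  then show ?thesis using assms by (auto simp: cmod_carrier M.act_inv_def)
qed

lemma cmod_add:
  assumes "f \<in> carrier cmod" "f' \<in> carrier cmod" shows "(\<lambda>x. f x + f' x) \<in> carrier cmod"
proof -
  obtain C where C: "compact C" "C \<subseteq> carrier Gp" "\<And>x. f x \<noteq> 0 \<Longrightarrow> x \<in> C"
    using assms(1) unfolding cmod_carrier compactly_supported_def by blast
  obtain C' where C': "compact C'" "C' \<subseteq> carrier Gp" "\<And>x. f' x \<noteq> 0 \<Longrightarrow> x \<in> C'"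
    using assms(2) unfolding cmod_carrier compactly_supported_def by blast
  have "x \<in> C \<union> C'" if "f x + f' x \<noteq> 0" for x
    using that C(3)[of x] C'(3)[of x] by (cases "f x = 0") auto
  then have "compactly_supported Gp (\<lambda>x. f x + f' x)"
    unfolding compactly_supported_def
    using C(1,2) C'(1,2) by (intro exI[of _ "C \<union> C'"]) (auto intro: compact_Un simp del: carrier_DirProd)
  then show ?thesis using assms by (auto simp: cmod_carrier M.act_inv_def)
qed

lemma cmod_zero: "(\<lambda>_. 0) \<in> carrier cmod"
  by (auto simp: cmod_carrier M.act_inv_def compactly_supported_def intro!: exI[of _ "{}"])

lemma left_module_cmod: "left_module (hecke_ring \<mu>G \<mu>H) cmod"
proof -
  have R: "hecke_ring \<mu>G \<mu>H = T.tensor" by (simp add: hecke_ring_def)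
  have add: "f \<oplus>\<^bsub>cmod\<^esub> f' = (\<lambda>x. f x + f' x)" for f f' by (simp add: coset_module_def)
  have zero: "\<zero>\<^bsub>cmod\<^esub> = (\<lambda>_. 0)" by (simp add: coset_module_def)
  have inv: "orbit_fun f" if "f \<in> carrier cmod" for f using that by (simp add: cmod_carrier)
  have grp: "abelian_group cmod"
  proof (rule abelian_groupI)
    fix f assume "f \<in> carrier cmod"
    then have "(\<lambda>z. (- 1) * f z) \<in> carrier cmod" by (rule cmod_scale)
    then show "\<exists>f'\<in>carrier cmod. f' \<oplus>\<^bsub>cmod\<^esub> f = \<zero>\<^bsub>cmod\<^esub>"
      by (rule bexI[rotated]) (simp add: add zero)
  qed (auto simp: add zero cmod_zero cmod_add add_ac)
  have one: "M.hact (indicator (Gp0 \<times> Hp0)) f = f" if f: "f \<in> carrier cmod" for f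
  proof
    fix x show "M.hact (indicator (Gp0 \<times> Hp0)) f x = f x"
    proof (cases "x \<in> carrier Gp")
      case True
      then have "x \<in> {A. det A \<noteq> 0} \<times> {B. det B \<noteq> 0}" by (simp add: carrier_GL2)
      moreover have "act \<one>\<^bsub>Gp \<times>\<times> Hp\<^esub> x = x"
        using minv_left[of "mat 1 :: 'p padic_mat"] by (cases x) simp
      ultimately show ?thesis using inv[OF f] by (intro M.hact_indicator)
    next
      case False
      then have "f x = 0" using f unfolding cmod_carrier compactly_supported_def by blast
      then show ?thesis using False by (auto simp: M.hact_def carrier_GL2)
    qed
  qed
  show ?thesis
    unfolding R
    by (intro left_module.intro left_module_axioms.intro T.ring_tensor grp)
      (simp_all add: T.tensor_carrier T.tensor_mult T.tensor_add T.tensor_one add inv cmod_smult hact_closed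
        T.P.hfun_add T.P.conv_closed T.P.hfun_indicator M.hact_add_left M.hact_add_right M.hact_conv one
        cmod_add[THEN inv] hact_closed[THEN inv])
qed

end


section \<open>Cyclicity\<close>

lemma haar_pair_hfun_of_compact:
  assumes "haar_pair G K R \<mu>" "compact C" "C \<subseteq> carrier G"
    and "\<And>k x. k \<in> K \<Longrightarrow> x \<in> carrier G \<Longrightarrow> (k \<otimes>\<^bsub>G\<^esub> x \<in> C \<longleftrightarrow> x \<in> C) \<and> (x \<otimes>\<^bsub>G\<^esub> k \<in> C \<longleftrightarrow> x \<in> C)"
  shows "indicator C \<in> hecke_functions G K R"
proof -
  interpret haar_pair G K R \<mu> by fact
  have "compactly_supported G (indicator C)"
    using assms(2,3) by (auto simp: compactly_supported_def indicator_def)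
  then have "finite {r \<in> R. indicator C r \<noteq> (0::complex)}" by (rule compactly_supported_imp_finite)
  then show ?thesis using assms(3,4) by (auto simp: hecke_functions_def indicator_def)
qed

text \<open>For invertible \<open>M\<close> this is the double coset of \<open>M\<close> under
  \<open>GL2_Zp\<close>, by elementary divisors. In terms of norms its compactness and its
  invariance on both sides are immediate.\<close>

definition shell :: "'p::prime_card padic_mat \<Rightarrow> 'p padic_mat set" where
  "shell M = {A. mnorm A = mnorm M \<and> padic_norm (det A) = padic_norm (det M)}"

lemma shell_self: "M \<in> shell M"
  by (simp add: shell_def)

lemma shell_disp: "A \<in> shell M \<Longrightarrow> disp A = disp M"
  by (simp add: shell_def disp_def)

lemma shell_det: "A \<in> shell M \<Longrightarrow> padic_norm (det A) = padic_norm (det M)"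
  by (simp add: shell_def)

lemma shell_carrier: "det M \<noteq> 0 \<Longrightarrow> shell M \<subseteq> {A. det A \<noteq> 0}"
  by (auto simp: shell_def)

lemma shell_left [simp]: "k \<in> GL2_Zp \<Longrightarrow> k ** A \<in> shell M \<longleftrightarrow> A \<in> shell M"
  by (simp add: shell_def)

lemma shell_right [simp]: "k \<in> GL2_Zp \<Longrightarrow> A ** k \<in> shell M \<longleftrightarrow> A \<in> shell M"
  by (simp add: shell_def)

lemma compact_shell: "compact (shell (M :: 'p::prime_card padic_mat))"
proof -
  have "closed {A :: 'p padic_mat. mnorm A = mnorm M}"
    by (intro closed_Collect_eq continuous_intros)
  then have "compact ({A :: 'p padic_mat. mnorm A \<le> mnorm M \<and> padic_norm (det A) = padic_norm (det M)} \<inter>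
      {A. mnorm A = mnorm M})"
    by (intro compact_Int_closed compact_norm_det)
  also have "\<dots> = shell M" by (auto simp: shell_def)
  finally show ?thesis .
qed

text \<open>This is \<open>p\<close> to the power of the perimeter of the geodesic triangle in the tree.\<close>

definition weight :: "'p::prime_card padic_mat \<times> 'p padic_mat \<Rightarrow> real" where
  "weight = (\<lambda>(A, B). disp A * disp B * disp (minv A ** B))"

lemma weight_power:
  fixes x :: "'p::prime_card padic_mat \<times> 'p padic_mat"
  assumes "x \<in> {A. det A \<noteq> 0} \<times> {B. det B \<noteq> 0}"
  obtains n where "weight x = real CARD('p) ^ n"
proof -
  obtain A B where x: "x = (A, B)" "det A \<noteq> 0" "det B \<noteq> 0" using assms by auto
  then have "det (minv A ** B) \<noteq> 0" by (simp add: det_mul det_minv)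
  then obtain i j k where "disp A = real CARD('p) ^ i" "disp B = real CARD('p) ^ j"
    "disp (minv A ** B) = real CARD('p) ^ k" using x disp_power by metis
  then show thesis using that[of "i + j + k"] by (simp add: weight_def x power_add)
qed

text \<open>The equality case of the perimeter bound: no factor can fall strictly below its bound if
  the products agree.\<close>

lemma mult_le_mult_eq:
  fixes a b c a' b' c' :: real
  assumes "0 < a" "0 < b" "0 < c" "a \<le> a'" "b \<le> b'" "c \<le> c'" "a * b * c = a' * b' * c'"
  shows "a = a' \<and> b = b' \<and> c = c'"
proof -
  have "a = a'"
  proof (rule ccontr)
    assume "a \<noteq> a'"
    then have "a * (b * c) < a' * (b * c)" using assms by simp
    also have "\<dots> \<le> a' * (b' * c')" using assms by (intro mult_left_mono mult_mono) auto
    finally show False using assms by (simp add: mult.assoc)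
  qed
  moreover have "b = b'"
  proof (rule ccontr)
    assume "b \<noteq> b'"
    then have "b * (a * c) < b' * (a * c)" using assms by simp
    also have "\<dots> \<le> b' * (a' * c')" using assms by (intro mult_left_mono mult_mono) auto
    finally show False using assms by (simp add: mult_ac)
  qed
  ultimately show ?thesis using assms by simp
qed

section \<open>Orbit functions and the induction on the perimeter\<close>

context hecke_module_setup
begin

abbreviation triples :: "('p padic_mat \<times> 'p padic_mat) set" where
  "triples \<equiv> {A. det A \<noteq> 0} \<times> {B. det B \<noteq> 0}"

lemma triples_eq: "carrier Gp = triples"
  by (simp add: carrier_GL2)

lemma orbit_fun_triple_invariant:
  assumes f: "orbit_fun f" and x: "x \<in> triples" "y \<in> triples" and eq: "triple_invariant x = triple_invariant y"
  shows "f x = f y"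
proof -
  obtain A B where A: "x = (A, B)" by force
  obtain A' B' where A': "y = (A', B')" by force
  have d: "det A \<noteq> 0" "det B \<noteq> 0" "det A' \<noteq> 0" "det B' \<noteq> 0" using x by (auto simp: A A')
  obtain k k1 k2 where "k \<in> GL2_Zp" "k1 \<in> GL2_Zp" "k2 \<in> GL2_Zp" "A' = k ** A ** k1" "B' = k ** B ** k2"
    using triple_invariant_eq_imp_orbit[OF d] eq by (metis A A')
  then show ?thesis using orbit_fun_apply[OF f] d by (simp add: A A')
qed

text \<open>A compact support meets finitely many right cosets classes modulo \<open>Gp0\<close>,
  and both \<open>f\<close> and the invariant are constant on each of them.\<close>

lemma finite_triple_invariant_support:
  assumes f: "f \<in> carrier cmod" shows "finite (triple_invariant ` {x. f x \<noteq> 0})"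
proof -
  have "finite {q \<in> Q. f q \<noteq> 0}"
    using f by (intro G.compactly_supported_imp_finite) (simp add: cmod_carrier)
  moreover have "triple_invariant ` {x. f x \<noteq> 0} \<subseteq> triple_invariant ` {q \<in> Q. f q \<noteq> 0}"
  proof
    fix t assume "t \<in> triple_invariant ` {x. f x \<noteq> 0}"
    then obtain z where z: "t = triple_invariant z" "f z \<noteq> 0" by blast
    obtain A B where AB: "z = (A, B)" by force
    have nz: "f (A, B) \<noteq> 0" using z AB by simp
    then have AB': "(A, B) \<in> carrier Gp" using f unfolding cmod_carrier compactly_supported_def by blast
    obtain q k where q: "q \<in> Q" "k \<in> Gp0" "(A, B) = q \<otimes>\<^bsub>Gp\<^esub> k" by (rule G.R_exists[OF AB'])
    obtain C D where C: "q = (C, D)" by force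
    obtain k1 k2 where k: "k = (k1, k2)" by force
    have kC: "A = C ** k1" "B = D ** k2" "k1 \<in> GL2_Zp" "k2 \<in> GL2_Zp" using q by (auto simp: C k)
    have d: "det C \<noteq> 0" "det D \<noteq> 0" using G.R_carrier[OF q(1)] by (auto simp: C carrier_GL2)
    have t: "triple_invariant (A, B) = triple_invariant (C, D)"
      using triple_invariant_orbit[of "mat 1" k1 k2 C D] kC d by simp
    have "f (A, B) = f (C, D)"
      using f AB' d t by (intro orbit_fun_triple_invariant) (auto simp: cmod_carrier carrier_GL2)
    then show "t \<in> triple_invariant ` {q \<in> Q. f q \<noteq> 0}"
      using t nz q(1) z(1) by (intro image_eqI[of _ _ q]) (simp_all add: C AB)
  qed
  ultimately show ?thesis by (meson finite_imageI finite_subset)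
qed

definition orbit_ind :: "real \<times> real \<times> real \<times> real \<times> real \<Rightarrow> 'p padic_mat \<times> 'p padic_mat \<Rightarrow> complex" where
  "orbit_ind t x = (if x \<in> triples \<and> triple_invariant x = t then 1 else 0)"

lemma orbit_decomposition:
  assumes f: "f \<in> carrier cmod"
  obtains c where "\<And>x. f x = (\<Sum>t\<in>triple_invariant ` {x. f x \<noteq> 0}. c t * orbit_ind t x)"
    "\<And>x. x \<in> triples \<Longrightarrow> c (triple_invariant x) = f x"
proof -
  \<comment> \<open>The value of \<open>f\<close> at a chosen triple with invariant
    \<open>t\<close>. For a \<open>t\<close> that no triple has, the value is arbitrary and
    \<open>orbit_ind t\<close> is zero.\<close>
  define c where "c t = f (SOME x. x \<in> triples \<and> triple_invariant x = t)" for t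
  have inv: "orbit_fun f" using f by (simp add: cmod_carrier)
  have c: "c (triple_invariant x) = f x" if "x \<in> triples" for x
  proof -
    have *: "(SOME y. y \<in> triples \<and> triple_invariant y = triple_invariant x) \<in> triples \<and>
        triple_invariant (SOME y. y \<in> triples \<and> triple_invariant y = triple_invariant x) = triple_invariant x"
      by (rule someI[of _ x]) (use that in simp)
    show ?thesis
      unfolding c_def by (rule orbit_fun_triple_invariant[OF inv conjunct1[OF *] that conjunct2[OF *]])
  qed
  have "f x = (\<Sum>t\<in>triple_invariant ` {x. f x \<noteq> 0}. c t * orbit_ind t x)" for x
  proof (cases "f x = 0")
    case False
    then have x: "x \<in> triples" using f unfolding cmod_carrier compactly_supported_def triples_eq by blast
    have "(\<Sum>t\<in>triple_invariant ` {x. f x \<noteq> 0}. c t * orbit_ind t x) =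
        (\<Sum>t\<in>triple_invariant ` {x. f x \<noteq> 0}. if t = triple_invariant x then f x else 0)"
      using x c[OF x] by (intro sum.cong) (auto simp: orbit_ind_def)
    also have "\<dots> = f x" using finite_triple_invariant_support[OF f] False by simp
    finally show ?thesis by simp
  next
    case True
    have "c t * orbit_ind t x = 0" for t using True c by (auto simp: orbit_ind_def)
    then have "(\<Sum>t\<in>triple_invariant ` {x. f x \<noteq> 0}. c t * orbit_ind t x) = 0" by (intro sum.neutral) blast
    then show ?thesis using True by simp
  qed
  then show thesis using that c by blast
qed

definition ch :: "'p padic_mat \<times> 'p padic_mat \<Rightarrow> complex" where "ch = indicator Gp0"

lemma ch_orbit_fun: "orbit_fun ch"
  unfolding M.act_inv_def ch_def
proof safe
  fix k1 k2 k A B :: "'p padic_mat"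
  assume k: "k1 \<in> Hp0" "k2 \<in> Hp0" "k \<in> Hp0"
  have "minv k ** C ** l \<in> GL2_Zp \<longleftrightarrow> C \<in> GL2_Zp" if "l \<in> GL2_Zp" for C l
    using that k by (simp add: GL2_Zp_iff[of "_ ** _"] GL2_Zp_minv) (simp add: GL2_Zp_iff)
  then show "(indicator Gp0 (act ((k1, k2), k) (A, B)) :: complex) = indicator Gp0 (A, B)"
    using k by (simp add: indicator_def)
qed

lemma ch_closed: "ch \<in> carrier cmod"
proof -
  have "compactly_supported Gp ch"
    unfolding compactly_supported_def ch_def
    by (intro exI[of _ Gp0])
      (auto simp: compact_Times compact_GL2_Zp carrier_GL2 GL2_Zp_det indicator_def)
  then show ?thesis using ch_orbit_fun by (simp add: cmod_carrier)
qed

definition cyclic_submodule :: "('p padic_mat \<times> 'p padic_mat \<Rightarrow> complex) set" where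
  "cyclic_submodule = (\<lambda>\<Phi>. M.hact \<Phi> ch) ` T.P.hfun"

lemma cyclic_submoduleI: "\<Phi> \<in> T.P.hfun \<Longrightarrow> M.hact \<Phi> ch \<in> cyclic_submodule"
  unfolding cyclic_submodule_def by (rule imageI)

lemma cyclic_submoduleE:
  assumes "f \<in> cyclic_submodule" obtains \<Phi> where "\<Phi> \<in> T.P.hfun" "f = M.hact \<Phi> ch"
  using assms unfolding cyclic_submodule_def by (rule imageE)

lemma cyclic_submodule_add:
  assumes "f \<in> cyclic_submodule" "f' \<in> cyclic_submodule" shows "(\<lambda>x. f x + f' x) \<in> cyclic_submodule"
proof -
  obtain \<Phi> where \<Phi>: "\<Phi> \<in> T.P.hfun" "f = M.hact \<Phi> ch" using assms(1) by (rule cyclic_submoduleE)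
  obtain \<Psi> where \<Psi>: "\<Psi> \<in> T.P.hfun" "f' = M.hact \<Psi> ch" using assms(2) by (rule cyclic_submoduleE)
  show ?thesis
    unfolding \<Phi>(2) \<Psi>(2) M.hact_add_left[OF \<Phi>(1) \<Psi>(1), symmetric]
    by (intro cyclic_submoduleI T.P.hfun_add \<Phi>(1) \<Psi>(1))
qed

lemma cyclic_submodule_scale:
  assumes "f \<in> cyclic_submodule" shows "(\<lambda>x. c * f x) \<in> cyclic_submodule"
proof -
  obtain \<Phi> where \<Phi>: "\<Phi> \<in> T.P.hfun" "f = M.hact \<Phi> ch" using assms(1) by (rule cyclic_submoduleE)
  show ?thesis
    unfolding \<Phi>(2) M.hact_scale_left[symmetric] by (intro cyclic_submoduleI T.P.hfun_scale \<Phi>(1))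
qed

lemma cyclic_submodule_zero: "(\<lambda>_. 0) \<in> cyclic_submodule"
  unfolding cyclic_submodule_def by (rule image_eqI[OF _ T.P.hfun_zero]) (auto simp: M.hact_def csum_def)

lemma cyclic_submodule_sum:
  "finite I \<Longrightarrow> (\<And>i. i \<in> I \<Longrightarrow> f i \<in> cyclic_submodule) \<Longrightarrow>
    (\<lambda>x. \<Sum>i\<in>I. c i * f i x) \<in> cyclic_submodule"
proof (induction I rule: finite_induct)
  case (insert i I)
  then have "(\<lambda>x. c i * f i x + (\<Sum>i\<in>I. c i * f i x)) \<in> cyclic_submodule"
    by (intro cyclic_submodule_add cyclic_submodule_scale) auto
  then show ?case using insert.hyps by simp
qed (simp add: cyclic_submodule_zero)

lemma hact_ch_leading:
  assumes x: "x \<in> triples"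
  obtains F where "F \<in> cyclic_submodule" "F x \<noteq> 0"
    "\<And>y. F y \<noteq> 0 \<Longrightarrow> y \<in> triples \<and> (triple_invariant y = triple_invariant x \<or> weight y < weight x)"
proof -
  obtain A B where A: "x = (A, B)" and d: "det A \<noteq> 0" "det B \<noteq> 0" using x by auto
  obtain h where h: "det h \<noteq> 0" and D: "disp h * disp (minv A ** h) = disp A"
    "disp h * disp (minv B ** h) = disp B" "disp (minv A ** h) * disp (minv B ** h) = disp (minv A ** B)"
    using tripod_centre[OF d] by blast
  \<comment> \<open>These elements bring the second and third vertices to the centre, as
    \<open>h\<close> does for the first: \<open>act ((?a, ?b), h)\<close> sends \<open>x\<close> to
    \<open>(mat 1, mat 1)\<close>.\<close>
  let ?a = "minv A ** h" and ?b = "minv B ** h"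
  have dab: "det ?a \<noteq> 0" "det ?b \<noteq> 0" using d h by (simp_all add: det_mul det_minv)
  define C where "C = (shell ?a \<times> shell ?b) \<times> shell h"
  define \<Phi> :: "('p padic_mat \<times> 'p padic_mat) \<times> 'p padic_mat \<Rightarrow> complex"
    where "\<Phi> = pure_tensor (indicator (shell ?a \<times> shell ?b)) (indicator (shell h))"
  have \<Phi>_ind: "\<Phi> \<gamma> = indicator C \<gamma>" for \<gamma>
    by (cases \<gamma>) (simp add: \<Phi>_def C_def pure_tensor_def indicator_def)
  have "(indicator (shell ?a \<times> shell ?b) :: _ \<Rightarrow> complex) \<in> G.hfun"
  proof (rule haar_pair_hfun_of_compact[OF G.haar_pair_axioms compact_Times[OF compact_shell compact_shell]])
    show "shell ?a \<times> shell ?b \<subseteq> carrier Gp"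
      unfolding triples_eq by (intro Sigma_mono shell_carrier dab)
    fix k z :: "'p padic_mat \<times> 'p padic_mat" assume "k \<in> Gp0"
    then show "(k \<otimes>\<^bsub>Gp\<^esub> z \<in> shell ?a \<times> shell ?b \<longleftrightarrow> z \<in> shell ?a \<times> shell ?b) \<and>
        (z \<otimes>\<^bsub>Gp\<^esub> k \<in> shell ?a \<times> shell ?b \<longleftrightarrow> z \<in> shell ?a \<times> shell ?b)"
      by (cases k, cases z) simp
  qed
  moreover have "(indicator (shell h) :: _ \<Rightarrow> complex) \<in> H.hfun"
    by (rule haar_pair_hfun_of_compact[OF H.haar_pair_axioms compact_shell])
      (simp_all add: carrier_GL2 shell_carrier h)
  ultimately have \<Phi>: "\<Phi> \<in> T.P.hfun" unfolding \<Phi>_def by (rule T.pure_tensor_hfun)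
  let ?F = "M.hact \<Phi> ch"
  let ?S = "{\<gamma> \<in> Q \<times> R. \<Phi> \<gamma> \<noteq> 0}"
  \<comment> \<open>The value is a number of cosets, so one representative suffices for it to be
    nonzero.\<close>
  have F: "?F y = of_nat (card {\<gamma> \<in> ?S. act \<gamma> y \<in> Gp0})" if "y \<in> triples" for y
  proof -
    have "?F y = (\<Sum>\<gamma>\<in>?S. if act \<gamma> y \<in> Gp0 then 1 else 0)"
      unfolding M.hact_eq_sum[OF \<Phi> that] by (intro sum.cong) (auto simp: \<Phi>_ind ch_def indicator_def)
    also have "\<dots> = of_nat (card {\<gamma> \<in> ?S. act \<gamma> y \<in> Gp0})"
      using T.P.hfun_finite[OF \<Phi>] by (subst sum.inter_filter[symmetric]) auto
    finally show ?thesis .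
  qed
  have "?F x \<noteq> 0"
  proof -
    have g0: "((?a, ?b), h) \<in> carrier (Gp \<times>\<times> Hp)" using dab h by (simp add: carrier_GL2)
    \<comment> \<open>The triple of matrices at the centre need not be a representative; right
      invariance of the summand moves its nonzero contribution to one.\<close>
    obtain r k where r: "r \<in> Q \<times> R" "k \<in> Gp0 \<times> Hp0" "((?a, ?b), h) = r \<otimes>\<^bsub>Gp \<times>\<times> Hp\<^esub> k"
      by (rule T.P.R_exists[OF g0])
    have "act ((?a, ?b), h) x = (mat 1, mat 1)"
    proof -
      have "minv h ** X ** (minv X ** h) = mat 1" if "det X \<noteq> 0" for X
      proof -
        have "minv h ** X ** (minv X ** h) = minv h ** (X ** minv X) ** h" by (simp only: matrix_mul_assoc)
        then show ?thesis using that h by (simp add: minv_right minv_left)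
      qed
      then show ?thesis using d by (simp add: A)
    qed
    then have "\<Phi> ((?a, ?b), h) * ch (act ((?a, ?b), h) x) = 1"
      by (simp add: \<Phi>_ind C_def shell_self ch_def)
    moreover have "\<Phi> ((?a, ?b), h) * ch (act ((?a, ?b), h) x) = \<Phi> r * ch (act r x)"
      using M.rinv_hact[OF \<Phi> ch_orbit_fun x] r(2) T.P.R_carrier[OF r(1)] unfolding T.P.rinv_def r(3) by blast
    ultimately have "\<Phi> r * ch (act r x) = 1" by simp
    then have "\<Phi> r \<noteq> 0" "ch (act r x) \<noteq> 0" by auto
    then have rS: "r \<in> {\<gamma> \<in> ?S. act \<gamma> x \<in> Gp0}" using r(1) by (simp add: ch_def indicator_eq_0_iff)
    have fin: "finite {\<gamma> \<in> ?S. act \<gamma> x \<in> Gp0}"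
      by (rule finite_subset[OF _ T.P.hfun_finite[OF \<Phi>]]) blast
    have "card {\<gamma> \<in> ?S. act \<gamma> x \<in> Gp0} \<noteq> 0"
      unfolding card_0_eq[OF fin] by (rule notI) (use rS in \<open>simp only: empty_iff\<close>)
    then show ?thesis unfolding F[OF x] by (simp only: of_nat_eq_0_iff not_False_eq_True)
  qed
  moreover have "y \<in> triples \<and> (triple_invariant y = triple_invariant x \<or> weight y < weight x)" if nz: "?F y \<noteq> 0" for y
  proof -
    have y: "y \<in> triples" using nz by (auto simp: M.hact_def split: if_splits)
    obtain A' B' where A': "y = (A', B')" and d': "det A' \<noteq> 0" "det B' \<noteq> 0" using y by auto
    have "{\<gamma> \<in> ?S. act \<gamma> y \<in> Gp0} \<noteq> {}"
    proof
      assume "{\<gamma> \<in> ?S. act \<gamma> y \<in> Gp0} = {}"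
      then show False using nz unfolding F[OF y] by (simp only: card.empty of_nat_0)
    qed
    then obtain \<gamma> where \<gamma>_mem: "\<gamma> \<in> {\<gamma> \<in> ?S. act \<gamma> y \<in> Gp0}" unfolding ex_in_conv[symmetric] by (elim exE)
    have \<gamma>: "\<Phi> \<gamma> \<noteq> 0" "act \<gamma> y \<in> Gp0" 
      by (rule conjunct2[OF conjunct1[OF \<gamma>_mem[unfolded mem_Collect_eq]]],
          rule conjunct2[OF \<gamma>_mem[unfolded mem_Collect_eq]])
    obtain g1 g2 h' where \<gamma>': "\<gamma> = ((g1, g2), h')" by (metis prod.collapse)
    have "\<gamma> \<in> C" using \<gamma>(1) by (simp add: \<Phi>_ind indicator_eq_0_iff)
    then have g: "g1 \<in> shell ?a" "g2 \<in> shell ?b" "h' \<in> shell h"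
      "minv h' ** A' ** g1 \<in> GL2_Zp" "minv h' ** B' ** g2 \<in> GL2_Zp"
      using \<gamma>(2) by (simp_all add: C_def \<gamma>' A')
    have dg: "det g1 \<noteq> 0" "det g2 \<noteq> 0" "det h' \<noteq> 0"
      using g(1-3) shell_carrier dab h by blast+
    define k1 k2 where "k1 = minv h' ** A' ** g1" and "k2 = minv h' ** B' ** g2"
    have kk: "k1 \<in> GL2_Zp" "k2 \<in> GL2_Zp" using g by (simp_all add: k1_def k2_def)
    \<comment> \<open>The two memberships in \<open>GL2_Zp\<close> say that \<open>h'\<close>,
      \<open>A' ** g1\<close> and \<open>B' ** g2\<close> give one lattice. Solving for
      \<open>A'\<close> and \<open>B'\<close> exhibits it as a vertex at the prescribed distances
      from all three members.\<close>
    have solve: "X = h' ** (minv h' ** X ** Y) ** minv Y" if "det Y \<noteq> 0" for X Y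
    proof -
      have "h' ** (minv h' ** X ** Y) ** minv Y = (h' ** minv h') ** X ** (Y ** minv Y)"
        by (simp only: matrix_mul_assoc)
      then show ?thesis using that dg by (simp add: minv_right)
    qed
    have AB': "A' = h' ** k1 ** minv g1" "B' = h' ** k2 ** minv g2"
      unfolding k1_def k2_def using solve dg by blast+
    note sd = g(1-3)[THEN shell_disp]
    have dA: "disp A' \<le> disp A"
    proof -
      have "disp A' \<le> disp (h' ** k1) * disp (minv g1)"
        unfolding AB' using dg kk by (intro disp_mult_le) (auto simp: det_mul det_minv GL2_Zp_det)
      also have "\<dots> = disp A" using dg kk D by (simp add: disp_minv sd)
      finally show ?thesis .
    qed
    have dB: "disp B' \<le> disp B"
    proof -
      have "disp B' \<le> disp (h' ** k2) * disp (minv g2)"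
        unfolding AB' using dg kk by (intro disp_mult_le) (auto simp: det_mul det_minv GL2_Zp_det)
      also have "\<dots> = disp B" using dg kk D by (simp add: disp_minv sd)
      finally show ?thesis .
    qed
    have dAB: "disp (minv A' ** B') \<le> disp (minv A ** B)"
    proof -
      have "minv A' ** B' = g1 ** minv k1 ** (minv h' ** h') ** k2 ** minv g2"
        using dg kk unfolding AB' by (simp add: minv_mult minv_minv det_mul det_minv GL2_Zp_det matrix_mul_assoc)
      then have "minv A' ** B' = g1 ** minv k1 ** (k2 ** minv g2)"
        using dg by (simp add: minv_left matrix_mul_assoc)
      then have "disp (minv A' ** B') \<le> disp (g1 ** minv k1) * disp (k2 ** minv g2)"
        using dg kk disp_mult_le[of "g1 ** minv k1" "k2 ** minv g2"] by (simp add: det_mul det_minv GL2_Zp_det)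
      also have "\<dots> = disp (minv A ** B)" using dg kk D by (simp add: disp_minv GL2_Zp_minv sd)
      finally show ?thesis .
    qed
    \<comment> \<open>The shells prescribe the norms of determinants, so the homothety invariants
      agree for every triple in the support, not only in the equality case.\<close>
    have detA: "padic_norm (det A') = padic_norm (det A)" "padic_norm (det B') = padic_norm (det B)"
    proof -
      have n: "padic_norm (det k1) = 1" "padic_norm (det k2) = 1" using kk by (simp_all add: GL2_Zp_iff)
      show "padic_norm (det A') = padic_norm (det A)" "padic_norm (det B') = padic_norm (det B)"
        unfolding AB' using dg d h g(1-3)[THEN shell_det] n
        by (simp_all add: det_mul det_minv padic_norm_mult padic_norm_divide divide_inverse padic_norm_inverse)
    qed
    have pos: "0 < disp A'" "0 < disp B'" "0 < disp (minv A' ** B')"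
      using d' disp_ge_1[of A'] disp_ge_1[of B'] disp_ge_1[of "minv A' ** B'"] by (auto simp: det_mul det_minv)
    have le: "weight y \<le> weight x"
      using dA dB dAB pos unfolding weight_def A A' by (auto intro!: mult_mono)
    moreover have "triple_invariant y = triple_invariant x" if "weight y = weight x"
      using mult_le_mult_eq[OF pos dA dB dAB] that detA by (simp add: weight_def triple_invariant_def A A')
    ultimately show ?thesis using y by (auto simp: order_le_less)
  qed
  moreover have "?F \<in> cyclic_submodule" using \<Phi> by (rule cyclic_submoduleI)
  ultimately show thesis by (intro that[of ?F])
qed

lemma cyclic_submodule_closed: "f \<in> cyclic_submodule \<Longrightarrow> f \<in> carrier cmod"
  unfolding cyclic_submodule_def using hact_closed ch_closed by blast

lemma orbit_ind_cyclic_submodule: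
  assumes "x \<in> triples" shows "orbit_ind (triple_invariant x) \<in> cyclic_submodule"
proof -
  obtain n where "weight x = real CARD('p) ^ n" using weight_power[OF assms] by blast
  then show ?thesis using assms
  proof (induction n arbitrary: x rule: less_induct)
    case (less n)
    obtain F where F: "F \<in> cyclic_submodule" "F x \<noteq> 0"
      "\<And>y. F y \<noteq> 0 \<Longrightarrow> y \<in> triples \<and> (triple_invariant y = triple_invariant x \<or> weight y < weight x)"
      using hact_ch_leading[OF less.prems(2)] by blast
    have FM: "F \<in> carrier cmod" by (rule cyclic_submodule_closed[OF F(1)])
    obtain c where c: "\<And>y. F y = (\<Sum>t\<in>triple_invariant ` {x. F x \<noteq> 0}. c t * orbit_ind t y)"
      "\<And>y. y \<in> triples \<Longrightarrow> c (triple_invariant y) = F y" using orbit_decomposition[OF FM] by blast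
    let ?T = "triple_invariant ` {x. F x \<noteq> 0}"
    have fin: "finite ?T" by (rule finite_triple_invariant_support[OF FM])
    have low: "(\<lambda>y. \<Sum>t\<in>?T - {triple_invariant x}. c t * orbit_ind t y) \<in> cyclic_submodule"
    proof (rule cyclic_submodule_sum)
      fix t assume "t \<in> ?T - {triple_invariant x}"
      then obtain y where y: "t = triple_invariant y" "F y \<noteq> 0" "triple_invariant y \<noteq> triple_invariant x" by auto
      then have y': "y \<in> triples" "weight y < weight x" using F(3) by blast+
      obtain m where m: "weight y = real CARD('p) ^ m" using weight_power[OF y'(1)] by blast
      \<comment> \<open>Since \<open>p > 1\<close>, comparing weights compares their exponents,
        which are natural numbers.\<close>
      then have "m < n" using y'(2) less.prems(1) card_gt_1[where 'p='p] by simp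
      then show "orbit_ind t \<in> cyclic_submodule" using less.IH m y'(1) y(1) by simp
    qed (use fin in simp)
    \<comment> \<open>The leading coefficient is \<open>F x\<close>, which is nonzero, so the
      expansion of \<open>F\<close> can be solved for its leading orbit function.\<close>
    have eq: "orbit_ind (triple_invariant x) =
        (\<lambda>y. (1 / F x) * (F y + (- 1) * (\<Sum>t\<in>?T - {triple_invariant x}. c t * orbit_ind t y)))"
    proof
      fix y
      have "triple_invariant x \<in> ?T" using F(2) by blast
      then have "F y = c (triple_invariant x) * orbit_ind (triple_invariant x) y +
          (\<Sum>t\<in>?T - {triple_invariant x}. c t * orbit_ind t y)"
        using fin unfolding c(1)[of y] by (rule sum.remove[rotated])
      then show "orbit_ind (triple_invariant x) y =
          (1 / F x) * (F y + (- 1) * (\<Sum>t\<in>?T - {triple_invariant x}. c t * orbit_ind t y))"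
        using F(2) c(2)[OF less.prems(2)] by simp
    qed
    show ?case unfolding eq by (intro cyclic_submodule_scale cyclic_submodule_add F(1) low)
  qed
qed

lemma cmod_eq_cyclic_submodule: "carrier cmod = cyclic_submodule"
proof
  show "carrier cmod \<subseteq> cyclic_submodule"
  proof
    fix f assume f: "f \<in> carrier cmod"
    obtain c where c: "\<And>x. f x = (\<Sum>t\<in>triple_invariant ` {x. f x \<noteq> 0}. c t * orbit_ind t x)"
      using orbit_decomposition[OF f] by blast
    have "(\<lambda>x. \<Sum>t\<in>triple_invariant ` {x. f x \<noteq> 0}. c t * orbit_ind t x) \<in> cyclic_submodule"
    proof (rule cyclic_submodule_sum[OF finite_triple_invariant_support[OF f]])
      fix t assume "t \<in> triple_invariant ` {x. f x \<noteq> 0}"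
      then obtain x where "t = triple_invariant x" "f x \<noteq> 0" by blast
      moreover then have "x \<in> triples"
        using f unfolding cmod_carrier compactly_supported_def triples_eq by blast
      ultimately show "orbit_ind t \<in> cyclic_submodule" using orbit_ind_cyclic_submodule by simp
    qed
    moreover have "f = (\<lambda>x. \<Sum>t\<in>triple_invariant ` {x. f x \<noteq> 0}. c t * orbit_ind t x)" using c by (intro ext)
    ultimately show "f \<in> cyclic_submodule" by metis
  qed
qed (use cyclic_submodule_closed in blast)

lemma cyclic: "cyclic_module_generated_by (hecke_ring \<mu>G \<mu>H) cmod (indicator Gp0)"
proof -
  have R: "carrier (hecke_ring \<mu>G \<mu>H) = T.P.hfun"
    by (simp only: hecke_ring_def T.tensor_carrier)
  have "{\<Phi> \<odot>\<^bsub>cmod\<^esub> ch | \<Phi>. \<Phi> \<in> T.P.hfun} = (\<lambda>\<Phi>. \<Phi> \<odot>\<^bsub>cmod\<^esub> ch) ` T.P.hfun"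
    by (rule Setcompr_eq_image)
  also have "\<dots> = cyclic_submodule"
    unfolding cyclic_submodule_def by (intro image_cong refl cmod_smult ch_orbit_fun)
  finally show ?thesis
    using left_module_cmod ch_closed cmod_eq_cyclic_submodule
    unfolding cyclic_module_generated_by_def ch_def R by blast
qed

end

theorem theorem3p1:
  fixes \<mu>H :: "('p::prime_card padic_mat) measure"
    and \<mu>G :: "('p padic_mat \<times> 'p padic_mat) measure"
  assumes "haar_measure Hp \<mu>H" and "emeasure \<mu>H Hp0 = 1"
    and "haar_measure Gp \<mu>G" and "emeasure \<mu>G Gp0 = 1"
  shows "cyclic_module_generated_by (hecke_ring \<mu>G \<mu>H) (coset_module \<mu>G \<mu>H) (indicator Gp0)"
proof -
  \<comment> \<open>Any choice of representatives serves, as the conclusion does not mention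
    them.\<close>
  obtain R :: "'p padic_mat set" where R: "transversal Hp Hp0 R"
    using transversal_exists[OF group_GL2 subgroup_GL2_Zp] by blast
  interpret H: haar_pair Hp Hp0 R \<mu>H by (rule haar_pair_Hp[OF assms(1,2) R])
  interpret G: haar_pair Gp Gp0 "R \<times> R" \<mu>G
    by (rule haar_pair_Gp[OF assms(3,4) transversal_DirProd[OF R R]])
  interpret hecke_module_setup R "R \<times> R" \<mu>H \<mu>G ..
  show ?thesis by (rule cyclic)
qed

end
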